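(* Let $1<p<\infty$, $1/p+1/q=1$, and let $T_p(a)+H_p(b)\in\mathcal L^{p,q}$. Then the Fourier transform $\mathcal F$, $h\mapsto(\hat h_n)_{n\in\mathbb Z_+}$, restricts to an isomorphism from $\ker(\mathbf T_q(a)+\mathbf H_q(b))\subset H^q$ onto $\ker(T_p(a)+H_p(b))\subset l^p$.
   Context: $l^p=l^p(\mathbb Z_+)$ is the space of $p$-summable complex sequences indexed by nonnegative integers, viewed inside $l^p(\mathbb Z)$. For $a\in L^\infty(\mathbb T)$ with Fourier coefficients $\hat a_k$, the Laurent operator $L(a)$ acts on finitely supported sequences by $(L(a)x)_k=\sum_m\hat a_{k-m}x_m$; $a$ is a multiplier on $l^p(\mathbb Z)$, written $a\in M^p$, if $L(a)$ extends to a bounded operator on $l^p(\mathbb Z)$. For $a\in M^p$, the Toeplitz and Hankel operators on $l^p$ are $T_p(a):(\xi_j)\mapsto(\sum_{k\ge0}\hat a_{j-k}\xi_k)_{j\ge0}$ and $H_p(a):(\xi_j)\mapsto(\sum_{k\ge0}\hat a_{j+k+1}\xi_k)_{j\ge0}$. For $a,b\in L^\infty(\mathbb T)$, $\mathbf T_s(a)+\mathbf H_s(b)$ denotes the classical Toeplitz plus Hankel operator on the Hardy space $H^s(\mathbb T)$, $\mathbf T_s(a)f=P(af)$, $\mathbf H_s(b)f=P(bQJf)$, with $P$ the Riesz projection, $Q=I-P$, $(Jf)(t)=t^{-1}f(t^{-1})$. $\mathcal L^{p,q}$ denotes the class of operators $T_p(a)+H_p(b)$ such that: $a,b\in M^p$;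 $T_p(a)+H_p(b)$ is Fredholm on $l^p$; $\mathbf T_q(a)+\mathbf H_q(b)$ is Fredholm on $H^q$; and these two operators have the same Fredholm index. *)

theory Defs
  imports "HOL-Analysis.Analysis"
begin

text \<open>A function on the unit circle T is represented as f :: complex => complex;
only its values f (cis theta), theta in [0, 2 pi], matter.  Lebesgue measure on
[0, 2 pi] is used (via the parametrisation theta |-> cis theta).\<close>

definition fcoef :: "(complex \<Rightarrow> complex) \<Rightarrow> int \<Rightarrow> complex" where
  "fcoef f n = (LINT \<theta>:{0..2*pi}|lebesgue. f (cis \<theta>) * cis (- (of_int n * \<theta>)))
                 / complex_of_real (2 * pi)"

definition Linf :: "(complex \<Rightarrow> complex) \<Rightarrow> bool" where
  "Linf a \<longleftrightarrow> set_borel_measurable lebesgue {0..2*pi} (\<lambda>\<theta>. a (cis \<theta>)) \<and>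
     (\<exists>M. AE \<theta> in lebesgue. \<theta> \<in> {0..2*pi} \<longrightarrow> norm (a (cis \<theta>)) \<le> M)"

definition Lspace :: "real \<Rightarrow> (complex \<Rightarrow> complex) \<Rightarrow> bool" where
  "Lspace s f \<longleftrightarrow> set_borel_measurable lebesgue {0..2*pi} (\<lambda>\<theta>. f (cis \<theta>)) \<and>
     set_integrable lebesgue {0..2*pi} (\<lambda>\<theta>. norm (f (cis \<theta>)) powr s)"

definition Lnorm :: "real \<Rightarrow> (complex \<Rightarrow> complex) \<Rightarrow> real" where
  "Lnorm s f = ((LINT \<theta>:{0..2*pi}|lebesgue. norm (f (cis \<theta>)) powr s) / (2 * pi)) powr (1 / s)"

definition null_T :: "(complex \<Rightarrow> complex) set" where
  "null_T = {f. AE \<theta> in lebesgue. \<theta> \<in> {0..2*pi} \<longrightarrow> f (cis \<theta>) = 0}"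

definition Hardy :: "real \<Rightarrow> (complex \<Rightarrow> complex) set" where
  "Hardy s = {f. Lspace s f \<and> (\<forall>n<0. fcoef f n = 0)}"

text \<open>Riesz projection on L^s: the L^s function whose Fourier coefficients are those of g
  for nonnegative indices and 0 for negative ones (exists for 1 < s < infinity by M. Riesz).\<close>
definition riesz_proj :: "real \<Rightarrow> (complex \<Rightarrow> complex) \<Rightarrow> (complex \<Rightarrow> complex)" where
  "riesz_proj s g = (SOME h. Lspace s h \<and> (\<forall>n. fcoef h n = (if 0 \<le> n then fcoef g n else 0)))"

definition flipJ :: "(complex \<Rightarrow> complex) \<Rightarrow> (complex \<Rightarrow> complex)" where
  "flipJ f = (\<lambda>t. inverse t * f (inverse t))"

definition TH_Hardy :: "real \<Rightarrow> (complex \<Rightarrow> complex) \<Rightarrow> (complex \<Rightarrow> complex)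
                         \<Rightarrow> (complex \<Rightarrow> complex) \<Rightarrow> (complex \<Rightarrow> complex)" where
  "TH_Hardy s a b f = (\<lambda>t. riesz_proj s (\<lambda>z. a z * f z) t
       + riesz_proj s (\<lambda>z. b z * (flipJ f z - riesz_proj s (flipJ f) z)) t)"

definition lpZ :: "real \<Rightarrow> (int \<Rightarrow> complex) \<Rightarrow> bool" where
  "lpZ p x \<longleftrightarrow> (\<lambda>k. norm (x k) powr p) summable_on UNIV"

definition lpZnorm :: "real \<Rightarrow> (int \<Rightarrow> complex) \<Rightarrow> real" where
  "lpZnorm p x = (\<Sum>\<^sub>\<infinity>k. norm (x k) powr p) powr (1 / p)"

definition lp :: "real \<Rightarrow> (nat \<Rightarrow> complex) set" where
  "lp p = {x. summable (\<lambda>n. norm (x n) powr p)}"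

definition lpnorm :: "real \<Rightarrow> (nat \<Rightarrow> complex) \<Rightarrow> real" where
  "lpnorm p x = (\<Sum>n. norm (x n) powr p) powr (1 / p)"

text \<open>Laurent operator on finitely supported sequences.\<close>
definition laurent :: "(complex \<Rightarrow> complex) \<Rightarrow> (int \<Rightarrow> complex) \<Rightarrow> (int \<Rightarrow> complex)" where
  "laurent a x = (\<lambda>k. \<Sum>m\<in>{m. x m \<noteq> 0}. fcoef a (k - m) * x m)"

text \<open>Multipliers M^p: a in L^infinity whose Laurent operator extends boundedly to l^p(Z),
  i.e. is bounded on the (dense) finitely supported sequences.\<close>
definition multiplier :: "real \<Rightarrow> (complex \<Rightarrow> complex) \<Rightarrow> bool" where
  "multiplier p a \<longleftrightarrow> Linf a \<and>
     (\<exists>C. \<forall>x. finite {k. x k \<noteq> 0} \<longrightarrow>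
          lpZ p (laurent a x) \<and> lpZnorm p (laurent a x) \<le> C * lpZnorm p x)"

definition toeplitz_lp :: "(complex \<Rightarrow> complex) \<Rightarrow> (nat \<Rightarrow> complex) \<Rightarrow> (nat \<Rightarrow> complex)" where
  "toeplitz_lp a \<xi> = (\<lambda>j. \<Sum>k. fcoef a (int j - int k) * \<xi> k)"

definition hankel_lp :: "(complex \<Rightarrow> complex) \<Rightarrow> (nat \<Rightarrow> complex) \<Rightarrow> (nat \<Rightarrow> complex)" where
  "hankel_lp b \<xi> = (\<lambda>j. \<Sum>k. fcoef b (int j + int k + 1) * \<xi> k)"

definition TH_lp :: "(complex \<Rightarrow> complex) \<Rightarrow> (complex \<Rightarrow> complex) \<Rightarrow> (nat \<Rightarrow> complex) \<Rightarrow> (nat \<Rightarrow> complex)" where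
  "TH_lp a b \<xi> = (\<lambda>j. toeplitz_lp a \<xi> j + hankel_lp b \<xi> j)"

text \<open>V: the space (a set of functions 'x => complex), N: elements identified with 0,
  nrm: the (semi)norm, T: the operator.\<close>

definition ker_op :: "('x \<Rightarrow> complex) set \<Rightarrow> ('x \<Rightarrow> complex) set \<Rightarrow>
     (('x \<Rightarrow> complex) \<Rightarrow> ('x \<Rightarrow> complex)) \<Rightarrow> ('x \<Rightarrow> complex) set" where
  "ker_op V N T = {x \<in> V. T x \<in> N}"

definition spans_mod :: "('x \<Rightarrow> complex) set \<Rightarrow> ('x \<Rightarrow> complex) set \<Rightarrow> ('x \<Rightarrow> complex) set \<Rightarrow> bool" where
  "spans_mod N B K \<longleftrightarrow> (\<forall>x\<in>K. \<exists>c. (\<lambda>t. x t - (\<Sum>b\<in>B. c b * b t)) \<in> N)"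

definition dim_mod :: "('x \<Rightarrow> complex) set \<Rightarrow> ('x \<Rightarrow> complex) set \<Rightarrow> nat" where
  "dim_mod N K = (LEAST n. \<exists>B. finite B \<and> B \<subseteq> K \<and> card B = n \<and> spans_mod N B K)"

definition cospans :: "('x \<Rightarrow> complex) set \<Rightarrow> ('x \<Rightarrow> complex) set \<Rightarrow>
     (('x \<Rightarrow> complex) \<Rightarrow> ('x \<Rightarrow> complex)) \<Rightarrow> ('x \<Rightarrow> complex) set \<Rightarrow> bool" where
  "cospans V N T B \<longleftrightarrow>
     (\<forall>y\<in>V. \<exists>x\<in>V. \<exists>c. (\<lambda>t. y t - T x t - (\<Sum>b\<in>B. c b * b t)) \<in> N)"

definition codim_range :: "('x \<Rightarrow> complex) set \<Rightarrow> ('x \<Rightarrow> complex) set \<Rightarrow>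
     (('x \<Rightarrow> complex) \<Rightarrow> ('x \<Rightarrow> complex)) \<Rightarrow> nat" where
  "codim_range V N T = (LEAST n. \<exists>B. finite B \<and> B \<subseteq> V \<and> card B = n \<and> cospans V N T B)"

definition bounded_op :: "('x \<Rightarrow> complex) set \<Rightarrow> ('x \<Rightarrow> complex) set \<Rightarrow>
     (('x \<Rightarrow> complex) \<Rightarrow> real) \<Rightarrow> (('x \<Rightarrow> complex) \<Rightarrow> ('x \<Rightarrow> complex)) \<Rightarrow> bool" where
  "bounded_op V N nrm T \<longleftrightarrow>
     (\<forall>x\<in>V. T x \<in> V) \<and>
     (\<forall>x\<in>V. x \<in> N \<longrightarrow> T x \<in> N) \<and>
     (\<forall>x\<in>V. \<forall>y\<in>V. (\<lambda>t. T (\<lambda>s. x s + y s) t - T x t - T y t) \<in> N) \<and>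
     (\<forall>x\<in>V. \<forall>c. (\<lambda>t. T (\<lambda>s. c * x s) t - c * T x t) \<in> N) \<and>
     (\<exists>C. \<forall>x\<in>V. nrm (T x) \<le> C * nrm x)"

definition fredholm_op :: "('x \<Rightarrow> complex) set \<Rightarrow> ('x \<Rightarrow> complex) set \<Rightarrow>
     (('x \<Rightarrow> complex) \<Rightarrow> real) \<Rightarrow> (('x \<Rightarrow> complex) \<Rightarrow> ('x \<Rightarrow> complex)) \<Rightarrow> bool" where
  "fredholm_op V N nrm T \<longleftrightarrow> bounded_op V N nrm T \<and>
     (\<exists>B. finite B \<and> B \<subseteq> ker_op V N T \<and> spans_mod N B (ker_op V N T)) \<and>
     (\<exists>B. finite B \<and> B \<subseteq> V \<and> cospans V N T B)"

definition fredholm_index :: "('x \<Rightarrow> complex) set \<Rightarrow> ('x \<Rightarrow> complex) set \<Rightarrow>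
     (('x \<Rightarrow> complex) \<Rightarrow> ('x \<Rightarrow> complex)) \<Rightarrow> int" where
  "fredholm_index V N T = int (dim_mod N (ker_op V N T)) - int (codim_range V N T)"

definition class_L :: "real \<Rightarrow> real \<Rightarrow> (complex \<Rightarrow> complex) \<Rightarrow> (complex \<Rightarrow> complex) \<Rightarrow> bool" where
  "class_L p q a b \<longleftrightarrow> multiplier p a \<and> multiplier p b \<and>
     fredholm_op (lp p) {\<lambda>_. 0} (lpnorm p) (TH_lp a b) \<and>
     fredholm_op (Hardy q) null_T (Lnorm q) (TH_Hardy q a b) \<and>
     fredholm_index (lp p) {\<lambda>_. 0} (TH_lp a b) = fredholm_index (Hardy q) null_T (TH_Hardy q a b)"

definition fourier_seq :: "(complex \<Rightarrow> complex) \<Rightarrow> (nat \<Rightarrow> complex)" where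
  "fourier_seq h = (\<lambda>n. fcoef h (int n))"

end

theory Submission
  imports Defs
begin

text \<open>If \<^term>\<open>p \<ge> 2\<close>, the Hausdorff-Young inequality makes the Fourier transform a bounded injection
  of the Hardy space into \<^term>\<open>lp p\<close> with dense range that intertwines the two operators; if
  \<^term>\<open>p \<le> 2\<close>, the same holds for its inverse, from \<^term>\<open>lp p\<close> into the Hardy space. Let \<open>J\<close> be such
  an injection, with \<open>J S = T J\<close>. A finite set spanning a complement of the range of \<open>S\<close> is mapped to one
  that spans, together with the range of \<open>T\<close>, a dense subspace; ranges of finite codimension
  being closed, this subspace is everything, so the codimension for \<open>T\<close> is at most that for
  \<open>S\<close>. As the indices agree, the kernel of \<open>T\<close> has at most the dimension of the kernel of \<open>S\<close>, which
  \<open>J\<close> embeds into it; hence \<open>J\<close> is a bijection between the kernels.\<close>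

section \<open>Complete seminormed spaces\<close>

text \<open>Functions on the circle are not identified almost everywhere and
  \<open>riesz_proj\<close> is a choice, so the spaces carry only seminorms, and identities,
  linearity of the operators included, hold modulo null elements. Which of the two spaces embeds
  into the other depends on p; hence the argument is made once, for an abstract pair of spaces.
  Completeness is required as convergence of absolutely convergent series, the form in which
  Riesz-Fischer gives it. Ranges of finite codimension are closed by the open mapping theorem, which
  comes here from a Baire argument for the size of a representation
  \<open>y = T x + sum of c b * b\<close>. The relation \<open>J (S x) = T (J x)\<close> is computed
  only for polynomials, where all sums are finite; boundedness of both operators is part of their
  Fredholm property and carries the relation to the whole space. Hausdorff-Young rests on an
  interpolation between l^1 and l^2 in which the coefficients are cut at a level that depends on the
  size of the polynomial at the given point.\<close>

locale seminormed_complete =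
  fixes V :: "('x \<Rightarrow> complex) set" and nrm :: "('x \<Rightarrow> complex) \<Rightarrow> real"
  assumes zero_mem: "(\<lambda>_. 0) \<in> V"
    and add_mem: "\<lbrakk>x \<in> V; y \<in> V\<rbrakk> \<Longrightarrow> (\<lambda>t. x t + y t) \<in> V"
    and scale_mem: "x \<in> V \<Longrightarrow> (\<lambda>t. c * x t) \<in> V"
    and nrm_triangle: "\<lbrakk>x \<in> V; y \<in> V\<rbrakk> \<Longrightarrow> nrm (\<lambda>t. x t + y t) \<le> nrm x + nrm y"
    and nrm_scale: "x \<in> V \<Longrightarrow> nrm (\<lambda>t. c * x t) = norm c * nrm x"
    and complete: "\<lbrakk>\<And>i. u i \<in> V; summable (\<lambda>i. nrm (u i))\<rbrakk>
      \<Longrightarrow> \<exists>y\<in>V. (\<lambda>n. nrm (\<lambda>t. y t - (\<Sum>i<n. u i t))) \<longlonglongrightarrow> 0"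
begin

text \<open>The subspace that is divided out implicitly: the functions vanishing almost everywhere
  in the case of the Hardy spaces, only the zero sequence in the case of l^p.\<close>

definition null :: "('x \<Rightarrow> complex) set" where
  "null = {x \<in> V. nrm x = 0}"

lemma minus_mem: "x \<in> V \<Longrightarrow> (\<lambda>t. - x t) \<in> V"
  using scale_mem[of x "-1"] by simp

lemma diff_mem: "\<lbrakk>x \<in> V; y \<in> V\<rbrakk> \<Longrightarrow> (\<lambda>t. x t - y t) \<in> V"
  using add_mem[OF _ minus_mem, of x y] by simp

lemma sum_mem: "(\<And>i. i \<in> I \<Longrightarrow> u i \<in> V) \<Longrightarrow> (\<lambda>t. \<Sum>i\<in>I. u i t) \<in> V"
proof (induction I rule: infinite_finite_induct)
  case (insert i I)
  then show ?case
    using add_mem[of "u i" "\<lambda>t. \<Sum>i\<in>I. u i t"] by simp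
qed (simp_all add: zero_mem)

lemma lincomb_mem: "(\<And>i. i \<in> I \<Longrightarrow> u i \<in> V) \<Longrightarrow> (\<lambda>t. \<Sum>i\<in>I. c i * u i t) \<in> V"
  by (rule sum_mem) (rule scale_mem)

lemma nrm_zero [simp]: "nrm (\<lambda>_. 0) = 0"
  using nrm_scale[OF zero_mem, of 0] by simp

lemma nrm_minus: "x \<in> V \<Longrightarrow> nrm (\<lambda>t. - x t) = nrm x"
  using nrm_scale[of x "-1"] by simp

lemma nrm_nonneg: "x \<in> V \<Longrightarrow> 0 \<le> nrm x"
  using nrm_triangle[OF _ minus_mem, of x x] by (simp add: nrm_minus)

lemma nrm_diff_le: "\<lbrakk>x \<in> V; y \<in> V\<rbrakk> \<Longrightarrow> nrm (\<lambda>t. x t - y t) \<le> nrm x + nrm y"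
  using nrm_triangle[OF _ minus_mem, of x y] by (simp add: nrm_minus)

lemma nrm_diff_commute: "\<lbrakk>x \<in> V; y \<in> V\<rbrakk> \<Longrightarrow> nrm (\<lambda>t. x t - y t) = nrm (\<lambda>t. y t - x t)"
  using nrm_minus[OF diff_mem, of x y] by simp

lemma nrm_diff_trans:
  "\<lbrakk>x \<in> V; y \<in> V; z \<in> V\<rbrakk> \<Longrightarrow> nrm (\<lambda>t. x t - z t) \<le> nrm (\<lambda>t. x t - y t) + nrm (\<lambda>t. y t - z t)"
  using nrm_triangle[OF diff_mem diff_mem, of x y y z] by simp

lemma nrm_le_diff: "\<lbrakk>x \<in> V; y \<in> V\<rbrakk> \<Longrightarrow> nrm x \<le> nrm (\<lambda>t. x t - y t) + nrm y"
  using nrm_diff_trans[OF _ _ zero_mem, of x y] by simp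

lemma nrm_sum: "(\<And>i. i \<in> I \<Longrightarrow> u i \<in> V) \<Longrightarrow> nrm (\<lambda>t. \<Sum>i\<in>I. u i t) \<le> (\<Sum>i\<in>I. nrm (u i))"
proof (induction I rule: infinite_finite_induct)
  case (insert i I)
  then show ?case
    using nrm_triangle[OF _ sum_mem, of "u i" I u] by fastforce
qed simp_all

lemma nullI: "x \<in> V \<Longrightarrow> nrm x \<le> 0 \<Longrightarrow> x \<in> null"
  using nrm_nonneg by (force simp: null_def)

lemma null_mem: "x \<in> null \<Longrightarrow> x \<in> V"
  by (simp add: null_def)

lemma null_nrm: "x \<in> null \<Longrightarrow> nrm x = 0"
  by (simp add: null_def)

lemma zero_null: "(\<lambda>_. 0) \<in> null"
  by (simp add: null_def zero_mem)

lemma null_add: "\<lbrakk>x \<in> null; y \<in> null\<rbrakk> \<Longrightarrow> (\<lambda>t. x t + y t) \<in> null"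
  using nrm_triangle[of x y] by (intro nullI) (auto simp: null_def add_mem)

lemma null_scale: "x \<in> null \<Longrightarrow> (\<lambda>t. c * x t) \<in> null"
  by (auto simp: null_def scale_mem nrm_scale)

lemma null_minus: "x \<in> null \<Longrightarrow> (\<lambda>t. - x t) \<in> null"
  using null_scale[of x "-1"] by simp

lemma null_diff: "\<lbrakk>x \<in> null; y \<in> null\<rbrakk> \<Longrightarrow> (\<lambda>t. x t - y t) \<in> null"
  using null_add[OF _ null_minus, of x y] by simp

lemma null_sum: "(\<And>i. i \<in> I \<Longrightarrow> u i \<in> null) \<Longrightarrow> (\<lambda>t. \<Sum>i\<in>I. u i t) \<in> null"
proof (induction I rule: infinite_finite_induct)
  case (insert i I)
  then show ?case
    using null_add[of "u i" "\<lambda>t. \<Sum>i\<in>I. u i t"] by simp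
qed (simp_all add: zero_null)

text \<open>Telescoping turns geometrically small increments into an absolutely convergent series.
  Both applications can arrange such increments: the nested balls of the Baire argument, and the
  partial sums of a Fourier series along a sparse subsequence.\<close>

lemma complete_fast:
  assumes y: "\<And>n. y n \<in> V" and le: "\<And>n. nrm (\<lambda>t. y (Suc n) t - y n t) \<le> (1/2)^n"
  shows "\<exists>z\<in>V. (\<lambda>n. nrm (\<lambda>t. z t - y n t)) \<longlonglongrightarrow> 0"
proof -
  have mem: "(\<lambda>t. y (Suc n) t - y n t) \<in> V" for n
    using y by (intro diff_mem)
  have "summable (\<lambda>n. nrm (\<lambda>t. y (Suc n) t - y n t))"
    by (rule summable_comparison_test'[where g = "\<lambda>n. (1/2)^n" and N = 0])
      (use le mem nrm_nonneg in \<open>auto simp: summable_geometric\<close>)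
  from complete[OF mem this] obtain z where z: "z \<in> V"
    "(\<lambda>n. nrm (\<lambda>t. z t - (\<Sum>i<n. y (Suc i) t - y i t))) \<longlonglongrightarrow> 0" by blast
  have "(\<Sum>i<n. y (Suc i) t - y i t) = y n t - y 0 t" for n t
    by (rule sum_lessThan_telescope)
  then have "(\<lambda>t. (z t + y 0 t) - y n t) = (\<lambda>t. z t - (\<Sum>i<n. y (Suc i) t - y i t))" for n
    by (intro ext) (simp only:, simp)
  with z(2) have "(\<lambda>n. nrm (\<lambda>t. (z t + y 0 t) - y n t)) \<longlonglongrightarrow> 0"
    by simp
  then show ?thesis
    using add_mem[OF z(1) y[of 0]] by (rule bexI)
qed

text \<open>Zabreiko's lemma for the gauge whose sublevel sets are the \<^term>\<open>Q r\<close>: a finite,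
  countably subadditive gauge on a complete space is bounded on the unit ball.\<close>

lemma countably_subadditive_bounded:
  fixes Q :: "real \<Rightarrow> ('x \<Rightarrow> complex) \<Rightarrow> bool"
  assumes total: "\<And>y. y \<in> V \<Longrightarrow> \<exists>r. Q r y"
    and mono: "\<And>r s y. Q r y \<Longrightarrow> r \<le> s \<Longrightarrow> Q s y"
    and diff: "\<And>r s y z. \<lbrakk>y \<in> V; z \<in> V; Q r y; Q s z\<rbrakk> \<Longrightarrow> Q (r + s) (\<lambda>t. y t - z t)"
    and scale: "\<And>r y c. \<lbrakk>y \<in> V; Q r y\<rbrakk> \<Longrightarrow> Q (norm c * r) (\<lambda>t. c * y t)"
    and series: "\<And>r y z. \<lbrakk>\<And>i::nat. y i \<in> V; z \<in> V; \<And>i. Q (r i) (y i); summable r;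
        (\<lambda>n. nrm (\<lambda>t. z t - (\<Sum>i<n. y i t))) \<longlonglongrightarrow> 0\<rbrakk> \<Longrightarrow> Q (suminf r) z"
  shows "\<exists>C. \<forall>y\<in>V. nrm y \<le> 1 \<longrightarrow> Q C y"
proof -
  \<comment> \<open>Baire's argument: some sublevel set is dense in a ball. Otherwise there are
    nested balls with radii tending to 0, each new one missing the next sublevel set, and the gauge
    of their common point could not be finite.\<close>
  have "\<exists>n y0 r. y0 \<in> V \<and> 0 < r \<and> (\<forall>z\<in>V. nrm (\<lambda>t. z t - y0 t) < r \<longrightarrow>
      (\<forall>\<epsilon>>0. \<exists>w\<in>V. Q (real n) w \<and> nrm (\<lambda>t. z t - w t) < \<epsilon>))"
  proof (rule ccontr)
    assume contr: "\<not> ?thesis"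
    define P where "P n yr \<longleftrightarrow> fst yr \<in> V \<and> 0 < snd yr \<and> snd yr \<le> (1/2)^n"
      for n :: nat and yr :: "('x \<Rightarrow> complex) \<times> real"
    define R where "R n yr yr' \<longleftrightarrow> nrm (\<lambda>t. fst yr' t - fst yr t) + snd yr' \<le> snd yr \<and>
        (\<forall>w\<in>V. Q (real n) w \<longrightarrow> snd yr' < nrm (\<lambda>t. fst yr' t - w t))"
      for n :: nat and yr yr' :: "('x \<Rightarrow> complex) \<times> real"
    have "\<exists>f. \<forall>n. P n (f n) \<and> R n (f n) (f (Suc n))"
    proof (rule dependent_nat_choice)
      show "\<exists>yr. P 0 yr"
        unfolding P_def by (rule exI[of _ "(\<lambda>_. 0, 1)"]) (simp add: zero_mem)
      fix yr :: "('x \<Rightarrow> complex) \<times> real" and n :: nat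
      assume P: "P n yr"
      define y r where "y = fst yr" and "r = snd yr"
      have y: "y \<in> V" and r: "0 < r" "r \<le> (1/2)^n"
        using P by (auto simp: P_def y_def r_def)
      have "\<not> (\<forall>z\<in>V. nrm (\<lambda>t. z t - y t) < r/2 \<longrightarrow>
          (\<forall>\<epsilon>>0. \<exists>w\<in>V. Q (real n) w \<and> nrm (\<lambda>t. z t - w t) < \<epsilon>))"
        using contr y r by (metis half_gt_zero)
      then obtain z e where z: "z \<in> V" "nrm (\<lambda>t. z t - y t) < r/2" "0 < e"
        and far: "\<And>w. w \<in> V \<Longrightarrow> Q (real n) w \<Longrightarrow> e \<le> nrm (\<lambda>t. z t - w t)"
        by (meson not_less)
      \<comment> \<open>Since z is within \<open>r/2\<close> of the old centre, a radius of at most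
        \<open>r/2\<close> keeps the new ball inside the old one; \<open>e/2\<close> keeps it
        strictly away from the sublevel set.\<close>
      have "P (Suc n) (z, min (r/2) (e/2))"
        using r z by (auto simp: P_def min_def)
      moreover have "R n yr (z, min (r/2) (e/2))"
        using z far unfolding R_def y_def[symmetric] r_def[symmetric] by (force simp: min_def)
      ultimately show "\<exists>yr'. P (Suc n) yr' \<and> R n yr yr'" by blast
    qed
    then obtain f where f: "\<And>n. P n (f n)" "\<And>n. R n (f n) (f (Suc n))" by blast
    define y r where "y n = fst (f n)" and "r n = snd (f n)" for n
    have y: "y n \<in> V" and r: "0 < r n" "r n \<le> (1/2)^n" for n
      using f(1)[of n] by (auto simp: P_def y_def r_def)
    have step: "nrm (\<lambda>t. y (Suc n) t - y n t) + r (Suc n) \<le> r n" for n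
      using f(2)[of n] by (auto simp: R_def y_def r_def)
    have far: "r (Suc n) < nrm (\<lambda>t. y (Suc n) t - w t)" if "w \<in> V" "Q (real n) w" for n w
      using f(2)[of n] that by (auto simp: R_def y_def r_def)
    have "nrm (\<lambda>t. y (Suc n) t - y n t) \<le> (1/2)^n" for n
      using step[of n] r(1)[of "Suc n"] r(2)[of n] by linarith
    from complete_fast[of y, OF y this] obtain z
      where z: "z \<in> V" "(\<lambda>n. nrm (\<lambda>t. z t - y n t)) \<longlonglongrightarrow> 0" by blast
    have nest: "nrm (\<lambda>t. y (n + k) t - y n t) + r (n + k) \<le> r n" for n k
    proof (induction k)
      case (Suc k)
      then show ?case
        using nrm_diff_trans[of "y (Suc (n + k))" "y (n + k)" "y n"] y step[of "n + k"] by simp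
    qed simp
    have close: "nrm (\<lambda>t. z t - y n t) \<le> r n" for n
    proof -
      have "(\<lambda>k. nrm (\<lambda>t. z t - y (n + k) t) + r n) \<longlonglongrightarrow> 0 + r n"
        by (intro tendsto_add tendsto_const)
          (use LIMSEQ_ignore_initial_segment[OF z(2), of n] in \<open>simp add: add.commute\<close>)
      moreover have "nrm (\<lambda>t. z t - y n t) \<le> nrm (\<lambda>t. z t - y (n + k) t) + r n" for k
        using nrm_diff_trans[of z "y (n + k)" "y n"] z(1) y[of n] y[of "n + k"] nest[of n k] r(1)[of "n + k"] by linarith
      ultimately show ?thesis
        using LIMSEQ_le_const[of "\<lambda>k. nrm (\<lambda>t. z t - y (n + k) t) + r n" "0 + r n"] by auto
    qed
    obtain s where s: "Q s z" using total z(1) by blast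
    obtain n :: nat where "s \<le> real n" using real_arch_simple by blast
    then have "Q (real n) z" using mono s by blast
    from far[OF z(1) this] show False
      using close[of "Suc n"] nrm_diff_commute[OF z(1) y, of "Suc n"] by linarith
  qed
  then obtain n y0 r where y0: "y0 \<in> V" and r: "0 < r"
    and appr: "\<And>z e. \<lbrakk>z \<in> V; nrm (\<lambda>t. z t - y0 t) < r; 0 < e\<rbrakk>
      \<Longrightarrow> \<exists>w\<in>V. Q (real n) w \<and> nrm (\<lambda>t. z t - w t) < e" by blast
  \<comment> \<open>The factor \<open>2 * real n\<close> is the price of moving the ball to the
    origin, and \<open>2 / r\<close> that of shrinking a vector of norm at most s into the ball of
    radius r.\<close>
  define K where "K = 2 * real n * (2 / r)"
  \<comment> \<open>Here \<open>x = (y0 + x) - y0\<close> is approximated by the difference of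
    approximants of two points of the ball about y0.\<close>
  have appr0: "\<exists>w\<in>V. Q (2 * real n) w \<and> nrm (\<lambda>t. x t - w t) < e"
    if x: "x \<in> V" "nrm x < r" and e: "0 < e" for x e
  proof -
    obtain w1 where w1: "w1 \<in> V" "Q (real n) w1" "nrm (\<lambda>t. y0 t + x t - w1 t) < e/2"
      using appr[of "\<lambda>t. y0 t + x t" "e/2"] add_mem[OF y0 x(1)] x e by auto
    obtain w2 where w2: "w2 \<in> V" "Q (real n) w2" "nrm (\<lambda>t. y0 t - w2 t) < e/2"
      using appr[of y0 "e/2"] y0 e r by auto
    have "nrm (\<lambda>t. x t - (w1 t - w2 t)) \<le> nrm (\<lambda>t. y0 t + x t - w1 t) + nrm (\<lambda>t. y0 t - w2 t)"
      using nrm_diff_le[OF diff_mem[OF add_mem[OF y0 x(1)] w1(1)] diff_mem[OF y0 w2(1)]]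
      by (simp add: algebra_simps)
    then have "nrm (\<lambda>t. x t - (w1 t - w2 t)) < e" using w1 w2 by linarith
    then show ?thesis
      using diff[OF w1(1) w2(1) w1(2) w2(2)] diff_mem[OF w1(1) w2(1)]
      by (intro bexI[of _ "\<lambda>t. w1 t - w2 t"]) auto
  qed
  have appr1: "\<exists>w\<in>V. Q (K * s) w \<and> nrm (\<lambda>t. x t - w t) < e"
    if x: "x \<in> V" "nrm x \<le> s" and s: "0 < s" and e: "0 < e" for x s e
  proof -
    define a where "a = 2 * s / r"
    have a: "0 < a" using s r by (simp add: a_def)
    let ?x = "\<lambda>t. of_real (1/a) * x t"
    have "nrm ?x = (1/a) * nrm x"
      using nrm_scale[OF x(1), of "of_real (1/a)"] a by (simp add: norm_divide)
    also have "\<dots> \<le> (1/a) * s" using x a by (intro mult_left_mono) auto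
    also have "\<dots> < r" using a r s by (simp add: a_def field_simps)
    finally obtain w where w: "w \<in> V" "Q (2 * real n) w" "nrm (\<lambda>t. ?x t - w t) < e / a"
      using appr0[OF scale_mem[OF x(1)], of "of_real (1/a)" "e/a"] a e by auto
    have "nrm (\<lambda>t. of_real a * (?x t - w t)) = a * nrm (\<lambda>t. ?x t - w t)"
      using nrm_scale[OF diff_mem[OF scale_mem[OF x(1), of "of_real (1/a)"] w(1)], of "of_real a"] a by simp
    also have "\<dots> < e" using w(3) a by (simp add: field_simps)
    also have "(\<lambda>t. of_real a * (?x t - w t)) = (\<lambda>t. x t - of_real a * w t)"
      using a by (simp add: fun_eq_iff algebra_simps)
    finally have "nrm (\<lambda>t. x t - of_real a * w t) < e" .
    moreover have "Q (K * s) (\<lambda>t. of_real a * w t)"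
    proof -
      have "norm (of_real a :: complex) * (2 * real n) = K * s"
        using a by simp (simp add: K_def a_def)
      then show ?thesis
        using scale[OF w(1,2), of "of_real a"] by simp
    qed
    ultimately show ?thesis
      using scale_mem[OF w(1)] by blast
  qed
  have "Q (K * 2) x" if x: "x \<in> V" "nrm x \<le> 1" for x
  proof -
    \<comment> \<open>Successive approximation: f n is the remainder after n steps, and each step
      removes an element of gauge \<open>K * (1/2)^n\<close> while halving the bound on the
      remainder. The removed elements sum to x, so x has gauge at most the geometric sum
      \<open>K * 2\<close>.\<close>
    define P where "P n y \<longleftrightarrow> y \<in> V \<and> nrm y \<le> (1/2)^n \<and> (n = 0 \<longrightarrow> y = x)" for n :: nat and y
    have "\<exists>f. \<forall>n. P n (f n) \<and> Q (K * (1/2)^n) (\<lambda>t. f n t - f (Suc n) t)"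
    proof (rule dependent_nat_choice)
      show "\<exists>y. P 0 y" using x by (auto simp: P_def)
      fix y and n :: nat
      assume "P n y"
      then have y: "y \<in> V" "nrm y \<le> (1/2)^n" by (auto simp: P_def)
      obtain w where w: "w \<in> V" "Q (K * (1/2)^n) w" "nrm (\<lambda>t. y t - w t) < (1/2)^Suc n"
        using appr1[OF y, of "(1/2)^Suc n"] by auto
      then show "\<exists>y'. P (Suc n) y' \<and> Q (K * (1/2)^n) (\<lambda>t. y t - y' t)"
        using diff_mem[OF y(1) w(1)]
        by (intro exI[of _ "\<lambda>t. y t - w t"]) (auto simp: P_def)
    qed
    then obtain f where f: "\<And>n. P n (f n)" "\<And>n. Q (K * (1/2)^n) (\<lambda>t. f n t - f (Suc n) t)"
      by blast
    have mem: "f n \<in> V" and small: "nrm (f n) \<le> (1/2)^n" for n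
      using f(1)[of n] by (auto simp: P_def)
    have f0: "f 0 = x" using f(1)[of 0] by (simp add: P_def)
    have part: "(\<Sum>i<n. f i t - f (Suc i) t) = x t - f n t" for n t
      using sum_lessThan_telescope'[of "\<lambda>i. f i t" n] f0 by simp
    have "(\<lambda>n. nrm (f n)) \<longlonglongrightarrow> 0"
      by (rule tendsto_sandwich[OF _ _ tendsto_const LIMSEQ_power_zero[of "1/2::real"]])
        (use small nrm_nonneg[OF mem] in auto)
    then have "(\<lambda>n. nrm (\<lambda>t. x t - (\<Sum>i<n. f i t - f (Suc i) t))) \<longlonglongrightarrow> 0"
      by (simp add: part)
    then have "Q (\<Sum>n. K * (1/2)^n) x"
      using f(2) mem x by (intro series[of "\<lambda>n t. f n t - f (Suc n) t"])
        (auto intro!: diff_mem summable_mult summable_geometric)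
    moreover have "(\<Sum>n. K * (1/2)^n) = K * 2"
      using suminf_mult[OF summable_geometric, of "1/2::real" K] suminf_geometric[of "1/2::real"]
      by simp
    ultimately show ?thesis by simp
  qed
  then show ?thesis by blast
qed

end

section \<open>Bounded maps, linear up to null elements\<close>

locale bounded_map =
  X: seminormed_complete X nX + Y: seminormed_complete Y nY
  for X :: "('x \<Rightarrow> complex) set" and nX and Y :: "('y \<Rightarrow> complex) set" and nY +
  fixes J :: "('x \<Rightarrow> complex) \<Rightarrow> ('y \<Rightarrow> complex)"
  assumes map_mem: "x \<in> X \<Longrightarrow> J x \<in> Y"
    and map_add: "\<lbrakk>x \<in> X; y \<in> X\<rbrakk> \<Longrightarrow> (\<lambda>t. J (\<lambda>s. x s + y s) t - J x t - J y t) \<in> Y.null"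
    and map_scale: "x \<in> X \<Longrightarrow> (\<lambda>t. J (\<lambda>s. c * x s) t - c * J x t) \<in> Y.null"
    and map_bound: "\<exists>C. \<forall>x\<in>X. nY (J x) \<le> C * nX x"
begin

lemma map_bound_pos: obtains C where "0 < C" "\<And>x. x \<in> X \<Longrightarrow> nY (J x) \<le> C * nX x"
proof -
  obtain C where C: "\<And>x. x \<in> X \<Longrightarrow> nY (J x) \<le> C * nX x" using map_bound by blast
  show ?thesis
  proof (rule that[of "max C 1"])
    fix x assume x: "x \<in> X"
    have "nY (J x) \<le> C * nX x" using C x by blast
    also have "\<dots> \<le> max C 1 * nX x" using X.nrm_nonneg[OF x] by (intro mult_right_mono) auto
    finally show "nY (J x) \<le> max C 1 * nX x" .
  qed simp
qed

lemma map_null: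
  assumes "x \<in> X.null"
  shows "J x \<in> Y.null"
proof -
  obtain C where "\<And>x. x \<in> X \<Longrightarrow> nY (J x) \<le> C * nX x" using map_bound_pos by blast
  from this[of x] assms show ?thesis
    by (intro Y.nullI map_mem) (simp_all add: X.null_def)
qed

lemma map_diff:
  assumes "x \<in> X" "y \<in> X"
  shows "(\<lambda>t. J (\<lambda>s. x s - y s) t - (J x t - J y t)) \<in> Y.null"
proof -
  have "(\<lambda>t. (J (\<lambda>s. x s + - 1 * y s) t - J x t - J (\<lambda>s. - 1 * y s) t)
      + (J (\<lambda>s. - 1 * y s) t - - 1 * J y t)) \<in> Y.null"
    by (intro Y.null_add map_add map_scale X.scale_mem assms)
  then show ?thesis by (simp add: diff_diff_eq2 add_diff_eq)
qed

lemma map_lincomb: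
  assumes "finite I" "\<And>i. i \<in> I \<Longrightarrow> u i \<in> X"
  shows "(\<lambda>t. J (\<lambda>s. \<Sum>i\<in>I. c i * u i s) t - (\<Sum>i\<in>I. c i * J (u i) t)) \<in> Y.null"
  using assms
proof (induction I)
  case empty
  then show ?case using map_null[OF X.zero_null] by simp
next
  case (insert i I)
  have "(\<lambda>t. J (\<lambda>s. c i * u i s + (\<Sum>i\<in>I. c i * u i s)) t
      - J (\<lambda>s. c i * u i s) t - J (\<lambda>s. \<Sum>i\<in>I. c i * u i s) t) \<in> Y.null"
    using insert by (intro map_add X.scale_mem X.lincomb_mem) auto
  from Y.null_add[OF this Y.null_add[OF map_scale[of "u i" "c i"] insert.IH]] insert
  show ?case by (simp add: algebra_simps)
qed

lemma nrm_map_diff: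
  assumes "x \<in> X" "y \<in> X"
  shows "nY (\<lambda>t. J x t - J y t) = nY (J (\<lambda>s. x s - y s))"
proof -
  have m: "J (\<lambda>s. x s - y s) \<in> Y" "(\<lambda>t. J x t - J y t) \<in> Y"
    using assms by (auto intro!: map_mem X.diff_mem Y.diff_mem)
  show ?thesis
    using Y.nrm_le_diff[OF m] Y.nrm_le_diff[OF m(2,1)] Y.nrm_diff_commute[OF m]
      Y.null_nrm[OF map_diff[OF assms]] by linarith
qed

lemma map_tendsto:
  assumes x: "x \<in> X" and u: "\<And>n. u n \<in> X" and lim: "(\<lambda>n. nX (\<lambda>t. x t - u n t)) \<longlonglongrightarrow> 0"
  shows "(\<lambda>n. nY (\<lambda>t. J x t - J (u n) t)) \<longlonglongrightarrow> 0"
proof -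
  obtain C where C: "0 < C" "\<And>x. x \<in> X \<Longrightarrow> nY (J x) \<le> C * nX x"
    using map_bound_pos by blast
  have "norm (nY (\<lambda>t. J x t - J (u n) t)) \<le> C * nX (\<lambda>t. x t - u n t)" for n
    using C(2)[OF X.diff_mem[OF x u]] nrm_map_diff[OF x u]
      Y.nrm_nonneg[OF Y.diff_mem[OF map_mem[OF x] map_mem[OF u]]] by simp
  then have "\<forall>\<^sub>F n in sequentially. norm (nY (\<lambda>t. J x t - J (u n) t)) \<le> C * nX (\<lambda>t. x t - u n t)"
    by simp
  moreover have "(\<lambda>n. C * nX (\<lambda>t. x t - u n t)) \<longlonglongrightarrow> 0"
    using tendsto_mult[OF tendsto_const lim, of C] by simp
  ultimately show ?thesis by (rule Lim_null_comparison)
qed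

end

section \<open>Operators with range of finite codimension\<close>

context seminormed_complete
begin

lemma bounded_op_iff_bounded_map: "bounded_op V null nrm T \<longleftrightarrow> bounded_map V nrm V nrm T"
proof
  assume "bounded_op V null nrm T"
  then show "bounded_map V nrm V nrm T"
    by unfold_locales (auto simp: bounded_op_def)
next
  assume "bounded_map V nrm V nrm T"
  then interpret T: bounded_map V nrm V nrm T .
  show "bounded_op V null nrm T"
    unfolding bounded_op_def
    using T.map_mem T.map_null T.map_add T.map_scale T.map_bound by blast
qed

text \<open>The open mapping theorem for the map sending (x, c) to \<open>T x\<close> plus the
  combination of B with coefficients c. The gauge measures the size of a representation of y; it is
  finite by \<open>co\<close>, and countably subadditive because representations of summable size
  can be added up termwise in the complete space.\<close>

lemma cospans_bounded:
  assumes T: "bounded_op V null nrm T" and B: "finite B" "B \<subseteq> V" and co: "cospans V null T B"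
  shows "\<exists>C. \<forall>y\<in>V. nrm y \<le> 1 \<longrightarrow> (\<exists>x\<in>V. \<exists>c. nrm x \<le> C \<and> (\<forall>b\<in>B. norm (c b) \<le> C) \<and>
      (\<lambda>t. y t - T x t - (\<Sum>b\<in>B. c b * b t)) \<in> null)"
proof (rule countably_subadditive_bounded)
  interpret T: bounded_map V nrm V nrm T
    using T bounded_op_iff_bounded_map by blast
  let ?Q = "\<lambda>r y. \<exists>x\<in>V. \<exists>c. nrm x \<le> r \<and> (\<forall>b\<in>B. norm (c b) \<le> r) \<and>
      (\<lambda>t. y t - T x t - (\<Sum>b\<in>B. c b * b t)) \<in> null"
  show "\<exists>r. ?Q r y" if y: "y \<in> V" for y
  proof -
    obtain x c where x: "x \<in> V" "(\<lambda>t. y t - T x t - (\<Sum>b\<in>B. c b * b t)) \<in> null"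
      using co y unfolding cospans_def by blast
    let ?S = "\<Sum>b\<in>B. norm (c b)"
    have "norm (c b) \<le> nrm x + ?S" if "b \<in> B" for b
      using member_le_sum[of b B "\<lambda>b. norm (c b)"] that B nrm_nonneg[OF x(1)] by auto
    moreover have "nrm x \<le> nrm x + ?S" by (simp add: sum_nonneg)
    ultimately show ?thesis using x by blast
  qed
  show "?Q s y" if "?Q r y" "r \<le> s" for r s y
    using that by (meson order_trans)
  show "?Q (r + s) (\<lambda>t. y t - z t)" if yz: "y \<in> V" "z \<in> V" "?Q r y" "?Q s z" for r s y z
  proof -
    obtain x1 c1 where 1: "x1 \<in> V" "nrm x1 \<le> r" "\<And>b. b \<in> B \<Longrightarrow> norm (c1 b) \<le> r"
      "(\<lambda>t. y t - T x1 t - (\<Sum>b\<in>B. c1 b * b t)) \<in> null" using yz(3) by blast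
    obtain x2 c2 where 2: "x2 \<in> V" "nrm x2 \<le> s" "\<And>b. b \<in> B \<Longrightarrow> norm (c2 b) \<le> s"
      "(\<lambda>t. z t - T x2 t - (\<Sum>b\<in>B. c2 b * b t)) \<in> null" using yz(4) by blast
    have "norm (c1 b - c2 b) \<le> r + s" if "b \<in> B" for b
      using norm_triangle_ineq4[of "c1 b" "c2 b"] 1(3)[OF that] 2(3)[OF that] by linarith
    moreover have "nrm (\<lambda>t. x1 t - x2 t) \<le> r + s"
      using nrm_diff_le[OF 1(1) 2(1)] 1(2) 2(2) by linarith
    moreover have "(\<lambda>t. (y t - z t) - T (\<lambda>t. x1 t - x2 t) t - (\<Sum>b\<in>B. (c1 b - c2 b) * b t)) \<in> null"
      using null_diff[OF null_diff[OF 1(4) 2(4)] T.map_diff[OF 1(1) 2(1)]]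
      by (simp add: algebra_simps sum_subtractf)
    ultimately show ?thesis
      using diff_mem[OF 1(1) 2(1)]
      by (intro bexI[of _ "\<lambda>t. x1 t - x2 t"] exI[of _ "\<lambda>b. c1 b - c2 b"] conjI ballI) blast+
  qed
  show "?Q (norm k * r) (\<lambda>t. k * y t)" if y: "y \<in> V" "?Q r y" for r y k
  proof -
    obtain x c where x: "x \<in> V" "nrm x \<le> r" "\<And>b. b \<in> B \<Longrightarrow> norm (c b) \<le> r"
      "(\<lambda>t. y t - T x t - (\<Sum>b\<in>B. c b * b t)) \<in> null" using y(2) by blast
    have "(\<lambda>t. k * y t - T (\<lambda>t. k * x t) t - (\<Sum>b\<in>B. (k * c b) * b t)) \<in> null"
      using null_diff[OF null_scale[OF x(4), of k] T.map_scale[OF x(1), of k]]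
      by (simp add: algebra_simps sum_distrib_left)
    moreover have "nrm (\<lambda>t. k * x t) \<le> norm k * r" "\<forall>b\<in>B. norm (k * c b) \<le> norm k * r"
      using x nrm_scale[OF x(1)] by (auto simp: norm_mult intro!: mult_left_mono)
    ultimately show ?thesis
      using scale_mem[OF x(1)]
      by (intro bexI[of _ "\<lambda>t. k * x t"] exI[of _ "\<lambda>b. k * c b"] conjI ballI) blast+
  qed
  show "?Q (suminf r) z" if y: "\<And>i::nat. y i \<in> V" and z: "z \<in> V" and Q: "\<And>i. ?Q (r i) (y i)"
    and r: "summable r" and lim: "(\<lambda>n. nrm (\<lambda>t. z t - (\<Sum>i<n. y i t))) \<longlonglongrightarrow> 0" for r y z
  proof -
    have "\<forall>i. \<exists>x c. x \<in> V \<and> nrm x \<le> r i \<and> (\<forall>b\<in>B. norm (c b) \<le> r i) \<and>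
        (\<lambda>t. y i t - T x t - (\<Sum>b\<in>B. c b * b t)) \<in> null"
      using Q by (simp add: Bex_def)
    then obtain x where "\<forall>i. \<exists>c. x i \<in> V \<and> nrm (x i) \<le> r i \<and> (\<forall>b\<in>B. norm (c b) \<le> r i) \<and>
        (\<lambda>t. y i t - T (x i) t - (\<Sum>b\<in>B. c b * b t)) \<in> null"
      by (rule choice[THEN exE])
    then obtain c where "\<forall>i. x i \<in> V \<and> nrm (x i) \<le> r i \<and> (\<forall>b\<in>B. norm (c i b) \<le> r i) \<and>
        (\<lambda>t. y i t - T (x i) t - (\<Sum>b\<in>B. c i b * b t)) \<in> null"
      by (rule choice[THEN exE])
    then have x: "\<And>i. x i \<in> V" "\<And>i. nrm (x i) \<le> r i" "\<And>i b. b \<in> B \<Longrightarrow> norm (c i b) \<le> r i"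
      and N: "\<And>i. (\<lambda>t. y i t - T (x i) t - (\<Sum>b\<in>B. c i b * b t)) \<in> null"
      by auto
    have r0: "0 \<le> r i" for i using x(2)[of i] nrm_nonneg[OF x(1)[of i]] by linarith
    have "summable (\<lambda>i. nrm (x i))"
      using x nrm_nonneg by (intro summable_comparison_test'[OF r, of 0]) simp
    from complete[OF x(1) this] obtain w where w: "w \<in> V"
      and wlim: "(\<lambda>n. nrm (\<lambda>t. w t - (\<Sum>i<n. x i t))) \<longlonglongrightarrow> 0" by blast
    have sc: "summable (\<lambda>i. norm (c i b))" if "b \<in> B" for b
      using x(3)[OF that] by (intro summable_comparison_test'[OF r, of 0]) simp
    define d where "d b = (\<Sum>i. c i b)" for b
    have part: "(\<Sum>i<n. r i) \<le> suminf r" for n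
      using r r0 by (intro sum_le_suminf) auto
    have dB: "norm (d b) \<le> suminf r" if "b \<in> B" for b
    proof -
      have "norm (d b) \<le> (\<Sum>i. norm (c i b))"
        unfolding d_def by (rule summable_norm[OF sc[OF that]])
      also have "\<dots> \<le> suminf r" by (rule suminf_le) (use x(3) that sc r in auto)
      finally show ?thesis .
    qed
    have wB: "nrm w \<le> suminf r"
    proof -
      have "nrm w \<le> nrm (\<lambda>t. w t - (\<Sum>i<n. x i t)) + suminf r" for n
      proof -
        have "nrm (\<lambda>t. \<Sum>i<n. x i t) \<le> (\<Sum>i<n. r i)"
          using nrm_sum[of "{..<n}" x] x sum_mono[of "{..<n}" "\<lambda>i. nrm (x i)" r]
          by (meson order_trans)
        then show ?thesis
          using nrm_le_diff[OF w sum_mem, of "{..<n}" x] x part[of n] by force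
      qed
      moreover have "(\<lambda>n. nrm (\<lambda>t. w t - (\<Sum>i<n. x i t)) + suminf r) \<longlonglongrightarrow> 0 + suminf r"
        by (intro tendsto_add tendsto_const wlim)
      ultimately show ?thesis
        using LIMSEQ_le_const[of "\<lambda>n. nrm (\<lambda>t. w t - (\<Sum>i<n. x i t)) + suminf r" "0 + suminf r"]
        by auto
    qed
    \<comment> \<open>The error of the representation by the summed data w and d. For every n its
      norm is at most the sum of three remainders, those of the series for z, for \<open>T w\<close>
      and for the coefficients, so it is 0.\<close>
    define g where "g = (\<lambda>t. z t - T w t - (\<Sum>b\<in>B. d b * b t))"
    have g: "g \<in> V"
      unfolding g_def using B by (intro diff_mem z T.map_mem w lincomb_mem) auto
    define X where "X n = (\<lambda>t. \<Sum>i<n. x i t)" for n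
    have X: "X n \<in> V" for n unfolding X_def by (intro sum_mem x)
    have Tlim: "(\<lambda>n. nrm (\<lambda>t. T w t - T (X n) t)) \<longlonglongrightarrow> 0"
      by (rule T.map_tendsto[OF w X]) (use wlim in \<open>simp add: X_def\<close>)
    have clim: "(\<lambda>n. \<Sum>b\<in>B. norm (d b - (\<Sum>i<n. c i b)) * nrm b) \<longlonglongrightarrow> (\<Sum>b\<in>B. norm (0::complex) * nrm b)"
    proof (intro tendsto_sum tendsto_mult tendsto_norm tendsto_const)
      fix b assume "b \<in> B"
      from summable_LIMSEQ[OF summable_norm_cancel[OF sc[OF this]]]
      show "(\<lambda>n. d b - (\<Sum>i<n. c i b)) \<longlonglongrightarrow> 0"
        using LIM_zero[of "\<lambda>n. (\<Sum>i<n. c i b)" "d b"] tendsto_minus[of "\<lambda>n. (\<Sum>i<n. c i b) - d b" 0]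
        by (simp add: d_def)
    qed
    let ?e = "\<lambda>n. nrm (\<lambda>t. z t - (\<Sum>i<n. y i t)) + nrm (\<lambda>t. T w t - T (X n) t)
        + (\<Sum>b\<in>B. norm (d b - (\<Sum>i<n. c i b)) * nrm b)"
    have "nrm g \<le> ?e n" for n
    proof -
      let ?a = "\<lambda>t. z t - (\<Sum>i<n. y i t)" and ?b = "\<lambda>t. T w t - T (X n) t"
      let ?c = "\<lambda>t. \<Sum>b\<in>B. (d b - (\<Sum>i<n. c i b)) * b t"
      \<comment> \<open>Collects everything that holds only up to null elements: the n
        representations and the additivity of T. The coefficient 1 matches the form of
        \<open>map_lincomb\<close>.\<close>
      let ?n = "\<lambda>t. (\<Sum>i<n. y i t - T (x i) t - (\<Sum>b\<in>B. c i b * b t)) - (T (X n) t - (\<Sum>i<n. 1 * T (x i) t))"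
      have n: "?n \<in> null"
        by (rule null_diff[OF null_sum[OF N]])
          (use T.map_lincomb[of "{..<n}" x "\<lambda>_. 1"] x(1) in \<open>simp add: X_def\<close>)
      have a: "?a \<in> V" and b: "?b \<in> V" and c: "?c \<in> V"
        using B by (auto intro!: diff_mem z sum_mem y T.map_mem w X scale_mem)
      have eq: "g = (\<lambda>t. ((?a t - ?b t) - ?c t) + ?n t)"
      proof
        fix t
        have "(\<Sum>b\<in>B. (\<Sum>i<n. c i b) * b t) = (\<Sum>i<n. \<Sum>b\<in>B. c i b * b t)"
          unfolding sum_distrib_right by (rule sum.swap)
        then show "g t = ((?a t - ?b t) - ?c t) + ?n t"
          unfolding g_def by (simp add: sum_subtractf sum.distrib algebra_simps)
      qed
      have "nrm g \<le> nrm (\<lambda>t. (?a t - ?b t) - ?c t) + 0"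
        using nrm_triangle[OF diff_mem[OF diff_mem[OF a b] c] null_mem[OF n]] null_nrm[OF n]
        unfolding eq by linarith
      also have "\<dots> \<le> nrm ?a + nrm ?b + nrm ?c"
        using nrm_diff_le[OF diff_mem[OF a b] c] nrm_diff_le[OF a b] by linarith
      also have "nrm ?c \<le> (\<Sum>b\<in>B. norm (d b - (\<Sum>i<n. c i b)) * nrm b)"
        using nrm_sum[of B "\<lambda>b t. (d b - (\<Sum>i<n. c i b)) * b t"] B
        by (force simp: nrm_scale[OF subsetD[OF B(2)]] intro: scale_mem
            intro!: order_trans[OF nrm_sum] sum_mono)
      finally show ?thesis by simp
    qed
    moreover have "?e \<longlonglongrightarrow> 0 + 0 + (\<Sum>b\<in>B. norm (0::complex) * nrm b)"
      by (intro tendsto_add lim Tlim clim)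
    ultimately have "nrm g \<le> 0"
      using LIMSEQ_le_const[of ?e "0 + 0 + (\<Sum>b\<in>B. norm (0::complex) * nrm b)"] by auto
    then have "g \<in> null" using g by (intro nullI)
    then show ?thesis
      using w wB dB unfolding g_def by (intro bexI[of _ w] exI[of _ d] conjI ballI) blast+
  qed
qed

text \<open>The error \<open>d - y\<close> of a good approximation is so small that
  \<open>cospans_bounded\<close> represents it with a coefficient of d of modulus less than 1. As y
  lies in the range of T plus the span of B, this is an equation that can be solved for d.\<close>

lemma cospans_remove:
  assumes T: "bounded_op V null nrm T" and B: "finite B" "B \<subseteq> V" and d: "d \<in> V" "d \<notin> B"
    and co: "cospans V null T (insert d B)"
    and dense: "\<And>\<epsilon>. 0 < \<epsilon> \<Longrightarrow> \<exists>y\<in>V. nrm (\<lambda>t. d t - y t) < \<epsilon> \<and>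
        (\<exists>x\<in>V. \<exists>c. (\<lambda>t. y t - T x t - (\<Sum>b\<in>B. c b * b t)) \<in> null)"
  shows "cospans V null T B"
proof -
  interpret T: bounded_map V nrm V nrm T
    using T bounded_op_iff_bounded_map by blast
  have "\<exists>x\<in>V. \<exists>c. (\<lambda>t. d t - T x t - (\<Sum>b\<in>B. c b * b t)) \<in> null"
  proof -
    have "finite (insert d B)" "insert d B \<subseteq> V" using B d by auto
    from cospans_bounded[OF T this co] obtain C where C: "\<forall>y\<in>V. nrm y \<le> 1 \<longrightarrow> (\<exists>x\<in>V. \<exists>c. nrm x \<le> C \<and>
        (\<forall>b\<in>insert d B. norm (c b) \<le> C) \<and> (\<lambda>t. y t - T x t - (\<Sum>b\<in>insert d B. c b * b t)) \<in> null)"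
      by (rule exE)
    \<comment> \<open>Makes \<open>C * e\<close> at most 1/2; the maximum guards against a C that is
      not positive.\<close>
    define e where "e = 1 / (2 * (max C 1))"
    have e: "0 < e" "C * e < 1" by (auto simp: e_def field_simps max_def)
    obtain y x1 c1 where y: "y \<in> V" "nrm (\<lambda>t. d t - y t) < e" and x1: "x1 \<in> V"
      and c1: "(\<lambda>t. y t - T x1 t - (\<Sum>b\<in>B. c1 b * b t)) \<in> null"
      using dense[OF e(1)] by blast
    let ?z = "\<lambda>t. of_real (1/e) * (d t - y t)"
    have "nrm ?z \<le> 1"
      using nrm_scale[OF diff_mem[OF d(1) y(1)], of "of_real (1/e)"] y(2) e
      by (simp add: norm_divide)
    from C[rule_format, OF scale_mem[OF diff_mem[OF d(1) y(1)]] this]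
    obtain x2 c2 where x2: "x2 \<in> V" and c2: "\<forall>b\<in>insert d B. norm (c2 b) \<le> C"
      "(\<lambda>t. ?z t - T x2 t - (\<Sum>b\<in>insert d B. c2 b * b t)) \<in> null"
      by (elim bexE exE conjE) (rule that)
    \<comment> \<open>The factor left at d once its occurrence in the representation of
      \<open>d - y\<close> has been moved to the left-hand side.\<close>
    define k where "k = 1 - of_real e * c2 d"
    have "norm (of_real e * c2 d) \<le> C * e" using c2(1) e by (simp add: norm_mult mult.commute)
    then have k: "k \<noteq> 0" using e(2) unfolding k_def
      by (metis eq_iff_diff_eq_0 norm_one not_le)
    \<comment> \<open>This is \<open>(x1 + e * x2) / k\<close>, written as an indexed sum so that
      \<open>map_lincomb\<close> applies.\<close>
    define x where "x = (\<lambda>t. \<Sum>i\<in>{0,1::nat}. (if i = 0 then 1 else of_real e) / k * (if i = 0 then x1 else x2) t)"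
    have x: "x \<in> V" unfolding x_def by (intro lincomb_mem) (use x1 x2 in auto)
    have Tx: "(\<lambda>t. T x t - (1 / k * T x1 t + of_real e / k * T x2 t)) \<in> null"
      using T.map_lincomb[of "{0,1::nat}" "\<lambda>i. if i = 0 then x1 else x2"
          "\<lambda>i. (if i = 0 then 1 else of_real e) / k"] x1 x2 unfolding x_def by simp
    define c where "c b = (c1 b + of_real e * c2 b) / k" for b
    have "(\<lambda>t. d t - T x t - (\<Sum>b\<in>B. c b * b t)) =
        (\<lambda>t. (1 / k * (y t - T x1 t - (\<Sum>b\<in>B. c1 b * b t))
          + of_real e / k * (?z t - T x2 t - (\<Sum>b\<in>insert d B. c2 b * b t)))
          - (T x t - (1 / k * T x1 t + of_real e / k * T x2 t)))" (is "?l = ?r")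
    proof
      fix t
      let ?s1 = "\<Sum>b\<in>B. c1 b * b t" and ?s2 = "\<Sum>b\<in>B. c2 b * b t"
      have c: "(\<Sum>b\<in>B. c b * b t) = (?s1 + of_real e * ?s2) / k"
        unfolding c_def by (simp add: sum_divide_distrib sum_distrib_left sum.distrib algebra_simps add_divide_distrib)
      \<comment> \<open>The identity behind solving for d, with the coefficient \<open>c2 d\<close>
        expressed as \<open>(1 - k) / e\<close>.\<close>
      have alg: "D - X - (S1 + E * S2) / k =
          (1 / k * (Y - A1 - S1) + E / k * (1 / E * (D - Y) - A2 - ((1 - k) / E * D + S2)))
            - (X - (1 / k * A1 + E / k * A2))"
        if "E \<noteq> 0" for D X S1 S2 E Y A1 A2 :: complex
        using that k by (simp add: field_simps)
      have "c2 d = (1 - k) / of_real e" using e by (simp add: k_def)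
      then show "?l t = ?r t"
        using B d(2) alg[of "of_real e" "d t" "T x t" ?s1 ?s2 "y t" "T x1 t" "T x2 t"] e
        unfolding c by simp
    qed
    then have "?l \<in> null"
      using null_diff[OF null_add[OF null_scale[OF c1] null_scale[OF c2(2)]] Tx, of "1/k" "of_real e / k"]
      by simp
    then show ?thesis using x by blast
  qed
  then obtain x0 c0 where x0: "x0 \<in> V" and c0: "(\<lambda>t. d t - T x0 t - (\<Sum>b\<in>B. c0 b * b t)) \<in> null"
    by blast
  show ?thesis
    unfolding cospans_def
  proof
    fix y assume "y \<in> V"
    then obtain x c where x: "x \<in> V" and c: "(\<lambda>t. y t - T x t - (\<Sum>b\<in>insert d B. c b * b t)) \<in> null"
      using co unfolding cospans_def by blast
    let ?x = "\<lambda>t. x t + c d * x0 t"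
    have "(\<lambda>t. (T ?x t - T x t - T (\<lambda>t. c d * x0 t) t) + (T (\<lambda>t. c d * x0 t) t - c d * T x0 t)) \<in> null"
      by (intro null_add T.map_add T.map_scale scale_mem x x0)
    from null_diff[OF null_add[OF c null_scale[OF c0, of "c d"]] this]
    have "(\<lambda>t. y t - T ?x t - (\<Sum>b\<in>B. (c b + c d * c0 b) * b t)) \<in> null"
      using B d(2) by (simp add: algebra_simps sum.distrib sum_distrib_left)
    then show "\<exists>x\<in>V. \<exists>c. (\<lambda>t. y t - T x t - (\<Sum>b\<in>B. c b * b t)) \<in> null"
      using add_mem[OF x scale_mem[OF x0, of "c d"]]
      by (intro bexI[of _ ?x] exI[of _ "\<lambda>b. c b + c d * c0 b"])
  qed
qed

end

section \<open>Linear algebra modulo null elements\<close>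

lemma homogeneous_system_nontrivial:
  fixes M :: "'i \<Rightarrow> 'j \<Rightarrow> 'a::field"
  assumes "finite J" "finite I" "card J < card I"
  shows "\<exists>d. (\<exists>i\<in>I. d i \<noteq> 0) \<and> (\<forall>j\<in>J. (\<Sum>i\<in>I. d i * M i j) = 0)"
  using assms
proof (induction J arbitrary: I M)
  case empty
  then obtain i where "i \<in> I" by fastforce
  then show ?case by (intro exI[of _ "\<lambda>_. 1"]) auto
next
  case (insert j J)
  show ?case
  proof (cases "\<forall>i\<in>I. M i j = 0")
    case True
    have "card J < card I" using insert.prems insert.hyps by simp
    from insert.IH[OF insert.prems(1) this, of M]
    obtain d where "\<exists>i\<in>I. d i \<noteq> 0" "\<forall>j\<in>J. (\<Sum>i\<in>I. d i * M i j) = 0" by blast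
    then show ?thesis using True by (intro exI[of _ d]) auto
  next
    case False
    then obtain i0 where i0: "i0 \<in> I" "M i0 j \<noteq> 0" by blast
    \<comment> \<open>Gaussian elimination: equation j is solved for the unknown i0 and substituted
      into the others; the induction hypothesis applies to the reduced system, and i0 is recovered
      from equation j.\<close>
    let ?I = "I - {i0}"
    have "card J < card ?I"
      using insert i0 by (simp add: card_Diff_singleton)
    then obtain d where d: "\<exists>i\<in>?I. d i \<noteq> 0"
      "\<forall>k\<in>J. (\<Sum>i\<in>?I. d i * (M i k - M i j / M i0 j * M i0 k)) = 0"
      using insert.IH[of ?I "\<lambda>i k. M i k - M i j / M i0 j * M i0 k"] insert.prems by auto
    define e where "e = d(i0 := - (\<Sum>i\<in>?I. d i * M i j) / M i0 j)"
    have split: "(\<Sum>i\<in>I. e i * M i k) =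
        - (\<Sum>i\<in>?I. d i * M i j) / M i0 j * M i0 k + (\<Sum>i\<in>?I. d i * M i k)" for k
    proof -
      have "(\<Sum>i\<in>I. e i * M i k) = e i0 * M i0 k + (\<Sum>i\<in>?I. e i * M i k)"
        using insert.prems i0 by (simp add: sum.remove)
      also have "(\<Sum>i\<in>?I. e i * M i k) = (\<Sum>i\<in>?I. d i * M i k)"
        by (rule sum.cong) (auto simp: e_def)
      finally show ?thesis by (simp add: e_def)
    qed
    have "(\<Sum>i\<in>I. e i * M i k) = 0" if "k \<in> insert j J" for k
    proof (cases "k = j")
      case True
      then show ?thesis using i0 unfolding split by simp
    next
      case False
      then have "(\<Sum>i\<in>?I. d i * M i k) - (\<Sum>i\<in>?I. d i * M i j) / M i0 j * M i0 k = 0"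
        using d(2) that by (simp add: algebra_simps sum_subtractf sum_distrib_left sum_divide_distrib)
      then show ?thesis unfolding split by simp
    qed
    moreover have "\<exists>i\<in>I. e i \<noteq> 0" using d(1) by (auto simp: e_def)
    ultimately show ?thesis by blast
  qed
qed

context seminormed_complete
begin

text \<open>\<open>dim_mod\<close> is the least size of a spanning set. A relation with
  \<open>c b\<close> nonzero would express b by the other elements, and the set without b would
  still span.\<close>

lemma minimal_spanning_independent:
  assumes B: "finite B" "B \<subseteq> K" "spans_mod null B K" and card: "card B = dim_mod null K"
    and K: "K \<subseteq> V" and c: "(\<lambda>t. \<Sum>b\<in>B. c b * b t) \<in> null" and b: "b \<in> B"
  shows "c b = 0"
proof (rule ccontr)
  assume cb: "c b \<noteq> 0"
  let ?B = "B - {b}"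
  have "spans_mod null ?B K"
    unfolding spans_mod_def
  proof
    fix x assume "x \<in> K"
    then obtain d where d: "(\<lambda>t. x t - (\<Sum>b\<in>B. d b * b t)) \<in> null"
      using B(3) unfolding spans_mod_def by blast
    \<comment> \<open>The multiple of the relation is chosen so that the coefficient of b becomes
      0.\<close>
    define e where "e b' = d b' - d b / c b * c b'" for b'
    have "(\<Sum>b\<in>?B. e b * b t) = (\<Sum>b\<in>B. e b * b t)" for t
      using B b cb by (simp add: sum.remove e_def)
    moreover have "(\<Sum>b\<in>B. e b * b t) = (\<Sum>b\<in>B. d b * b t) - d b / c b * (\<Sum>b\<in>B. c b * b t)" for t
      by (simp add: e_def algebra_simps sum_subtractf sum_distrib_left)
    ultimately have "(\<lambda>t. x t - (\<Sum>b\<in>?B. e b * b t)) =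
        (\<lambda>t. (x t - (\<Sum>b\<in>B. d b * b t)) + d b / c b * (\<Sum>b\<in>B. c b * b t))"
      by (simp add: fun_eq_iff)
    then have "(\<lambda>t. x t - (\<Sum>b\<in>?B. e b * b t)) \<in> null"
      using null_add[OF d null_scale[OF c, of "d b / c b"]] by simp
    then show "\<exists>e. (\<lambda>t. x t - (\<Sum>b\<in>?B. e b * b t)) \<in> null" by blast
  qed
  then have "dim_mod null K \<le> card ?B"
    unfolding dim_mod_def using B by (intro Least_le exI[of _ ?B]) auto
  then show False
    using card b B(1) by (metis card_Diff1_less not_less)
qed

text \<open>Compactness of the unit sphere of the coefficient space. If no constant worked, there
  would be coefficients of total size 1 whose combinations tend to 0; the limit of a convergent
  subsequence has total size 1 and a null combination, against independence.\<close>

lemma independent_bounded_below: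
  assumes I: "finite I" and v: "\<And>i. i \<in> I \<Longrightarrow> v i \<in> V"
    and indep: "\<And>c. (\<lambda>t. \<Sum>i\<in>I. c i * v i t) \<in> null \<Longrightarrow> (\<forall>i\<in>I. c i = 0)"
  shows "\<exists>C>0. \<forall>c. (\<Sum>i\<in>I. norm (c i)) \<le> C * nrm (\<lambda>t. \<Sum>i\<in>I. c i * v i t)"
proof (rule ccontr)
  assume contr: "\<not> ?thesis"
  have mem: "(\<lambda>t. \<Sum>i\<in>I. c i * v i t) \<in> V" for c using v by (intro lincomb_mem)
  have "\<exists>c. (\<Sum>i\<in>I. norm (c i)) = 1 \<and> nrm (\<lambda>t. \<Sum>i\<in>I. c i * v i t) \<le> 1 / real (Suc n)" for n
  proof -
    obtain c where c: "real (Suc n) * nrm (\<lambda>t. \<Sum>i\<in>I. c i * v i t) < (\<Sum>i\<in>I. norm (c i))"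
      using contr by (meson not_le of_nat_0_less_iff zero_less_Suc)
    define s where "s = (\<Sum>i\<in>I. norm (c i))"
    have s: "0 < s"
      using c nrm_nonneg[OF mem, of c] unfolding s_def
      by (metis le_less_trans mult_nonneg_nonneg of_nat_0_le_iff)
    let ?c = "\<lambda>i. of_real (1/s) * c i"
    have "(\<Sum>i\<in>I. norm (?c i)) = 1 / s * s"
      using s by (simp add: norm_mult norm_divide flip: sum_divide_distrib s_def)
    moreover have "(\<lambda>t. \<Sum>i\<in>I. ?c i * v i t) = (\<lambda>t. of_real (1/s) * (\<Sum>i\<in>I. c i * v i t))"
      by (simp add: sum_distrib_left mult.assoc)
    then have "nrm (\<lambda>t. \<Sum>i\<in>I. ?c i * v i t) = 1 / s * nrm (\<lambda>t. \<Sum>i\<in>I. c i * v i t)"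
      using nrm_scale[OF mem, of "of_real (1/s)" c] s by (simp add: norm_divide)
    moreover have "1 / s * nrm (\<lambda>t. \<Sum>i\<in>I. c i * v i t) \<le> 1 / real (Suc n)"
      using c s unfolding s_def[symmetric] by (simp add: field_simps)
    ultimately show ?thesis using s by (intro exI[of _ ?c]) auto
  qed
  then have "\<forall>n. \<exists>c. (\<Sum>i\<in>I. norm (c i)) = 1 \<and> nrm (\<lambda>t. \<Sum>i\<in>I. c i * v i t) \<le> 1 / real (Suc n)"
    by blast
  from choice[OF this] obtain c where c1: "\<And>n. (\<Sum>i\<in>I. norm (c n i)) = 1"
    and csmall: "\<And>n. nrm (\<lambda>t. \<Sum>i\<in>I. c n i * v i t) \<le> 1 / real (Suc n)" by blast
  have "norm (c n i) \<le> 1" if "i \<in> I" for n i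
    using member_le_sum[of i I "\<lambda>i. norm (c n i)"] that I c1[of n] by simp
  then have "bounded ((\<lambda>x. x i) ` range c)" if "i \<in> I" for i
    using that by (auto simp: bounded_iff)
  then have "\<exists>l r. strict_mono r \<and>
      (\<forall>e>0. \<forall>\<^sub>F n in sequentially. \<forall>i\<in>I. dist (c (r n) i) (l i) < e)"
    using compact_lemma_general[of I "\<lambda>x i. x i" c "\<lambda>x. x", THEN spec[of _ I]] I by auto
  then obtain l r where r: "strict_mono r"
    and l: "\<And>e. 0 < e \<Longrightarrow> \<forall>\<^sub>F n in sequentially. \<forall>i\<in>I. dist (c (r n) i) (l i) < e"
    by blast
  have lim: "(\<lambda>n. c (r n) i) \<longlonglongrightarrow> l i" if "i \<in> I" for i
  proof (rule tendstoI)
    fix e :: real assume "0 < e"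
    from l[OF this] show "\<forall>\<^sub>F n in sequentially. dist (c (r n) i) (l i) < e"
      by (rule eventually_mono) (use that in blast)
  qed
  let ?e = "\<lambda>n. (\<Sum>i\<in>I. norm (l i - c (r n) i) * nrm (v i)) + 1 / real (Suc (r n))"
  have "nrm (\<lambda>t. \<Sum>i\<in>I. l i * v i t) \<le> ?e n" for n
  proof -
    have "nrm (\<lambda>t. \<Sum>i\<in>I. l i * v i t) \<le>
        nrm (\<lambda>t. (\<Sum>i\<in>I. l i * v i t) - (\<Sum>i\<in>I. c (r n) i * v i t)) + nrm (\<lambda>t. \<Sum>i\<in>I. c (r n) i * v i t)"
      by (rule nrm_le_diff[OF mem mem])
    also have "(\<lambda>t. (\<Sum>i\<in>I. l i * v i t) - (\<Sum>i\<in>I. c (r n) i * v i t)) =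
        (\<lambda>t. \<Sum>i\<in>I. (l i - c (r n) i) * v i t)"
      by (simp add: sum_subtractf algebra_simps)
    also have "nrm \<dots> \<le> (\<Sum>i\<in>I. nrm (\<lambda>t. (l i - c (r n) i) * v i t))"
      using v by (intro nrm_sum scale_mem)
    also have "\<dots> = (\<Sum>i\<in>I. norm (l i - c (r n) i) * nrm (v i))"
      using v by (intro sum.cong) (simp_all add: nrm_scale)
    finally show ?thesis using csmall[of "r n"] by linarith
  qed
  moreover have "?e \<longlonglongrightarrow> (\<Sum>i\<in>I. norm (l i - l i) * nrm (v i)) + 0"
    by (intro tendsto_add tendsto_sum tendsto_mult tendsto_norm tendsto_diff tendsto_const lim)
      (use LIMSEQ_subseq_LIMSEQ[OF LIMSEQ_inverse_real_of_nat r] in \<open>simp_all add: o_def inverse_eq_divide\<close>)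
  ultimately have "nrm (\<lambda>t. \<Sum>i\<in>I. l i * v i t) \<le> 0"
    using LIMSEQ_le_const[of ?e "(\<Sum>i\<in>I. norm (l i - l i) * nrm (v i)) + 0"] by auto
  then have "\<forall>i\<in>I. l i = 0" using mem by (intro indep nullI)
  moreover have "(\<lambda>n. \<Sum>i\<in>I. norm (c (r n) i)) \<longlonglongrightarrow> (\<Sum>i\<in>I. norm (l i))"
    by (intro tendsto_sum tendsto_norm lim)
  ultimately show False
    using c1 LIMSEQ_unique[of "\<lambda>n. 1::real" 0 1] by simp
qed

text \<open>The sum of the range of T and the span of B has finite codimension, witnessed by D.
  Being dense, it comes arbitrarily close to each element of D, so \<open>cospans_remove\<close>
  discards these elements one at a time.\<close>

lemma cospans_Un_dense:
  assumes T: "bounded_op V null nrm T" and B: "finite B" "B \<subseteq> V"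
    and dense: "\<And>y \<epsilon>. \<lbrakk>y \<in> V; 0 < \<epsilon>\<rbrakk> \<Longrightarrow> \<exists>z\<in>V. nrm (\<lambda>t. y t - z t) < \<epsilon> \<and>
        (\<exists>x\<in>V. \<exists>c. (\<lambda>t. z t - T x t - (\<Sum>b\<in>B. c b * b t)) \<in> null)"
    and D: "finite D" "D \<subseteq> V" "cospans V null T (B \<union> D)"
  shows "cospans V null T B"
  using D
proof (induction D)
  case (insert d D)
  show ?case
  proof (cases "d \<in> B \<union> D")
    case True
    then show ?thesis using insert by (auto simp: insert_absorb)
  next
    case False
    have extend: "\<exists>c'. (\<lambda>t. z t - T x t - (\<Sum>b\<in>B \<union> D. c' b * b t)) \<in> null"
      if "(\<lambda>t. z t - T x t - (\<Sum>b\<in>B. c b * b t)) \<in> null" for z x c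
    proof -
      have "(\<Sum>b\<in>B \<union> D. (if b \<in> B then c b else 0) * b t) = (\<Sum>b\<in>B. c b * b t)" for t
        using B insert.hyps by (intro sum.mono_neutral_cong_right) auto
      then show ?thesis using that by (intro exI[of _ "\<lambda>b. if b \<in> B then c b else 0"]) simp
    qed
    have "cospans V null T (B \<union> D)"
    proof (rule cospans_remove[OF T])
      show "finite (B \<union> D)" "B \<union> D \<subseteq> V" "d \<in> V" "d \<notin> B \<union> D"
        using insert B False by auto
      show "cospans V null T (insert d (B \<union> D))" using insert.prems by simp
      show "\<exists>y\<in>V. nrm (\<lambda>t. d t - y t) < \<epsilon> \<and>
          (\<exists>x\<in>V. \<exists>c. (\<lambda>t. y t - T x t - (\<Sum>b\<in>B \<union> D. c b * b t)) \<in> null)" if \<epsilon>: "0 < \<epsilon>" for \<epsilon>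
      proof -
        obtain y x c where y: "y \<in> V" "nrm (\<lambda>t. d t - y t) < \<epsilon>" "x \<in> V"
          and c: "(\<lambda>t. y t - T x t - (\<Sum>b\<in>B. c b * b t)) \<in> null"
          using dense[OF _ \<epsilon>, of d] insert.prems by blast
        show ?thesis using y extend[OF c] by (intro bexI[of _ y] conjI bexI[of _ x])
      qed
    qed
    then show ?thesis using insert by blast
  qed
qed simp

end

section \<open>Intertwined Fredholm operators of equal index\<close>

locale fredholm_pair = bounded_map X nX Y nY J
  for X :: "('x \<Rightarrow> complex) set" and nX and Y :: "('y \<Rightarrow> complex) set" and nY and J +
  fixes S T D
  assumes S: "fredholm_op X X.null nX S" and T: "fredholm_op Y Y.null nY T"
    and index_eq: "fredholm_index X X.null S = fredholm_index Y Y.null T"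
    and inj: "\<lbrakk>x \<in> X; J x \<in> Y.null\<rbrakk> \<Longrightarrow> x \<in> X.null"
    and dense_range: "\<lbrakk>y \<in> Y; 0 < \<epsilon>\<rbrakk> \<Longrightarrow> \<exists>x\<in>X. nY (\<lambda>t. y t - J x t) < \<epsilon>"
    and D: "D \<subseteq> X" and dense_D: "\<lbrakk>x \<in> X; 0 < \<epsilon>\<rbrakk> \<Longrightarrow> \<exists>d\<in>D. nX (\<lambda>t. x t - d t) < \<epsilon>"
    and intertwines_D: "d \<in> D \<Longrightarrow> (\<lambda>t. J (S d) t - T (J d) t) \<in> Y.null"
begin

sublocale S: bounded_map X nX X nX S
  using S X.bounded_op_iff_bounded_map unfolding fredholm_op_def by blast

sublocale T: bounded_map Y nY Y nY T
  using T Y.bounded_op_iff_bounded_map unfolding fredholm_op_def by blast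

text \<open>Both sides are continuous in x, because S, T and J are bounded, and they agree on the
  dense set D.\<close>

lemma intertwines:
  assumes x: "x \<in> X"
  shows "(\<lambda>t. J (S x) t - T (J x) t) \<in> Y.null"
proof -
  have "\<forall>n. \<exists>d. d \<in> D \<and> nX (\<lambda>t. x t - d t) < 1 / real (Suc n)"
    using dense_D[OF x] by (simp add: Bex_def)
  from choice[OF this] obtain d where d: "\<And>n. d n \<in> D"
    and small: "\<And>n. nX (\<lambda>t. x t - d n t) < 1 / real (Suc n)" by blast
  have dX: "d n \<in> X" for n using d D by blast
  have "norm (nX (\<lambda>t. x t - d n t)) \<le> inverse (real (Suc n))" for n
    using small[of n] X.nrm_nonneg[OF X.diff_mem[OF x dX]] by (simp add: inverse_eq_divide less_imp_le)
  then have "\<forall>\<^sub>F n in sequentially. norm (nX (\<lambda>t. x t - d n t)) \<le> inverse (real (Suc n))"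
    by simp
  from Lim_null_comparison[OF this LIMSEQ_inverse_real_of_nat]
  have lim: "(\<lambda>n. nX (\<lambda>t. x t - d n t)) \<longlonglongrightarrow> 0" .
  have lim1: "(\<lambda>n. nY (\<lambda>t. J (S x) t - J (S (d n)) t)) \<longlonglongrightarrow> 0"
    by (rule map_tendsto[OF S.map_mem[OF x] S.map_mem[OF dX] S.map_tendsto[OF x dX lim]])
  have lim2: "(\<lambda>n. nY (\<lambda>t. T (J x) t - T (J (d n)) t)) \<longlonglongrightarrow> 0"
    by (rule T.map_tendsto[OF map_mem[OF x] map_mem[OF dX] map_tendsto[OF x dX lim]])
  have le: "nY (\<lambda>t. J (S x) t - T (J x) t) \<le>
      nY (\<lambda>t. J (S x) t - J (S (d n)) t) + nY (\<lambda>t. T (J x) t - T (J (d n)) t)" for n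
  proof -
    have m: "J (S x) \<in> Y" "T (J x) \<in> Y" "J (S (d n)) \<in> Y" "T (J (d n)) \<in> Y"
      using x dX by (auto intro: map_mem S.map_mem T.map_mem)
    show ?thesis
      using Y.nrm_diff_trans[OF m(1,3,2)] Y.nrm_diff_trans[OF m(3,4,2)]
        Y.null_nrm[OF intertwines_D[OF d]] Y.nrm_diff_commute[OF m(2,4)] by force
  qed
  have "nY (\<lambda>t. J (S x) t - T (J x) t) \<le> 0"
    using LIMSEQ_le_const[OF tendsto_add[OF lim1 lim2]] le by auto
  then show ?thesis
    using x by (intro Y.nullI Y.diff_mem map_mem T.map_mem S.map_mem)
qed

lemma ker_map:
  assumes "x \<in> ker_op X X.null S"
  shows "J x \<in> ker_op Y Y.null T"
proof -
  have x: "x \<in> X" "S x \<in> X.null" using assms by (auto simp: ker_op_def)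
  from Y.null_diff[OF map_null[OF x(2)] intertwines[OF x(1)]] have "T (J x) \<in> Y.null" by simp
  then show ?thesis using map_mem[OF x(1)] by (simp add: ker_op_def)
qed

text \<open>Up to null elements \<open>J (S x)\<close> is \<open>T (J x)\<close>, hence
  \<open>T y\<close>, hence 0; injectivity of J on X then removes J. This returns an element of X
  from the kernel of T to the kernel of S.\<close>

lemma ker_cancel:
  assumes x: "x \<in> X" and y: "y \<in> ker_op Y Y.null T" and eq: "(\<lambda>t. J x t - y t) \<in> Y.null"
  shows "x \<in> ker_op X X.null S"
proof -
  have y: "y \<in> Y" "T y \<in> Y.null" using y by (auto simp: ker_op_def)
  have "(\<lambda>t. J (S x) t - T (J x) t + (T (\<lambda>t. J x t - y t) t - (T (\<lambda>t. J x t - y t) t - (T (J x) t - T y t))) + T y t) \<in> Y.null"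
    by (intro Y.null_add Y.null_diff[OF T.map_null[OF eq]] intertwines T.map_diff map_mem x y)
  then have "J (S x) \<in> Y.null" by simp
  then show ?thesis using inj[OF S.map_mem[OF x]] x by (simp add: ker_op_def)
qed

lemma codim_range_le: "codim_range Y Y.null T \<le> codim_range X X.null S"
proof -
  have "\<exists>n B. finite B \<and> B \<subseteq> X \<and> card B = n \<and> cospans X X.null S B"
    using S unfolding fredholm_op_def by blast
  from LeastI_ex[OF this] obtain B where B: "finite B" "B \<subseteq> X"
    "card B = codim_range X X.null S" "cospans X X.null S B"
    unfolding codim_range_def by blast
  have JB: "finite (J ` B)" "J ` B \<subseteq> Y" using B map_mem by auto
  have hit: "\<exists>w\<in>Y. \<exists>c. (\<lambda>t. J x t - T w t - (\<Sum>b\<in>J ` B. c b * b t)) \<in> Y.null" if x: "x \<in> X" for x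
  proof -
    obtain w c where w: "w \<in> X" and c: "(\<lambda>t. x t - S w t - (\<Sum>b\<in>B. c b * b t)) \<in> X.null"
      using B(4) x unfolding cospans_def by blast
    have BX: "b \<in> X" if "b \<in> B" for b using that B by blast
    define s where "s = (\<lambda>t. \<Sum>b\<in>B. c b * b t)"
    have s: "s \<in> X" unfolding s_def using BX by (intro X.lincomb_mem)
    \<comment> \<open>J may send several elements of B to the same function; adding their
      coefficients turns a sum over B into a sum over the image of B.\<close>
    define e where "e b' = (\<Sum>b\<in>{b\<in>B. J b = b'}. c b)" for b'
    have e: "(\<Sum>b\<in>J ` B. e b * b t) = (\<Sum>b\<in>B. c b * J b t)" for t
    proof -
      have "(\<Sum>b\<in>B. c b * J b t) = (\<Sum>b'\<in>J ` B. \<Sum>b\<in>{b\<in>B. J b = b'}. c b * J b t)"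
        by (rule sum.image_gen[OF B(1)])
      also have "\<dots> = (\<Sum>b'\<in>J ` B. e b' * b' t)"
        unfolding e_def sum_distrib_right by (intro sum.cong refl) auto
      finally show ?thesis by simp
    qed
    have 1: "J (\<lambda>t. x t - S w t - s t) \<in> Y.null"
      using map_null[OF c] by (simp add: s_def)
    have 2: "(\<lambda>t. J (\<lambda>t. x t - S w t - s t) t - (J (\<lambda>t. x t - S w t) t - J s t)) \<in> Y.null"
      by (intro map_diff X.diff_mem x S.map_mem w s)
    have 3: "(\<lambda>t. J (\<lambda>t. x t - S w t) t - (J x t - J (S w) t)) \<in> Y.null"
      by (intro map_diff x S.map_mem w)
    have 4: "(\<lambda>t. J s t - (\<Sum>b\<in>B. c b * J b t)) \<in> Y.null"
      unfolding s_def using BX by (intro map_lincomb B(1))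
    have "(\<lambda>t. J x t - T (J w) t - (\<Sum>b\<in>J ` B. e b * b t)) =
        (\<lambda>t. (((J (\<lambda>t. x t - S w t - s t) t
          - (J (\<lambda>t. x t - S w t - s t) t - (J (\<lambda>t. x t - S w t) t - J s t)))
          - (J (\<lambda>t. x t - S w t) t - (J x t - J (S w) t)))
          + (J s t - (\<Sum>b\<in>B. c b * J b t))) + (J (S w) t - T (J w) t))"
      unfolding e by (simp add: fun_eq_iff)
    also have "\<dots> \<in> Y.null"
      by (intro Y.null_add Y.null_diff[OF Y.null_diff[OF 1 2] 3] 4 intertwines w)
    finally show ?thesis using map_mem[OF w] by blast
  qed
  \<comment> \<open>The Fredholm property of T supplies some finite supplement; density of the range
    of T plus the span of the image of B then allows all of it to be discarded.\<close>
  obtain D' where D': "finite D'" "D' \<subseteq> Y" "cospans Y Y.null T D'"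
    using T unfolding fredholm_op_def by blast
  have "cospans Y Y.null T (J ` B \<union> D')"
    unfolding cospans_def
  proof
    fix y assume "y \<in> Y"
    then obtain x c where x: "x \<in> Y" and c: "(\<lambda>t. y t - T x t - (\<Sum>b\<in>D'. c b * b t)) \<in> Y.null"
      using D'(3) unfolding cospans_def by blast
    have "(\<Sum>b\<in>J ` B \<union> D'. (if b \<in> D' then c b else 0) * b t) = (\<Sum>b\<in>D'. c b * b t)" for t
      using JB D' by (intro sum.mono_neutral_cong_right) auto
    then have "(\<lambda>t. y t - T x t - (\<Sum>b\<in>J ` B \<union> D'. (if b \<in> D' then c b else 0) * b t)) \<in> Y.null"
      using c by simp
    then show "\<exists>x\<in>Y. \<exists>c. (\<lambda>t. y t - T x t - (\<Sum>b\<in>J ` B \<union> D'. c b * b t)) \<in> Y.null"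
      using x by (intro bexI[of _ x] exI[of _ "\<lambda>b. if b \<in> D' then c b else 0"])
  qed
  moreover have "\<exists>z\<in>Y. nY (\<lambda>t. y t - z t) < \<epsilon> \<and>
      (\<exists>x\<in>Y. \<exists>c. (\<lambda>t. z t - T x t - (\<Sum>b\<in>J ` B. c b * b t)) \<in> Y.null)"
    if y: "y \<in> Y" "0 < \<epsilon>" for y \<epsilon>
  proof -
    obtain x where x: "x \<in> X" "nY (\<lambda>t. y t - J x t) < \<epsilon>" using dense_range y by blast
    show ?thesis by (intro bexI[of _ "J x"] conjI x hit map_mem)
  qed
  ultimately have "cospans Y Y.null T (J ` B)"
    using T JB D' unfolding fredholm_op_def
    by (intro Y.cospans_Un_dense[of T "J ` B" D']) auto
  then have "codim_range Y Y.null T \<le> card (J ` B)"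
    unfolding codim_range_def using JB by (intro Least_le exI[of _ "J ` B"]) auto
  also have "\<dots> \<le> card B" using B(1) by (rule card_image_le)
  finally show ?thesis using B by simp
qed

lemma dim_ker_le:
  "dim_mod Y.null (ker_op Y Y.null T) \<le> dim_mod X.null (ker_op X X.null S)"
  using index_eq codim_range_le by (simp add: fredholm_index_def)

text \<open>A relation among the images pulls back along the injective J to a relation in a minimal
  spanning set, where all coefficients vanish. So the image of B is independent in the kernel of
  T.\<close>

lemma ker_basis:
  obtains B where "finite B" "B \<subseteq> ker_op X X.null S" "spans_mod X.null B (ker_op X X.null S)"
    "card B = dim_mod X.null (ker_op X X.null S)"
    "\<And>c. (\<lambda>t. \<Sum>b\<in>B. c b * J b t) \<in> Y.null \<Longrightarrow> \<forall>b\<in>B. c b = 0"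
proof -
  let ?K = "ker_op X X.null S"
  have "\<exists>n B. finite B \<and> B \<subseteq> ?K \<and> card B = n \<and> spans_mod X.null B ?K"
    using S unfolding fredholm_op_def by blast
  from LeastI_ex[OF this] obtain B where B: "finite B" "B \<subseteq> ?K"
    "card B = dim_mod X.null ?K" "spans_mod X.null B ?K"
    unfolding dim_mod_def by blast
  have K: "?K \<subseteq> X" by (auto simp: ker_op_def)
  have BX: "b \<in> X" if "b \<in> B" for b using that B K by blast
  have "\<forall>b\<in>B. c b = 0" if c: "(\<lambda>t. \<Sum>b\<in>B. c b * J b t) \<in> Y.null" for c
  proof -
    have "(\<lambda>t. \<Sum>b\<in>B. c b * b t) \<in> X.null"
    proof (rule inj)
      show "(\<lambda>t. \<Sum>b\<in>B. c b * b t) \<in> X" using BX by (intro X.lincomb_mem)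
      show "J (\<lambda>t. \<Sum>b\<in>B. c b * b t) \<in> Y.null"
        using Y.null_add[OF map_lincomb[OF B(1) BX, of "\<lambda>b. b" c] c] by simp
    qed
    then show ?thesis
      using X.minimal_spanning_independent[OF B(1,2,4,3) K] by blast
  qed
  then show ?thesis using that B by blast
qed

lemma ker_surj:
  assumes y: "y \<in> ker_op Y Y.null T"
  shows "\<exists>x \<in> ker_op X X.null S. (\<lambda>t. J x t - y t) \<in> Y.null"
proof -
  let ?KS = "ker_op X X.null S" and ?KT = "ker_op Y Y.null T"
  obtain B where B: "finite B" "B \<subseteq> ?KS" "spans_mod X.null B ?KS" "card B = dim_mod X.null ?KS"
    and indep: "\<And>c. (\<lambda>t. \<Sum>b\<in>B. c b * J b t) \<in> Y.null \<Longrightarrow> \<forall>b\<in>B. c b = 0"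
    by (rule ker_basis) (rule that)
  have "\<exists>n B. finite B \<and> B \<subseteq> ?KT \<and> card B = n \<and> spans_mod Y.null B ?KT"
    using T unfolding fredholm_op_def by blast
  from LeastI_ex[OF this] obtain E where E: "finite E" "E \<subseteq> ?KT"
    "card E = dim_mod Y.null ?KT" "spans_mod Y.null E ?KT"
    unfolding dim_mod_def by blast
  have BX: "b \<in> X" if "b \<in> B" for b using that B by (auto simp: ker_op_def)
  \<comment> \<open>\<open>None\<close> stands for y and \<open>Some b\<close> for the image of b.
    Option indices keep y apart from the images even if it equals one of them, so the family has one
    member more than the dimension of the kernel of T can accommodate.\<close>
  define I where "I = insert None (Some ` B)"
  define v where "v = (\<lambda>i. case i of None \<Rightarrow> y | Some b \<Rightarrow> J b)"
  have I: "finite I" "card I = Suc (card B)"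
    using B by (auto simp: I_def card_insert_if card_image)
  have "v i \<in> ?KT" if "i \<in> I" for i
    using that y ker_map B by (auto simp: I_def v_def)
  then have "\<forall>i. \<exists>c. i \<in> I \<longrightarrow> (\<lambda>t. v i t - (\<Sum>b\<in>E. c b * b t)) \<in> Y.null"
    using E(4) unfolding spans_mod_def by blast
  from choice[OF this] obtain M where
    M: "\<And>i. i \<in> I \<Longrightarrow> (\<lambda>t. v i t - (\<Sum>b\<in>E. M i b * b t)) \<in> Y.null" by blast
  have "card E < card I" using I E B dim_ker_le by simp
  from homogeneous_system_nontrivial[OF E(1) I(1) this, of M] obtain d where
    d: "\<exists>i\<in>I. d i \<noteq> 0" "\<forall>b\<in>E. (\<Sum>i\<in>I. d i * M i b) = 0" by blast
  have "(\<lambda>t. \<Sum>i\<in>I. d i * (v i t - (\<Sum>b\<in>E. M i b * b t))) \<in> Y.null"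
    by (intro Y.null_sum Y.null_scale M)
  also have "(\<lambda>t. \<Sum>i\<in>I. d i * (v i t - (\<Sum>b\<in>E. M i b * b t))) = (\<lambda>t. \<Sum>i\<in>I. d i * v i t)"
  proof
    fix t
    have "(\<Sum>i\<in>I. d i * (\<Sum>b\<in>E. M i b * b t)) = (\<Sum>b\<in>E. (\<Sum>i\<in>I. d i * M i b) * b t)"
      unfolding sum_distrib_left sum_distrib_right by (subst sum.swap) (simp add: mult.assoc)
    also have "\<dots> = 0" using d(2) by simp
    finally show "(\<Sum>i\<in>I. d i * (v i t - (\<Sum>b\<in>E. M i b * b t))) = (\<Sum>i\<in>I. d i * v i t)"
      by (simp add: algebra_simps sum_subtractf)
  qed
  also have "(\<lambda>t. \<Sum>i\<in>I. d i * v i t) = (\<lambda>t. d None * y t + (\<Sum>b\<in>B. d (Some b) * J b t))"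
    unfolding I_def using B(1) by (simp add: v_def sum.reindex)
  finally have rel: "(\<lambda>t. d None * y t + (\<Sum>b\<in>B. d (Some b) * J b t)) \<in> Y.null" .
  \<comment> \<open>Otherwise the relation would involve the independent images of B alone. Hence it
    can be solved for y.\<close>
  have nz: "d None \<noteq> 0"
  proof
    assume 0: "d None = 0"
    then have "\<forall>b\<in>B. d (Some b) = 0" using indep[of "\<lambda>b. d (Some b)"] rel by simp
    then show False using d(1) 0 by (auto simp: I_def)
  qed
  define c where "c b = - d (Some b) / d None" for b
  define x where "x = (\<lambda>t. \<Sum>b\<in>B. c b * b t)"
  have x: "x \<in> X" unfolding x_def using BX by (intro X.lincomb_mem)
  have "(\<lambda>t. (J x t - (\<Sum>b\<in>B. c b * J b t))
      - 1 / d None * (d None * y t + (\<Sum>b\<in>B. d (Some b) * J b t))) \<in> Y.null"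
    unfolding x_def using BX by (intro Y.null_diff Y.null_scale map_lincomb rel B(1))
  also have "(\<lambda>t. (J x t - (\<Sum>b\<in>B. c b * J b t))
      - 1 / d None * (d None * y t + (\<Sum>b\<in>B. d (Some b) * J b t))) = (\<lambda>t. J x t - y t)"
    using nz by (simp add: fun_eq_iff c_def sum_negf sum_divide_distrib add_divide_distrib)
  finally have "(\<lambda>t. J x t - y t) \<in> Y.null" .
  then show ?thesis using ker_cancel[OF x y] by blast
qed

text \<open>Passes through coefficients with respect to B: the norm of x is controlled by their
  size, and their size by the norm of \<open>J x\<close>, because the images of B are
  independent.\<close>

lemma ker_bounded_below:
  "\<exists>C>0. \<forall>x \<in> ker_op X X.null S. nX x \<le> C * nY (J x)"
proof -
  let ?K = "ker_op X X.null S"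
  obtain B where B: "finite B" "B \<subseteq> ?K" "spans_mod X.null B ?K" "card B = dim_mod X.null ?K"
    and indep: "\<And>c. (\<lambda>t. \<Sum>b\<in>B. c b * J b t) \<in> Y.null \<Longrightarrow> \<forall>b\<in>B. c b = 0"
    by (rule ker_basis) (rule that)
  have BX: "b \<in> X" if "b \<in> B" for b using that B by (auto simp: ker_op_def)
  have "\<exists>C>0. \<forall>c. (\<Sum>b\<in>B. norm (c b)) \<le> C * nY (\<lambda>t. \<Sum>b\<in>B. c b * J b t)"
    by (rule Y.independent_bounded_below[OF B(1) map_mem[OF BX] indep])
  then obtain C where C: "0 < C" "\<And>c. (\<Sum>b\<in>B. norm (c b)) \<le> C * nY (\<lambda>t. \<Sum>b\<in>B. c b * J b t)"
    by blast
  \<comment> \<open>The summand 1 makes the constant positive even if B is empty.\<close>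
  define M where "M = 1 + (\<Sum>b\<in>B. nX b)"
  have M: "nX b \<le> M" if "b \<in> B" for b
    using member_le_sum[of b B nX] that B(1) BX X.nrm_nonneg by (force simp: M_def)
  have M0: "0 < M"
    unfolding M_def using sum_nonneg[of B nX] BX X.nrm_nonneg by (simp add: add_pos_nonneg)
  have "nX x \<le> M * C * nY (J x)" if xK: "x \<in> ?K" for x
  proof -
    have x: "x \<in> X" using xK by (auto simp: ker_op_def)
    obtain c where c: "(\<lambda>t. x t - (\<Sum>b\<in>B. c b * b t)) \<in> X.null"
      using B(3) xK unfolding spans_mod_def by blast
    define s where "s = (\<lambda>t. \<Sum>b\<in>B. c b * b t)"
    have s: "s \<in> X" unfolding s_def using BX by (intro X.lincomb_mem)
    have sJ: "(\<lambda>t. \<Sum>b\<in>B. c b * J b t) \<in> Y" by (intro Y.lincomb_mem map_mem BX)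
    have "nX x \<le> nX s"
      using X.nrm_le_diff[OF x s] X.null_nrm[OF c] by (simp add: s_def)
    also have "\<dots> \<le> (\<Sum>b\<in>B. nX (\<lambda>t. c b * b t))"
      unfolding s_def using BX by (intro X.nrm_sum X.scale_mem)
    also have "\<dots> \<le> (\<Sum>b\<in>B. M * norm (c b))"
      using mult_left_mono[OF M norm_ge_zero] BX by (intro sum_mono) (simp add: X.nrm_scale mult.commute[of M])
    also have "\<dots> = M * (\<Sum>b\<in>B. norm (c b))" by (simp add: sum_distrib_left)
    also have "\<dots> \<le> M * (C * nY (\<lambda>t. \<Sum>b\<in>B. c b * J b t))"
      using C(2) M0 by (intro mult_left_mono) auto
    also have "nY (\<lambda>t. \<Sum>b\<in>B. c b * J b t) = nY (J x)"
    proof -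
      have "(\<lambda>t. J s t - (\<Sum>b\<in>B. c b * J b t)) \<in> Y.null"
        unfolding s_def using BX by (intro map_lincomb B(1))
      then have "nY (\<lambda>t. \<Sum>b\<in>B. c b * J b t) = nY (J s)"
        using Y.nrm_le_diff[OF map_mem[OF s] sJ] Y.nrm_le_diff[OF sJ map_mem[OF s]]
          Y.nrm_diff_commute[OF map_mem[OF s] sJ] Y.null_nrm by fastforce
      moreover have "nY (\<lambda>t. J x t - J s t) = 0"
        using nrm_map_diff[OF x s] Y.null_nrm[OF map_null[OF c]] by (simp add: s_def)
      then have "nY (J x) = nY (J s)"
        using Y.nrm_le_diff[OF map_mem[OF s] map_mem[OF x]] Y.nrm_le_diff[OF map_mem[OF x] map_mem[OF s]]
          Y.nrm_diff_commute[OF map_mem[OF s] map_mem[OF x]] by linarith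
      ultimately show ?thesis by simp
    qed
    finally show ?thesis by (simp add: mult.assoc)
  qed
  then show ?thesis using C(1) M0 by (intro exI[of _ "M * C"]) auto
qed

end

section \<open>Lebesgue spaces\<close>

lemma convex_powr_le:
  fixes u v l s :: real
  assumes s: "1 \<le> s" and uv: "0 \<le> u" "0 \<le> v" and l: "0 \<le> l" "l \<le> 1"
  shows "(l * u + (1 - l) * v) powr s \<le> l * u powr s + (1 - l) * v powr s"
proof -
  have zero: "(k * w) powr s \<le> k * w powr s" if "0 \<le> k" "k \<le> 1" "0 \<le> w" for k w
  proof -
    have "k powr s \<le> k" using powr_mono'[of 1 s k] that s by simp
    then show ?thesis using that by (simp add: powr_mult mult_right_mono)
  qed
  consider "u = 0" | "v = 0" | "0 < u" "0 < v" using uv by linarith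
  then show ?thesis
  proof cases
    case 1
    then show ?thesis using zero[of "1 - l" v] l uv s by simp
  next
    case 2
    then show ?thesis using zero[of l u] l uv s by simp
  next
    case 3
    then show ?thesis
      using convex_onD[OF powr_convex[OF s], of l v u] l by (simp add: add.commute)
  qed
qed

text \<open>One notion for both sides of the theorem: Lebesgue measure on \<open>{0..2*pi}\<close>
  gives the functions on the circle, counting measure on the naturals gives l^p.\<close>

definition Lp_fun :: "real \<Rightarrow> 'a measure \<Rightarrow> ('a \<Rightarrow> complex) \<Rightarrow> bool" where
  "Lp_fun s M f \<longleftrightarrow> f \<in> borel_measurable M \<and> integrable M (\<lambda>x. norm (f x) powr s)"

definition Lp_norm :: "real \<Rightarrow> 'a measure \<Rightarrow> ('a \<Rightarrow> complex) \<Rightarrow> real" where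
  "Lp_norm s M f = (\<integral>x. norm (f x) powr s \<partial>M) powr (1 / s)"

lemma Lp_norm_nonneg: "0 \<le> Lp_norm s M f"
  by (simp add: Lp_norm_def)

lemma Lp_norm_powr: "0 < s \<Longrightarrow> Lp_norm s M f powr s = (\<integral>x. norm (f x) powr s \<partial>M)"
  by (simp add: Lp_norm_def powr_powr integral_nonneg_AE)

lemma Lp_norm_le_iff:
  assumes "0 < s" "0 \<le> C"
  shows "Lp_norm s M f \<le> C \<longleftrightarrow> (\<integral>x. norm (f x) powr s \<partial>M) \<le> C powr s"
  using powr_mono2[of s "Lp_norm s M f" C] powr_less_mono2[of s C "Lp_norm s M f"] assms
  by (metis Lp_norm_nonneg Lp_norm_powr linorder_not_less less_imp_le)

lemma Lp_fun_zero: "Lp_fun s M (\<lambda>_. 0)"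
  by (simp add: Lp_fun_def)

lemma Lp_fun_scale: "Lp_fun s M f \<Longrightarrow> Lp_fun s M (\<lambda>x. c * f x)"
  by (auto simp: Lp_fun_def norm_mult powr_mult)

lemma Lp_norm_scale:
  assumes "0 < s"
  shows "Lp_norm s M (\<lambda>x. c * f x) = norm c * Lp_norm s M f"
  using assms by (simp add: Lp_norm_def norm_mult powr_mult powr_powr integral_nonneg_AE)

lemma Lp_norm_eq_0:
  assumes "0 < s" "Lp_fun s M f"
  shows "Lp_norm s M f = 0 \<longleftrightarrow> (AE x in M. f x = 0)"
  using assms integral_nonneg_eq_0_iff_AE[of M "\<lambda>x. norm (f x) powr s"]
  by (simp add: Lp_norm_def Lp_fun_def)

lemma AE_norm_powr_mono:
  assumes "0 < s" "AE x in M. norm (g x) \<le> norm (f x)"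
  shows "AE x in M. norm (g x) powr s \<le> norm (f x) powr s"
  using assms(2) by (rule eventually_mono) (use assms(1) in \<open>simp add: powr_mono2\<close>)

lemma Lp_fun_bound:
  assumes "0 < s" "Lp_fun s M f" "g \<in> borel_measurable M" "AE x in M. norm (g x) \<le> norm (f x)"
  shows "Lp_fun s M g"
proof -
  have [measurable]: "g \<in> borel_measurable M" by fact
  have "integrable M (\<lambda>x. norm (g x) powr s)"
  proof (rule Bochner_Integration.integrable_bound)
    show "integrable M (\<lambda>x. norm (f x) powr s)" using assms(2) by (simp add: Lp_fun_def)
    show "(\<lambda>x. norm (g x) powr s) \<in> borel_measurable M" by measurable
    show "AE x in M. norm (norm (g x) powr s) \<le> norm (norm (f x) powr s)"
      using AE_norm_powr_mono[OF assms(1,4)] by simp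
  qed
  then show ?thesis using assms(3) by (simp add: Lp_fun_def)
qed

lemma Lp_norm_mono_AE:
  assumes "0 < s" "Lp_fun s M f" "g \<in> borel_measurable M" "AE x in M. norm (g x) \<le> norm (f x)"
  shows "Lp_norm s M g \<le> Lp_norm s M f"
proof -
  have "(\<integral>x. norm (g x) powr s \<partial>M) \<le> (\<integral>x. norm (f x) powr s \<partial>M)"
    using Lp_fun_bound[OF assms] assms(2)
    by (intro integral_mono_AE AE_norm_powr_mono[OF assms(1,4)]) (simp_all add: Lp_fun_def)
  then show ?thesis
    unfolding Lp_norm_def using assms(1) by (intro powr_mono2) (simp_all add: integral_nonneg_AE)
qed

lemma integrable_pointwise_bound:
  fixes h :: "'a \<Rightarrow> 'b::{banach, second_countable_topology}"
  assumes "integrable M w" "h \<in> borel_measurable M" "\<And>x. norm (h x) \<le> w x"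
  shows "integrable M h"
  using assms(1,2)
proof (rule Bochner_Integration.integrable_bound)
  show "AE x in M. norm (h x) \<le> norm (w x)"
    using assms(3) by (intro AE_I2) (metis abs_ge_self order_trans real_norm_def)
qed

lemma Lp_fun_measurable: "Lp_fun s M f \<Longrightarrow> f \<in> borel_measurable M"
  by (simp add: Lp_fun_def)

lemma Lp_fun_integrable: "Lp_fun s M f \<Longrightarrow> integrable M (\<lambda>x. norm (f x) powr s)"
  by (simp add: Lp_fun_def)

lemma Lp_fun_add:
  assumes s: "1 \<le> s" and f: "Lp_fun s M f" and g: "Lp_fun s M g"
  shows "Lp_fun s M (\<lambda>x. f x + g x)"
  unfolding Lp_fun_def
proof
  have [measurable]: "f \<in> borel_measurable M" "g \<in> borel_measurable M"
    using f g by (simp_all add: Lp_fun_measurable)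
  show "(\<lambda>x. f x + g x) \<in> borel_measurable M" by measurable
  have "norm (f x + g x) powr s \<le> 2 powr s * norm (f x) powr s + 2 powr s * norm (g x) powr s" for x
  proof -
    have "norm (f x + g x) powr s \<le> (2 * max (norm (f x)) (norm (g x))) powr s"
      using s norm_triangle_ineq[of "f x" "g x"] by (intro powr_mono2) (auto simp: max_def)
    also have "\<dots> \<le> 2 powr s * norm (f x) powr s + 2 powr s * norm (g x) powr s"
      by (auto simp: powr_mult max_def)
    finally show ?thesis .
  qed
  moreover have "integrable M (\<lambda>x. 2 powr s * norm (f x) powr s + 2 powr s * norm (g x) powr s)"
    by (intro Bochner_Integration.integrable_add integrable_mult_right Lp_fun_integrable f g)
  moreover have "(\<lambda>x. norm (f x + g x) powr s) \<in> borel_measurable M" by measurable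
  ultimately show "integrable M (\<lambda>x. norm (f x + g x) powr s)"
    by (intro integrable_pointwise_bound[where h = "\<lambda>x. norm (f x + g x) powr s"]) simp_all
qed

text \<open>Minkowski's inequality by convexity of the s-th power: with
  \<open>l = A / (A + B)\<close>, the sum of the moduli is \<open>A + B\<close> times the convex
  combination, with weights l and \<open>1 - l\<close>, of the normalized moduli
  \<open>norm (f x) / A\<close> and \<open>norm (g x) / B\<close>.\<close>

lemma Lp_norm_triangle:
  assumes s: "1 \<le> s" and f: "Lp_fun s M f" and g: "Lp_fun s M g"
  shows "Lp_norm s M (\<lambda>x. f x + g x) \<le> Lp_norm s M f + Lp_norm s M g"
proof -
  define A B where "A = Lp_norm s M f" and "B = Lp_norm s M g"
  have AB: "0 \<le> A" "0 \<le> B" by (auto simp: A_def B_def Lp_norm_nonneg)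
  have fg: "Lp_fun s M (\<lambda>x. f x + g x)" by (rule Lp_fun_add[OF s f g])
  consider "A = 0" | "B = 0" | "0 < A" "0 < B" using AB by linarith
  then show ?thesis
  proof cases
    case 1
    then have "AE x in M. f x = 0" using Lp_norm_eq_0[of s M f] s f by (simp add: A_def)
    then have "AE x in M. norm (f x + g x) \<le> norm (g x)" by (rule eventually_mono) simp
    then have "Lp_norm s M (\<lambda>x. f x + g x) \<le> Lp_norm s M g"
      using s g fg by (intro Lp_norm_mono_AE) (simp_all add: Lp_fun_measurable)
    then show ?thesis using AB by (simp add: A_def)
  next
    case 2
    then have "AE x in M. g x = 0" using Lp_norm_eq_0[of s M g] s g by (simp add: B_def)
    then have "AE x in M. norm (f x + g x) \<le> norm (f x)" by (rule eventually_mono) simp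
    then have "Lp_norm s M (\<lambda>x. f x + g x) \<le> Lp_norm s M f"
      using s f fg by (intro Lp_norm_mono_AE) (simp_all add: Lp_fun_measurable)
    then show ?thesis using AB by (simp add: B_def)
  next
    case 3
    define l where "l = A / (A + B)"
    have l: "0 \<le> l" "l \<le> 1" "1 - l = B / (A + B)" using 3 by (auto simp: l_def field_simps)
    let ?a = "\<lambda>x. norm (f x) powr s" and ?b = "\<lambda>x. norm (g x) powr s"
    have int: "(\<integral>x. ?a x \<partial>M) = A powr s" "(\<integral>x. ?b x \<partial>M) = B powr s"
      using s by (auto simp: A_def B_def Lp_norm_powr)
    have "norm (f x + g x) powr s \<le>
        (A + B) powr s * (l * (?a x / A powr s) + (1 - l) * (?b x / B powr s))" for x
    proof -
      have "norm (f x + g x) powr s \<le> ((A + B) * (l * (norm (f x) / A) + (1 - l) * (norm (g x) / B))) powr s"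
      proof (rule powr_mono2)
        have "(A + B) * (l * (norm (f x) / A) + (1 - l) * (norm (g x) / B)) = norm (f x) + norm (g x)"
        proof -
          have "(A + B) * l = A" "(A + B) * (1 - l) = B" using 3 unfolding l(3) by (auto simp: l_def)
          then show ?thesis
            using 3 by (simp add: distrib_left flip: mult.assoc)
        qed
        then show "norm (f x + g x) \<le> (A + B) * (l * (norm (f x) / A) + (1 - l) * (norm (g x) / B))"
          using norm_triangle_ineq[of "f x" "g x"] by simp
      qed (use s in auto)
      also have "\<dots> = (A + B) powr s * (l * (norm (f x) / A) + (1 - l) * (norm (g x) / B)) powr s"
        using l 3 by (subst powr_mult) auto
      also have "\<dots> \<le> (A + B) powr s * (l * (norm (f x) / A) powr s + (1 - l) * (norm (g x) / B) powr s)"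
        using l 3 s by (intro mult_left_mono convex_powr_le) auto
      finally show ?thesis using 3 by (simp add: powr_divide)
    qed
    then have "(\<integral>x. norm (f x + g x) powr s \<partial>M) \<le>
        (\<integral>x. (A + B) powr s * (l * (?a x / A powr s) + (1 - l) * (?b x / B powr s)) \<partial>M)"
      by (intro integral_mono Lp_fun_integrable fg Bochner_Integration.integrable_add
          integrable_mult_right integrable_divide f g)
    also have "\<dots> = (A + B) powr s * (l * (A powr s / A powr s) + (1 - l) * (B powr s / B powr s))"
      using f g by (simp add: Lp_fun_def int)
    also have "\<dots> = (A + B) powr s" using 3 by simp
    finally have "Lp_norm s M (\<lambda>x. f x + g x) \<le> A + B"
      using s AB by (subst Lp_norm_le_iff) auto
    then show ?thesis by (simp add: A_def B_def)
  qed
qed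

lemma Lp_fun_norm:
  assumes "Lp_fun s M f"
  shows "Lp_fun s M (\<lambda>x. of_real (norm (f x)))"
proof -
  have [measurable]: "f \<in> borel_measurable M" using assms by (simp add: Lp_fun_def)
  have "(\<lambda>x. of_real (norm (f x)) :: complex) \<in> borel_measurable M" by measurable
  then show ?thesis using assms by (simp add: Lp_fun_def)
qed

lemma Lp_norm_norm: "Lp_norm s M (\<lambda>x. of_real (norm (f x))) = Lp_norm s M f"
  by (simp add: Lp_norm_def)

lemma Lp_fun_sum:
  assumes "1 \<le> s" "\<And>i. i \<in> I \<Longrightarrow> Lp_fun s M (u i)"
  shows "Lp_fun s M (\<lambda>x. \<Sum>i\<in>I. u i x)"
  using assms(2)
proof (induction I rule: infinite_finite_induct)
  case (insert i I)
  then show ?case using Lp_fun_add[OF assms(1), of M "u i"] by simp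
qed (simp_all add: Lp_fun_zero)

lemma Lp_norm_sum:
  assumes "1 \<le> s" "\<And>i. i \<in> I \<Longrightarrow> Lp_fun s M (u i)"
  shows "Lp_norm s M (\<lambda>x. \<Sum>i\<in>I. u i x) \<le> (\<Sum>i\<in>I. Lp_norm s M (u i))"
  using assms(2)
proof (induction I rule: infinite_finite_induct)
  case (insert i I)
  then show ?case
    using Lp_norm_triangle[OF assms(1), of M "u i" "\<lambda>x. \<Sum>i\<in>I. u i x"] Lp_fun_sum[OF assms(1), of I M u]
    by simp
qed (use assms(1) in \<open>simp_all add: Lp_norm_def\<close>)

text \<open>Riesz-Fischer. Monotone convergence puts the sum G of the moduli into the space; hence
  the series converges almost everywhere, and G dominates all its remainders.\<close>

lemma Lp_complete:
  assumes s: "1 \<le> s" and u: "\<And>i::nat. Lp_fun s M (u i)" and sum: "summable (\<lambda>i. Lp_norm s M (u i))"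
  defines "f \<equiv> \<lambda>x. \<Sum>i. u i x"
  shows "Lp_fun s M f" and "(\<lambda>n. Lp_norm s M (\<lambda>x. f x - (\<Sum>i<n. u i x))) \<longlonglongrightarrow> 0"
proof -
  have um[measurable]: "u i \<in> borel_measurable M" for i using u by (simp add: Lp_fun_def)
  define S where "S = (\<Sum>i. Lp_norm s M (u i))"
  define g where "g n x = (\<Sum>i<n. norm (u i x))" for n x
  define G where "G x = (\<Sum>i. norm (u i x))" for x
  have g0: "0 \<le> g n x" for n x by (simp add: g_def sum_nonneg)
  have gm[measurable]: "g n \<in> borel_measurable M" for n unfolding g_def by measurable
  have Gm[measurable]: "G \<in> borel_measurable M" unfolding G_def by measurable
  have fm[measurable]: "f \<in> borel_measurable M" unfolding f_def by measurable
  have gL: "Lp_fun s M (\<lambda>x. of_real (g n x))" for n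
    using Lp_fun_sum[OF s, of "{..<n}" M "\<lambda>i x. of_real (norm (u i x))"] Lp_fun_norm[OF u]
    by (simp add: g_def)
  have S0: "0 \<le> S" unfolding S_def by (intro suminf_nonneg sum Lp_norm_nonneg)
  have gN: "(\<integral>x. g n x powr s \<partial>M) \<le> S powr s" for n
  proof -
    have "Lp_norm s M (\<lambda>x. of_real (g n x)) \<le> (\<Sum>i<n. Lp_norm s M (u i))"
      using Lp_norm_sum[OF s, of "{..<n}" M "\<lambda>i x. of_real (norm (u i x))"] Lp_fun_norm[OF u]
      by (simp add: g_def Lp_norm_norm)
    also have "\<dots> \<le> S" unfolding S_def by (intro sum_le_suminf sum) (auto simp: Lp_norm_nonneg)
    finally show ?thesis using s S0 g0 by (subst (asm) Lp_norm_le_iff) auto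
  qed
  \<comment> \<open>Where the series of moduli diverges, G is an unspecified \<open>suminf\<close>,
    whereas H is infinite there. So finiteness of the integral of H shows that divergence occurs
    only on a null set.\<close>
  define H where "H x = (SUP n. ennreal (g n x powr s))" for x
  have Hm[measurable]: "H \<in> borel_measurable M" unfolding H_def by measurable
  have "(\<integral>\<^sup>+x. H x \<partial>M) = (SUP n. \<integral>\<^sup>+x. ennreal (g n x powr s) \<partial>M)"
    unfolding H_def
  proof (rule nn_integral_monotone_convergence_SUP)
    show "incseq (\<lambda>n x. ennreal (g n x powr s))"
      using s g0 by (auto simp: incseq_def le_fun_def g_def intro!: ennreal_leI powr_mono2 sum_mono2 sum_nonneg)
  qed measurable
  also have "\<dots> \<le> ennreal (S powr s)"
  proof (rule SUP_least)
    fix n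
    have "(\<integral>\<^sup>+x. ennreal (g n x powr s) \<partial>M) = ennreal (\<integral>x. g n x powr s \<partial>M)"
      using gL[of n] g0 by (intro nn_integral_eq_integral) (simp_all add: Lp_fun_def)
    also have "\<dots> \<le> ennreal (S powr s)" using gN by (rule ennreal_leI)
    finally show "(\<integral>\<^sup>+x. ennreal (g n x powr s) \<partial>M) \<le> ennreal (S powr s)" .
  qed
  finally have Hfin: "(\<integral>\<^sup>+x. H x \<partial>M) < \<infinity>" by (auto simp: le_less_trans)
  then have "AE x in M. H x \<noteq> \<infinity>" by (intro nn_integral_PInf_AE) auto
  then have AE: "AE x in M. summable (\<lambda>i. norm (u i x)) \<and> ennreal (G x powr s) \<le> H x"
  proof (rule eventually_mono)
    fix x assume Hx: "H x \<noteq> \<infinity>"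
    have le: "g n x powr s \<le> enn2real (H x)" for n
    proof -
      have "ennreal (g n x powr s) \<le> H x" unfolding H_def by (rule SUP_upper) simp
      then show ?thesis using Hx by (metis enn2real_ennreal enn2real_mono infinity_ennreal_def powr_ge_zero top.not_eq_extremum)
    qed
    have "g n x \<le> enn2real (H x) powr (1 / s)" for n
      using powr_mono2[OF _ _ le, of "1 / s" n] s g0[of n x] by (simp add: powr_powr)
    then have sm: "summable (\<lambda>i. norm (u i x))"
      unfolding g_def by (intro summableI_nonneg_bounded) auto
    have "(\<lambda>n. g n x) \<longlonglongrightarrow> G x" unfolding g_def G_def by (rule summable_LIMSEQ[OF sm])
    moreover have "g n x \<le> G x" for n
      unfolding g_def G_def by (rule sum_le_suminf[OF sm]) auto
    moreover have "0 \<le> G x" unfolding G_def by (intro suminf_nonneg sm) auto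
    ultimately have "(\<lambda>n. g n x powr s) \<longlonglongrightarrow> G x powr s"
      using s by (intro tendsto_powr2) (auto simp: g0)
    then have "G x powr s \<le> enn2real (H x)" using le by (intro LIMSEQ_le_const2) auto
    then have "ennreal (G x powr s) \<le> H x"
      using Hx by (metis ennreal_enn2real ennreal_leI infinity_ennreal_def top.not_eq_extremum)
    with sm show "summable (\<lambda>i. norm (u i x)) \<and> ennreal (G x powr s) \<le> H x" by simp
  qed
  have GL: "Lp_fun s M (\<lambda>x. of_real (G x))"
    unfolding Lp_fun_def
  proof
    have "AE x in M. 0 \<le> G x"
      using AE by (rule eventually_mono) (auto simp: G_def intro!: suminf_nonneg)
    then have "AE x in M. ennreal (norm (norm (of_real (G x) :: complex) powr s)) \<le> H x"
      using AE by eventually_elim simp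
    then have "(\<integral>\<^sup>+x. ennreal (norm (norm (of_real (G x) :: complex) powr s)) \<partial>M) \<le> (\<integral>\<^sup>+x. H x \<partial>M)"
      by (rule nn_integral_mono_AE)
    then show "integrable M (\<lambda>x. norm (of_real (G x) :: complex) powr s)"
      using Hfin by (intro integrableI_bounded) (auto simp: le_less_trans)
  qed measurable
  have bound: "AE x in M. norm (f x - (\<Sum>i<n. u i x)) \<le> G x" for n
    using AE
  proof (rule eventually_mono)
    fix x assume x: "summable (\<lambda>i. norm (u i x)) \<and> ennreal (G x powr s) \<le> H x"
    then have sm: "summable (\<lambda>i. norm (u i x))" by simp
    have "f x - (\<Sum>i<n. u i x) = (\<Sum>i. u (i + n) x)"
      using suminf_split_initial_segment[OF summable_norm_cancel[OF sm], of n] by (simp add: f_def)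
    also have "norm \<dots> \<le> (\<Sum>i. norm (u (i + n) x))"
      using summable_norm[of "\<lambda>i. u (i + n) x"] summable_iff_shift[of "\<lambda>i. norm (u i x)" n] sm by simp
    also have "\<dots> = G x - g n x"
      using suminf_split_initial_segment[OF sm, of n] by (simp add: G_def g_def)
    also have "\<dots> \<le> G x" using g0 by simp
    finally show "norm (f x - (\<Sum>i<n. u i x)) \<le> G x" .
  qed
  have "AE x in M. norm (f x) \<le> norm (of_real (G x) :: complex)"
    using bound[of 0] by (rule eventually_mono) simp
  then show "Lp_fun s M f"
    using s by (intro Lp_fun_bound[OF _ GL fm]) auto
  have "(\<lambda>n. \<integral>x. norm (f x - (\<Sum>i<n. u i x)) powr s \<partial>M) \<longlonglongrightarrow> (\<integral>x. 0 \<partial>M)"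
  proof (rule integral_dominated_convergence[where w = "\<lambda>x. norm (of_real (G x) :: complex) powr s"])
    show "integrable M (\<lambda>x. norm (of_real (G x) :: complex) powr s)" using GL by (simp add: Lp_fun_def)
    show "AE x in M. (\<lambda>n. norm (f x - (\<Sum>i<n. u i x)) powr s) \<longlonglongrightarrow> 0"
      using AE
    proof (rule eventually_mono)
      fix x assume "summable (\<lambda>i. norm (u i x)) \<and> ennreal (G x powr s) \<le> H x"
      then have "summable (\<lambda>i. u i x)" by (simp add: summable_norm_cancel)
      then have "(\<lambda>n. \<Sum>i<n. u i x) \<longlonglongrightarrow> f x"
        unfolding f_def by (rule summable_LIMSEQ)
      then have "(\<lambda>n. norm (f x - (\<Sum>i<n. u i x))) \<longlonglongrightarrow> norm (f x - f x)"
        by (intro tendsto_norm tendsto_diff tendsto_const)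
      then have "(\<lambda>n. norm (f x - (\<Sum>i<n. u i x))) \<longlonglongrightarrow> 0" by simp
      then show "(\<lambda>n. norm (f x - (\<Sum>i<n. u i x)) powr s) \<longlonglongrightarrow> 0"
        using s by (intro tendsto_zero_powrI tendsto_const) auto
    qed
    show "AE x in M. norm (norm (f x - (\<Sum>i<n. u i x)) powr s) \<le> norm (of_real (G x) :: complex) powr s" for n
      using bound[of n] by (rule eventually_mono) (use s in \<open>auto intro!: powr_mono2\<close>)
  qed measurable
  then show "(\<lambda>n. Lp_norm s M (\<lambda>x. f x - (\<Sum>i<n. u i x))) \<longlonglongrightarrow> 0"
    unfolding Lp_norm_def using s
    by (intro tendsto_zero_powrI tendsto_const) (auto intro!: integral_nonneg_AE)
qed

lemma Holder_inequality:
  assumes p: "1 < p" "1 < q" "1 / p + 1 / q = 1" and f: "Lp_fun p M f" and g: "Lp_fun q M g"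
  shows "integrable M (\<lambda>x. f x * g x)"
    and "norm (\<integral>x. f x * g x \<partial>M) \<le> Lp_norm p M f * Lp_norm q M g"
proof -
  have [measurable]: "f \<in> borel_measurable M" "g \<in> borel_measurable M"
    using f g by (simp_all add: Lp_fun_measurable)
  have "norm (f x * g x) \<le> norm (f x) powr p / p + norm (g x) powr q / q" for x
    using Youngs_inequality[OF p, of "norm (f x)" "norm (g x)"] by (simp add: norm_mult)
  moreover have "integrable M (\<lambda>x. norm (f x) powr p / p + norm (g x) powr q / q)"
    by (intro Bochner_Integration.integrable_add integrable_divide Lp_fun_integrable f g)
  moreover have "(\<lambda>x. f x * g x) \<in> borel_measurable M" by measurable
  ultimately show int: "integrable M (\<lambda>x. f x * g x)"
    by (intro integrable_pointwise_bound[where h = "\<lambda>x. f x * g x"])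
  define A B where "A = Lp_norm p M f" and "B = Lp_norm q M g"
  have AB: "0 \<le> A" "0 \<le> B" by (auto simp: A_def B_def Lp_norm_nonneg)
  have "norm (\<integral>x. f x * g x \<partial>M) \<le> A * B"
  proof (cases "A = 0 \<or> B = 0")
    case True
    then have "(AE x in M. f x = 0) \<or> (AE x in M. g x = 0)"
      using Lp_norm_eq_0[of p M f] Lp_norm_eq_0[of q M g] p f g by (auto simp: A_def B_def)
    then have "AE x in M. f x * g x = 0"
    proof
      assume "AE x in M. f x = 0"
      then show ?thesis by (rule eventually_mono) simp
    next
      assume "AE x in M. g x = 0"
      then show ?thesis by (rule eventually_mono) simp
    qed
    then have "(\<integral>x. f x * g x \<partial>M) = 0" by (rule integral_eq_zero_AE)
    then show ?thesis using AB by simp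
  next
    case False
    then have AB': "0 < A" "0 < B" using AB by auto
    let ?a = "\<lambda>x. norm (f x) powr p" and ?b = "\<lambda>x. norm (g x) powr q"
    have i: "(\<integral>x. ?a x \<partial>M) = A powr p" "(\<integral>x. ?b x \<partial>M) = B powr q"
      using p by (auto simp: A_def B_def Lp_norm_powr)
    have "norm (f x * g x) \<le> A * B * (?a x / A powr p / p + ?b x / B powr q / q)" for x
    proof -
      have "norm (f x * g x) = A * B * (norm (f x) / A * (norm (g x) / B))"
        using AB' by (simp add: norm_mult)
      also have "\<dots> \<le> A * B * ((norm (f x) / A) powr p / p + (norm (g x) / B) powr q / q)"
        using AB' by (intro mult_left_mono Youngs_inequality p) auto
      finally show ?thesis using AB' by (simp add: powr_divide)
    qed
    then have "(\<integral>x. norm (f x * g x) \<partial>M) \<le>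
        (\<integral>x. A * B * (?a x / A powr p / p + ?b x / B powr q / q) \<partial>M)"
      by (intro integral_mono integrable_norm int Bochner_Integration.integrable_add
          integrable_mult_right integrable_divide Lp_fun_integrable f g)
    also have "\<dots> = A * B * (A powr p / A powr p / p + B powr q / B powr q / q)"
      using f g by (simp add: Lp_fun_def i)
    also have "\<dots> = A * B" using AB' p by simp
    finally show ?thesis
      using integral_norm_bound[of M "\<lambda>x. f x * g x"] by linarith
  qed
  then show "norm (\<integral>x. f x * g x \<partial>M) \<le> Lp_norm p M f * Lp_norm q M g"
    by (simp add: A_def B_def)
qed

section \<open>Fourier coefficients and Fejer means\<close>

abbreviation circ :: "real measure" where
  "circ \<equiv> lebesgue_on {0..2*pi}"

lemma emeasure_circ: "emeasure circ (space circ) = ennreal (2 * pi)"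
  by (simp add: emeasure_restrict_space space_restrict_space)

interpretation circ: finite_measure circ
  by (rule finite_measureI) (simp only: emeasure_circ infinity_ennreal_def ennreal_neq_top not_False_eq_True)

lemma measure_circ: "measure circ (space circ) = 2 * pi"
  by (simp only: measure_def emeasure_circ) simp

lemma continuous_measurable_circ: "continuous_on {0..2*pi} f \<Longrightarrow> f \<in> borel_measurable circ"
  by (rule continuous_imp_measurable_on_sets_lebesgue) auto

lemma cis_measurable_circ [measurable]: "(\<lambda>\<theta>. cis (c * \<theta>)) \<in> borel_measurable circ"
  by (intro continuous_measurable_circ continuous_intros)

lemma cis_linear_measurable_circ [measurable]: "(\<lambda>\<theta>. cis (- (c * \<theta>))) \<in> borel_measurable circ"
  by (intro continuous_measurable_circ continuous_intros)

lemma Lspace_iff_Lp_fun: "Lspace s f \<longleftrightarrow> Lp_fun s circ (\<lambda>\<theta>. f (cis \<theta>))"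
  by (simp add: Lspace_def Lp_fun_def set_borel_measurable_def set_integrable_def
      borel_measurable_restrict_space_iff integrable_restrict_space)

lemma Lnorm_eq_Lp_norm:
  assumes "0 < s"
  shows "Lnorm s f = (1 / (2 * pi)) powr (1 / s) * Lp_norm s circ (\<lambda>\<theta>. f (cis \<theta>))"
proof -
  have "Lnorm s f = ((1 / (2 * pi)) * (\<integral>\<theta>. norm (f (cis \<theta>)) powr s \<partial>circ)) powr (1 / s)"
    by (simp add: Lnorm_def set_lebesgue_integral_def integral_restrict_space)
  then show ?thesis
    by (simp only: Lp_norm_def powr_mult integral_nonneg_AE)
qed

lemma null_T_iff: "f \<in> null_T \<longleftrightarrow> (AE \<theta> in circ. f (cis \<theta>) = 0)"
  by (simp add: null_T_def AE_restrict_space_iff)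

lemma fcoef_eq_integral:
  "fcoef f n = (\<integral>\<theta>. f (cis \<theta>) * cis (- (of_int n * \<theta>)) \<partial>circ) / of_real (2 * pi)"
  by (simp add: fcoef_def set_lebesgue_integral_def integral_restrict_space)

text \<open>Additivity of \<open>fcoef\<close> requires integrability, since the integral of a
  non-integrable function is 0 by convention.\<close>

definition L1 :: "(complex \<Rightarrow> complex) \<Rightarrow> bool" where
  "L1 f \<longleftrightarrow> integrable circ (\<lambda>\<theta>. f (cis \<theta>))"

lemma Lspace_mono:
  assumes "0 < r" "r \<le> s" "Lspace s f"
  shows "Lspace r f"
proof -
  have f: "Lp_fun s circ (\<lambda>\<theta>. f (cis \<theta>))" using assms(3) by (simp add: Lspace_iff_Lp_fun)
  have [measurable]: "(\<lambda>\<theta>. f (cis \<theta>)) \<in> borel_measurable circ" using f by (rule Lp_fun_measurable)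
  have "integrable circ (\<lambda>\<theta>. norm (f (cis \<theta>)) powr r)"
  proof (rule integrable_pointwise_bound)
    show "integrable circ (\<lambda>\<theta>. 1 + norm (f (cis \<theta>)) powr s)"
      by (intro Bochner_Integration.integrable_add Lp_fun_integrable f) simp
    fix \<theta>
    show "norm (norm (f (cis \<theta>)) powr r) \<le> 1 + norm (f (cis \<theta>)) powr s"
    proof (cases "norm (f (cis \<theta>)) \<le> 1")
      case True
      then have "norm (f (cis \<theta>)) powr r \<le> 1" using assms powr_mono2[of r "norm (f (cis \<theta>))" 1] by simp
      then show ?thesis by (simp add: add_increasing2)
    next
      case False
      then have "norm (f (cis \<theta>)) powr r \<le> norm (f (cis \<theta>)) powr s" using assms by (intro powr_mono) auto
      then show ?thesis by simp
    qed
  qed measurable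
  then show ?thesis by (simp add: Lspace_iff_Lp_fun Lp_fun_def)
qed

lemma Lspace_imp_L1:
  assumes "1 \<le> s" "Lspace s f"
  shows "L1 f"
proof -
  have "Lp_fun 1 circ (\<lambda>\<theta>. f (cis \<theta>))"
    using Lspace_mono[OF _ assms] by (simp add: Lspace_iff_Lp_fun)
  then have "integrable circ (\<lambda>\<theta>. norm (f (cis \<theta>)))" "(\<lambda>\<theta>. f (cis \<theta>)) \<in> borel_measurable circ"
    by (simp_all add: Lp_fun_def)
  then show ?thesis unfolding L1_def by (rule integrable_norm_cancel)
qed

lemma L1_mult_cis:
  assumes "L1 f"
  shows "integrable circ (\<lambda>\<theta>. f (cis \<theta>) * cis (- (c * \<theta>)))"
proof -
  have int: "integrable circ (\<lambda>\<theta>. f (cis \<theta>))" using assms by (simp add: L1_def)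
  then have [measurable]: "(\<lambda>\<theta>. f (cis \<theta>)) \<in> borel_measurable circ" by simp
  have "(\<lambda>\<theta>. f (cis \<theta>) * cis (- (c * \<theta>))) \<in> borel_measurable circ" by measurable
  with integrable_norm[OF int] show ?thesis
    by (rule integrable_pointwise_bound) (simp add: norm_mult)
qed

lemma fcoef_add: "\<lbrakk>L1 f; L1 g\<rbrakk> \<Longrightarrow> fcoef (\<lambda>z. f z + g z) n = fcoef f n + fcoef g n"
  using L1_mult_cis[of f "of_int n"] L1_mult_cis[of g "of_int n"]
  by (simp add: fcoef_eq_integral distrib_right add_divide_distrib)

lemma fcoef_scale: "fcoef (\<lambda>z. c * f z) n = c * fcoef f n"
  by (simp add: fcoef_eq_integral mult.assoc)

lemma L1_scale: "L1 f \<Longrightarrow> L1 (\<lambda>z. c * f z)"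
  by (simp add: L1_def)

lemma L1_sum: "(\<And>i. i \<in> I \<Longrightarrow> L1 (f i)) \<Longrightarrow> L1 (\<lambda>z. \<Sum>i\<in>I. f i z)"
  unfolding L1_def by (rule Bochner_Integration.integrable_sum) 

lemma fcoef_diff: "\<lbrakk>L1 f; L1 g\<rbrakk> \<Longrightarrow> fcoef (\<lambda>z. f z - g z) n = fcoef f n - fcoef g n"
  using fcoef_add[of f "\<lambda>z. - 1 * g z" n] fcoef_scale[of "- 1" g n] L1_scale[of g "- 1"] by simp

lemma fcoef_zero [simp]: "fcoef (\<lambda>_. 0) n = 0"
  by (simp add: fcoef_eq_integral)

lemma fcoef_sum:
  assumes "\<And>i. i \<in> I \<Longrightarrow> L1 (f i)"
  shows "fcoef (\<lambda>z. \<Sum>i\<in>I. f i z) n = (\<Sum>i\<in>I. fcoef (f i) n)"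
  using assms
proof (induction I rule: infinite_finite_induct)
  case (insert i I)
  then show ?case using fcoef_add[of "f i" "\<lambda>z. \<Sum>i\<in>I. f i z" n] L1_sum[of I f] by simp
qed simp_all

lemma fcoef_cong_circle: "(\<And>z. norm z = 1 \<Longrightarrow> f z = g z) \<Longrightarrow> fcoef f n = fcoef g n"
  by (simp add: fcoef_eq_integral)

lemma cis_measurable_circ' [measurable]: "cis \<in> borel_measurable circ"
  using cis_measurable_circ[of 1] by simp

lemma L1_bounded:
  assumes "(\<lambda>\<theta>. f (cis \<theta>)) \<in> borel_measurable circ" "\<And>z. norm z = 1 \<Longrightarrow> norm (f z) \<le> B"
  shows "L1 f"
  unfolding L1_def using assms by (intro circ.integrable_const_bound[where B = B]) auto

lemma Lspace_bounded:
  assumes "(\<lambda>\<theta>. f (cis \<theta>)) \<in> borel_measurable circ" "AE \<theta> in circ. norm (f (cis \<theta>)) \<le> B" "0 < s"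
  shows "Lspace s f"
proof -
  have [measurable]: "(\<lambda>\<theta>. f (cis \<theta>)) \<in> borel_measurable circ" by fact
  have "AE \<theta> in circ. norm (norm (f (cis \<theta>)) powr s) \<le> max B 0 powr s"
    using assms(2) by (rule eventually_mono) (use assms(3) in \<open>auto intro!: powr_mono2\<close>)
  then have "integrable circ (\<lambda>\<theta>. norm (f (cis \<theta>)) powr s)"
    by (intro circ.integrable_const_bound[where B = "max B 0 powr s"]) measurable
  then show ?thesis by (simp add: Lspace_iff_Lp_fun Lp_fun_def)
qed

lemma powi_measurable_circ [measurable]: "(\<lambda>\<theta>. cis \<theta> powi k) \<in> borel_measurable circ"
  by (simp add: cis_power_int)

lemma norm_powi_circle: "norm z = 1 \<Longrightarrow> norm (z powi k) = (1::real)" for z :: complex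
  by (simp add: norm_power_int)

lemma L1_powi: "L1 (\<lambda>z. z powi k)"
  by (rule L1_bounded[of _ 1]) (simp_all add: norm_powi_circle)

lemma Lspace_powi: "0 < s \<Longrightarrow> Lspace s (\<lambda>z. z powi k)"
  by (rule Lspace_bounded[of _ 1]) (simp_all add: norm_powi_circle)

lemma integral_cis_circ: "(\<integral>\<theta>. cis (of_int m * \<theta>) \<partial>circ) = (if m = 0 then of_real (2 * pi) else 0)"
proof (cases "m = 0")
  case True
  then show ?thesis using measure_circ by (simp add: scaleR_conv_of_real)
next
  case False
  have int: "integrable circ (\<lambda>\<theta>. cis (of_int m * \<theta>))"
    by (rule circ.integrable_const_bound[where B = 1]) auto
  have "((\<lambda>\<theta>. cis (of_int m * \<theta>)) has_integral
      (cis (of_int m * (2 * pi)) / (\<i> * of_int m) - cis (of_int m * 0) / (\<i> * of_int m))) {0..2*pi}"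
  proof (rule fundamental_theorem_of_calculus)
    show "((\<lambda>\<theta>. cis (of_int m * \<theta>) / (\<i> * of_int m)) has_vector_derivative cis (of_int m * \<theta>)) (at \<theta> within {0..2*pi})" for \<theta>
      using False unfolding cis_conv_exp
      by (auto intro!: derivative_eq_intros has_vector_derivative_real_field simp: field_simps)
  qed simp
  moreover have "cis (of_int m * (2 * pi)) = 1"
    using cis_multiple_2pi[of "of_int m"] by (simp add: mult.commute)
  ultimately have "((\<lambda>\<theta>. cis (of_int m * \<theta>)) has_integral 0) {0..2*pi}" by simp
  then show ?thesis
    using False int by (simp add: lebesgue_integral_eq_integral integral_unique)
qed

lemma fcoef_powi: "fcoef (\<lambda>z. z powi k) n = (if k = n then 1 else 0)"
proof -
  have "fcoef (\<lambda>z. z powi k) n = (\<integral>\<theta>. cis (of_int (k - n) * \<theta>) \<partial>circ) / of_real (2 * pi)"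
    by (simp add: fcoef_eq_integral cis_power_int cis_mult algebra_simps)
  then show ?thesis by (simp only: integral_cis_circ) simp
qed

lemma Lnorm_nonneg: "0 \<le> Lnorm s f"
  by (simp add: Lnorm_def)

lemma Lnorm_powr:
  assumes "0 < s"
  shows "Lnorm s f powr s = (\<integral>\<theta>. norm (f (cis \<theta>)) powr s \<partial>circ) / (2 * pi)"
  using assms by (simp add: Lnorm_eq_Lp_norm powr_mult Lp_norm_nonneg Lp_norm_powr powr_powr)

lemma Lnorm_le_iff:
  assumes "0 < s" "0 \<le> C"
  shows "Lnorm s f \<le> C \<longleftrightarrow> (\<integral>\<theta>. norm (f (cis \<theta>)) powr s \<partial>circ) \<le> 2 * pi * C powr s"
proof -
  have "Lnorm s f \<le> C \<longleftrightarrow> Lnorm s f powr s \<le> C powr s"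
    using assms powr_mono2[of s "Lnorm s f" C] powr_less_mono2[of s C "Lnorm s f"] Lnorm_nonneg[of s f]
    by linarith
  then show ?thesis using assms by (simp add: Lnorm_powr field_simps)
qed

text \<open>Hoelder against a character, which has norm 1 for the normalized measure. It makes each
  coefficient continuous, so coefficients may be read off in the limit.\<close>

lemma fcoef_le_Lnorm:
  assumes "1 < s" "Lspace s f"
  shows "norm (fcoef f n) \<le> Lnorm s f"
proof -
  define t where "t = s / (s - 1)"
  have t: "1 < t" "1 / s + 1 / t = 1" using assms(1) by (auto simp: t_def field_simps)
  have f: "Lp_fun s circ (\<lambda>\<theta>. f (cis \<theta>))" using assms by (simp add: Lspace_iff_Lp_fun)
  have g: "Lp_fun t circ (\<lambda>\<theta>. cis (- (of_int n * \<theta>)))" by (simp add: Lp_fun_def)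
  have N: "Lp_norm t circ (\<lambda>\<theta>. cis (- (of_int n * \<theta>))) = (2 * pi) powr (1 / t)"
    using measure_circ by (simp add: Lp_norm_def)
  have "norm (fcoef f n) = norm (\<integral>\<theta>. f (cis \<theta>) * cis (- (of_int n * \<theta>)) \<partial>circ) / (2 * pi)"
    by (simp add: fcoef_eq_integral norm_divide)
  also have "\<dots> \<le> (Lp_norm s circ (\<lambda>\<theta>. f (cis \<theta>)) * (2 * pi) powr (1 / t)) / (2 * pi)"
    using Holder_inequality(2)[OF assms(1) t f g] unfolding N by (intro divide_right_mono) auto
  also have "\<dots> = Lnorm s f"
  proof -
    have "1 / t = 1 - 1 / s" using t by simp
    then have "(2 * pi) powr (1 / t) = 2 * pi / (2 * pi) powr (1 / s)"
      by (simp only: powr_diff) simp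
    then show ?thesis using assms(1) by (simp add: Lnorm_eq_Lp_norm powr_divide)
  qed
  finally show ?thesis .
qed

text \<open>The usual Fejer mean: \<open>n - \<bar>m\<bar>\<close> of the pairs have difference m if
  \<open>\<bar>m\<bar> \<le> n\<close>. The double sum is preferred because it exhibits the kernel
  as a squared modulus, hence as nonnegative.\<close>

definition fejer :: "nat \<Rightarrow> (complex \<Rightarrow> complex) \<Rightarrow> complex \<Rightarrow> complex" where
  "fejer n f z = (\<Sum>j<n. \<Sum>l<n. fcoef f (int j - int l) * z powi (int j - int l)) / of_nat n"

definition fejer_kernel :: "nat \<Rightarrow> real \<Rightarrow> real \<Rightarrow> real" where
  "fejer_kernel n \<theta> \<phi> = (norm (\<Sum>j<n. cis (real j * (\<theta> - \<phi>))))\<^sup>2 / real n"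

lemma fejer_kernel_nonneg: "0 \<le> fejer_kernel n \<theta> \<phi>"
  by (simp add: fejer_kernel_def)

lemma fejer_kernel_eq:
  "complex_of_real (fejer_kernel n \<theta> \<phi>) =
    (\<Sum>j<n. \<Sum>l<n. cis \<theta> powi (int j - int l) * cis (- (of_int (int j - int l) * \<phi>))) / of_nat n"
proof -
  have "complex_of_real ((norm (\<Sum>j<n. cis (real j * (\<theta> - \<phi>))))\<^sup>2) =
      (\<Sum>j<n. cis (real j * (\<theta> - \<phi>))) * (\<Sum>l<n. cis (- (real l * (\<theta> - \<phi>))))"
    by (simp only: complex_norm_square cnj_sum cis_cnj)
  also have "\<dots> = (\<Sum>j<n. \<Sum>l<n. cis \<theta> powi (int j - int l) * cis (- (of_int (int j - int l) * \<phi>)))"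
    unfolding sum_product
    by (intro sum.cong refl) (simp add: cis_power_int cis_mult algebra_simps)
  finally show ?thesis by (simp add: fejer_kernel_def)
qed

lemma fejer_eq_integral:
  assumes f: "L1 f"
  shows "integrable circ (\<lambda>\<phi>. f (cis \<phi>) * of_real (fejer_kernel n \<theta> \<phi>))"
    and "fejer n f (cis \<theta>) = (\<integral>\<phi>. f (cis \<phi>) * of_real (fejer_kernel n \<theta> \<phi>) \<partial>circ) / of_real (2 * pi)"
proof -
  let ?e = "\<lambda>j l \<phi>. f (cis \<phi>) * cis (- (of_int (int j - int l) * \<phi>))"
  have eq: "f (cis \<phi>) * of_real (fejer_kernel n \<theta> \<phi>) =
      (\<Sum>j<n. \<Sum>l<n. cis \<theta> powi (int j - int l) * ?e j l \<phi>) / of_nat n" for \<phi>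
    unfolding fejer_kernel_eq by (simp add: sum_distrib_left algebra_simps)
  have int: "integrable circ (\<lambda>\<phi>. cis \<theta> powi (int j - int l) * ?e j l \<phi>)" for j l
    by (intro integrable_mult_right L1_mult_cis f)
  then show "integrable circ (\<lambda>\<phi>. f (cis \<phi>) * of_real (fejer_kernel n \<theta> \<phi>))"
    unfolding eq by (intro integrable_divide Bochner_Integration.integrable_sum)
  have "(\<integral>\<phi>. f (cis \<phi>) * of_real (fejer_kernel n \<theta> \<phi>) \<partial>circ) =
      (\<Sum>j<n. \<Sum>l<n. cis \<theta> powi (int j - int l) * (\<integral>\<phi>. ?e j l \<phi> \<partial>circ)) / of_nat n"
    unfolding eq by (simp add: Bochner_Integration.integral_sum int L1_mult_cis[OF f] integral_mult_right)
  then show "fejer n f (cis \<theta>) = (\<integral>\<phi>. f (cis \<phi>) * of_real (fejer_kernel n \<theta> \<phi>) \<partial>circ) / of_real (2 * pi)"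
    by (simp add: fejer_def fcoef_eq_integral sum_divide_distrib mult.commute)
qed

lemma L1_fejer: "L1 (fejer n f)"
  unfolding fejer_def L1_def
  by (intro integrable_divide Bochner_Integration.integrable_sum integrable_mult_right)
    (use L1_powi in \<open>simp add: L1_def\<close>)

text \<open>For \<open>0 < n\<close> this is the maximum of 0 and
  \<open>1 - \<bar>m\<bar> / n\<close>, obtained by counting pairs with difference m.\<close>

definition fejer_weight :: "nat \<Rightarrow> int \<Rightarrow> real" where
  "fejer_weight n m = (\<Sum>j<n. \<Sum>l<n. of_bool (int j - int l = m)) / real n"

lemma fcoef_fejer: "fcoef (fejer n f) m = of_real (fejer_weight n m) * fcoef f m"
proof -
  have "fcoef (fejer n f) m =
      fcoef (\<lambda>z. (1 / of_nat n) * (\<Sum>j<n. \<Sum>l<n. fcoef f (int j - int l) * z powi (int j - int l))) m"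
    by (simp add: fejer_def[abs_def])
  also have "\<dots> = (1 / of_nat n) * (\<Sum>j<n. \<Sum>l<n. fcoef f (int j - int l) *
      fcoef (\<lambda>z. z powi (int j - int l)) m)"
    by (simp only: fcoef_scale fcoef_sum L1_sum L1_scale L1_powi)
  also have "\<dots> = (1 / of_nat n) * (\<Sum>j<n. \<Sum>l<n. of_bool (int j - int l = m) * fcoef f m)"
  proof -
    have "fcoef f (int j - int l) * fcoef (\<lambda>z. z powi (int j - int l)) m =
        of_bool (int j - int l = m) * fcoef f m" for j l
      by (simp add: fcoef_powi)
    then show ?thesis by (simp only:)
  qed
  finally show ?thesis
    by (simp add: fejer_weight_def sum_distrib_right sum_divide_distrib)
qed

lemma fejer_weight_0: "0 < n \<Longrightarrow> fejer_weight n 0 = 1"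
  by (simp add: fejer_weight_def)

lemma fejer_weight_bounds:
  assumes "0 < n"
  shows "1 - real_of_int \<bar>m\<bar> / real n \<le> fejer_weight n m" and "fejer_weight n m \<le> 1"
proof -
  have inner: "(\<Sum>l<n. of_bool (int j - int l = m)) = (of_bool (0 \<le> int j - m \<and> int j - m < int n) :: real)" for j
  proof (cases "0 \<le> int j - m \<and> int j - m < int n")
    case True
    then have "(\<Sum>l<n. of_bool (int j - int l = m)) = (\<Sum>l<n. if l = nat (int j - m) then 1 else (0::real))"
      by (intro sum.cong) auto
    then show ?thesis using True by (simp add: sum.delta nat_less_iff)
  next
    case False
    then show ?thesis by (auto intro!: sum.neutral)
  qed
  let ?A = "{j. j < n \<and> 0 \<le> int j - m \<and> int j - m < int n}"
  have eq: "(\<Sum>j<n. \<Sum>l<n. of_bool (int j - int l = m)) = real (card ?A)"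
    unfolding inner by (simp add: Int_def lessThan_def)
  have "card ?A \<le> card {..<n}" by (intro card_mono) auto
  then show "fejer_weight n m \<le> 1" using assms unfolding fejer_weight_def eq by simp
  have "n - nat \<bar>m\<bar> \<le> card ?A"
  proof (cases "0 \<le> m")
    case True
    then have "card {nat m..<n} \<le> card ?A" by (intro card_mono) auto
    then show ?thesis using True by simp
  next
    case False
    then have "card {..<n - nat (- m)} \<le> card ?A" by (intro card_mono) auto
    then show ?thesis using False by simp
  qed
  then have "real n - real_of_int \<bar>m\<bar> \<le> real (card ?A)" by linarith
  then show "1 - real_of_int \<bar>m\<bar> / real n \<le> fejer_weight n m"
    using assms divide_right_mono[of "real n - real_of_int \<bar>m\<bar>" "real (card ?A)" "real n"]
    unfolding fejer_weight_def eq by (simp add: diff_divide_distrib)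
qed

lemma fejer_weight_tendsto: "(\<lambda>n. fejer_weight n m) \<longlonglongrightarrow> 1"
proof (rule tendsto_sandwich)
  show "\<forall>\<^sub>F n in sequentially. 1 - real_of_int \<bar>m\<bar> / real n \<le> fejer_weight n m"
    "\<forall>\<^sub>F n in sequentially. fejer_weight n m \<le> 1"
    by (rule eventually_mono[OF eventually_gt_at_top[of 0]], rule fejer_weight_bounds, simp)+
  have "(\<lambda>n. 1 - real_of_int \<bar>m\<bar> / real n) \<longlonglongrightarrow> 1 - 0"
    by (intro tendsto_diff tendsto_const lim_const_over_n)
  then show "(\<lambda>n. 1 - real_of_int \<bar>m\<bar> / real n) \<longlonglongrightarrow> 1" by simp
qed simp

text \<open>Jensen's inequality against the kernel, followed by integration in the other variable;
  the latter only uses that the mean of a Fejer mean is the mean of the function, so no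
  product measure is involved.\<close>

lemma Lnorm_fejer_le:
  assumes s: "1 < s" and f: "Lspace s f" and n: "0 < n"
  shows "Lnorm s (fejer n f) \<le> Lnorm s f"
proof -
  define G where "G z = complex_of_real (norm (f z) powr s)" for z
  have fL: "Lp_fun s circ (\<lambda>\<theta>. f (cis \<theta>))" using f by (simp add: Lspace_iff_Lp_fun)
  have G: "L1 G" unfolding L1_def G_def using Lp_fun_integrable[OF fL] by simp
  have f1: "L1 f" using Lspace_imp_L1[OF _ f] s by simp
  have af: "L1 (\<lambda>z. of_real (norm (f z)))" using f1 by (simp add: L1_def integrable_norm)
  have one: "L1 (\<lambda>z. 1)" by (simp add: L1_def)
  define t where "t = s / (s - 1)"
  have t: "1 < t" "1 / s + 1 / t = 1" using s by (auto simp: t_def field_simps)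
  have mean1: "fejer n (\<lambda>z. 1) (cis \<theta>) = 1" for \<theta>
  proof -
    have "fcoef (\<lambda>z. 1) k = (if k = 0 then 1 else 0)" for k
      using fcoef_powi[of 0 k] by simp
    then have "fejer n (\<lambda>z. 1) (cis \<theta>) =
        (\<Sum>j<n. \<Sum>l<n. if l = j then 1 else 0) / of_nat n"
      unfolding fejer_def by (intro arg_cong2[where f = "(/)"] refl sum.cong) auto
    then show ?thesis using n by simp
  qed
  have point: "norm (fejer n f (cis \<theta>)) powr s \<le> Re (fejer n G (cis \<theta>))" for \<theta>
  proof -
    let ?k = "fejer_kernel n \<theta>"
    have k0: "0 \<le> ?k \<phi>" for \<phi> by (rule fejer_kernel_nonneg)
    have ik: "integrable circ ?k"
      using fejer_eq_integral(1)[OF one, of n \<theta>] by (simp add: complex_of_real_integrable_eq)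
    have iaf: "integrable circ (\<lambda>\<phi>. norm (f (cis \<phi>)) * ?k \<phi>)"
      using fejer_eq_integral(1)[OF af, of n \<theta>] by (simp add: complex_of_real_integrable_eq flip: of_real_mult)
    have iG: "integrable circ (\<lambda>\<phi>. norm (f (cis \<phi>)) powr s * ?k \<phi>)"
      using fejer_eq_integral(1)[OF G, of n \<theta>] by (simp add: G_def complex_of_real_integrable_eq flip: of_real_mult)
    define m where "m = (\<integral>\<phi>. norm (f (cis \<phi>)) * ?k \<phi> \<partial>circ) / (2 * pi)"
    define I where "I = (\<integral>\<phi>. norm (f (cis \<phi>)) powr s * ?k \<phi> \<partial>circ) / (2 * pi)"
    have k1: "(\<integral>\<phi>. ?k \<phi> \<partial>circ) = 2 * pi"
    proof -
      have "complex_of_real (\<integral>\<phi>. ?k \<phi> \<partial>circ) = of_real (2 * pi)"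
        using fejer_eq_integral(2)[OF one, of n \<theta>] mean1[of \<theta>] by (simp flip: integral_complex_of_real)
      then show ?thesis by (simp only: of_real_eq_iff)
    qed
    have m0: "0 \<le> m" unfolding m_def by (intro divide_nonneg_pos integral_nonneg_AE) (simp_all add: k0)
    have fm: "norm (fejer n f (cis \<theta>)) \<le> m"
    proof -
      have "norm (fejer n f (cis \<theta>)) = norm (\<integral>\<phi>. f (cis \<phi>) * of_real (?k \<phi>) \<partial>circ) / (2 * pi)"
        by (simp add: fejer_eq_integral(2)[OF f1] norm_divide)
      also have "\<dots> \<le> (\<integral>\<phi>. norm (f (cis \<phi>) * of_real (?k \<phi>)) \<partial>circ) / (2 * pi)"
        by (intro divide_right_mono integral_norm_bound) simp
      also have "\<dots> = m" by (simp add: m_def norm_mult k0)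
      finally show ?thesis .
    qed
    have IG: "Re (fejer n G (cis \<theta>)) = I"
    proof -
      have "fejer n G (cis \<theta>) = complex_of_real I"
        by (simp add: fejer_eq_integral(2)[OF G] I_def G_def flip: integral_complex_of_real of_real_mult)
      then show ?thesis by simp
    qed
    \<comment> \<open>Jensen's inequality out of Young's:
      \<open>norm (f (cis \<phi>)) * m powr (s - 1)\<close> is estimated by Young and integrated
      against the kernel, which has mean 1. The factor \<open>m powr (s - 1)\<close> is the one for
      which Young is an equality when the modulus is m.\<close>
    have "m powr s \<le> I"
    proof (cases "m = 0")
      case True
      then show ?thesis using s unfolding I_def by (auto intro!: divide_nonneg_pos integral_nonneg_AE simp: k0)
    next
      case False
      then have mp: "0 < m" using m0 by simp
      have young: "norm (f (cis \<phi>)) * ?k \<phi> * m powr (s - 1) \<le>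
          norm (f (cis \<phi>)) powr s * ?k \<phi> / s + m powr s / t * ?k \<phi>" for \<phi>
      proof -
        have "norm (f (cis \<phi>)) * m powr (s - 1) \<le> norm (f (cis \<phi>)) powr s / s + (m powr (s - 1)) powr t / t"
          by (rule Youngs_inequality[OF s t]) auto
        also have "(m powr (s - 1)) powr t = m powr s"
          using s by (simp add: powr_powr t_def)
        finally show ?thesis
          using mult_right_mono[OF _ k0[of \<phi>]] by (fastforce simp: algebra_simps)
      qed
      have "m * m powr (s - 1) * (2 * pi) = (\<integral>\<phi>. norm (f (cis \<phi>)) * ?k \<phi> * m powr (s - 1) \<partial>circ)"
        using iaf by (simp add: m_def)
      also have "\<dots> \<le> (\<integral>\<phi>. norm (f (cis \<phi>)) powr s * ?k \<phi> / s + m powr s / t * ?k \<phi> \<partial>circ)"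
        by (intro integral_mono integrable_mult_left Bochner_Integration.integrable_add
            integrable_divide integrable_mult_right iaf iG ik young)
      also have "\<dots> = (I / s + m powr s / t) * (2 * pi)"
        using iG ik by (simp add: I_def k1 distrib_right)
      finally have "m * m powr (s - 1) \<le> I / s + m powr s / t" by simp
      moreover have "m * m powr (s - 1) = m powr s" using mp by (simp add: powr_mult_base)
      moreover have "m powr s / t = m powr s - m powr s / s"
      proof -
        have "1 / t = 1 - 1 / s" using t(2) by simp
        then have "m powr s * (1 / t) = m powr s * (1 - 1 / s)" by simp
        then show ?thesis by (simp add: right_diff_distrib)
      qed
      ultimately have "m powr s / s \<le> I / s" by linarith
      then show ?thesis using s by (simp add: divide_le_cancel)
    qed
    then have "norm (fejer n f (cis \<theta>)) powr s \<le> I"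
      using powr_mono2[OF _ _ fm, of s] s by simp
    then show ?thesis by (simp add: IG)
  qed
  have iFG: "integrable circ (\<lambda>\<theta>. fejer n G (cis \<theta>))" using L1_fejer by (simp add: L1_def)
  have [measurable]: "(\<lambda>\<theta>. fejer n f (cis \<theta>)) \<in> borel_measurable circ"
    using L1_fejer[of n f] by (simp add: L1_def borel_measurable_integrable)
  have "integrable circ (\<lambda>\<theta>. norm (fejer n f (cis \<theta>)) powr s)"
    by (rule integrable_pointwise_bound[OF integrable_Re[OF iFG]]) (use point in auto)
  then have "(\<integral>\<theta>. norm (fejer n f (cis \<theta>)) powr s \<partial>circ) \<le> (\<integral>\<theta>. Re (fejer n G (cis \<theta>)) \<partial>circ)"
    by (intro integral_mono integrable_Re iFG point)
  also have "\<dots> = Re (\<integral>\<theta>. fejer n G (cis \<theta>) \<partial>circ)" using iFG by simp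
  also have "(\<integral>\<theta>. fejer n G (cis \<theta>) \<partial>circ) = of_real (2 * pi) * fcoef (fejer n G) 0"
    by (simp add: fcoef_eq_integral)
  also have "\<dots> = (\<integral>\<theta>. G (cis \<theta>) \<partial>circ)"
    unfolding fcoef_fejer using n by (simp add: fejer_weight_0 fcoef_eq_integral)
  also have "Re \<dots> = (\<integral>\<theta>. norm (f (cis \<theta>)) powr s \<partial>circ)"
    by (simp add: G_def)
  also have "\<dots> = 2 * pi * Lnorm s f powr s" using s by (simp add: Lnorm_powr)
  finally show ?thesis using s by (subst Lnorm_le_iff) (auto simp: Lnorm_nonneg)
qed

lemma Lp_dominated_convergence:
  assumes s: "0 < s" and w: "Lp_fun s M w" and u: "\<And>n. u n \<in> borel_measurable M"
    and lim: "AE x in M. (\<lambda>n. u n x) \<longlonglongrightarrow> 0" and le: "\<And>n. AE x in M. norm (u n x) \<le> norm (w x)"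
  shows "(\<lambda>n. Lp_norm s M (u n)) \<longlonglongrightarrow> 0"
proof -
  have [measurable]: "\<And>n. u n \<in> borel_measurable M" "w \<in> borel_measurable M"
    using u w by (simp_all add: Lp_fun_measurable)
  have "(\<lambda>n. \<integral>x. norm (u n x) powr s \<partial>M) \<longlonglongrightarrow> (\<integral>x. 0 \<partial>M)"
  proof (rule integral_dominated_convergence[where w = "\<lambda>x. norm (w x) powr s"])
    show "integrable M (\<lambda>x. norm (w x) powr s)" using w by (rule Lp_fun_integrable)
    show "AE x in M. (\<lambda>n. norm (u n x) powr s) \<longlonglongrightarrow> 0"
      using lim by (rule eventually_mono) (use s in \<open>auto intro!: tendsto_zero_powrI tendsto_const tendsto_norm_zero\<close>)
    show "AE x in M. norm (norm (u n x) powr s) \<le> norm (w x) powr s" for n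
      using AE_norm_powr_mono[OF s le] by simp
  qed measurable
  then show ?thesis
    unfolding Lp_norm_def using s
    by (intro tendsto_zero_powrI[where b = "1 / s"]) (auto intro!: integral_nonneg_AE)
qed

lemma Lspace_seminormed_complete:
  assumes s: "1 \<le> s"
  shows "seminormed_complete {f. Lspace s f} (Lnorm s)"
proof
  let ?k = "(1 / (2 * pi)) powr (1 / s)"
  have k: "0 < ?k" by simp
  have N: "Lnorm s f = ?k * Lp_norm s circ (\<lambda>\<theta>. f (cis \<theta>))" for f
    using s by (intro Lnorm_eq_Lp_norm) simp
  show "(\<lambda>_. 0) \<in> {f. Lspace s f}" by (simp add: Lspace_iff_Lp_fun Lp_fun_zero)
  show "(\<lambda>t. x t + y t) \<in> {f. Lspace s f}" if "x \<in> {f. Lspace s f}" "y \<in> {f. Lspace s f}" for x y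
    using that Lp_fun_add[OF s] by (simp add: Lspace_iff_Lp_fun)
  show "(\<lambda>t. c * x t) \<in> {f. Lspace s f}" if "x \<in> {f. Lspace s f}" for x c
    using that Lp_fun_scale by (simp add: Lspace_iff_Lp_fun)
  show "Lnorm s (\<lambda>t. x t + y t) \<le> Lnorm s x + Lnorm s y"
    if "x \<in> {f. Lspace s f}" "y \<in> {f. Lspace s f}" for x y
    using that Lp_norm_triangle[OF s, of circ "\<lambda>\<theta>. x (cis \<theta>)" "\<lambda>\<theta>. y (cis \<theta>)"] k
    unfolding N distrib_left[symmetric] by (intro mult_left_mono) (auto simp: Lspace_iff_Lp_fun)
  show "Lnorm s (\<lambda>t. c * x t) = norm c * Lnorm s x" for x c
    using s Lp_norm_scale[of s circ c "\<lambda>\<theta>. x (cis \<theta>)"] by (simp add: N)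
  fix u :: "nat \<Rightarrow> complex \<Rightarrow> complex"
  assume u: "\<And>i. u i \<in> {f. Lspace s f}" and sum: "summable (\<lambda>i. Lnorm s (u i))"
  have uL: "Lp_fun s circ (\<lambda>\<theta>. u i (cis \<theta>))" for i using u by (simp add: Lspace_iff_Lp_fun)
  have "summable (\<lambda>i. Lp_norm s circ (\<lambda>\<theta>. u i (cis \<theta>)))"
    using summable_mult[OF sum, of "1 / ?k"] k unfolding N by simp
  note * = Lp_complete[OF s uL this]
  let ?f = "\<lambda>z. \<Sum>i. u i z"
  have "(\<lambda>n. ?k * Lp_norm s circ (\<lambda>\<theta>. ?f (cis \<theta>) - (\<Sum>i<n. u i (cis \<theta>)))) \<longlonglongrightarrow> ?k * 0"
    by (intro tendsto_mult tendsto_const *(2))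
  then have "(\<lambda>n. Lnorm s (\<lambda>z. ?f z - (\<Sum>i<n. u i z))) \<longlonglongrightarrow> 0" unfolding N by simp
  moreover have "?f \<in> {f. Lspace s f}" using *(1) by (simp add: Lspace_iff_Lp_fun)
  ultimately show "\<exists>y\<in>{f. Lspace s f}. (\<lambda>n. Lnorm s (\<lambda>z. y z - (\<Sum>i<n. u i z))) \<longlonglongrightarrow> 0" by (rule bexI)
qed

lemma Lnorm_cong_circle: "(\<And>z. norm z = 1 \<Longrightarrow> f z = g z) \<Longrightarrow> Lnorm s f = Lnorm s g"
  by (simp add: Lnorm_def)

lemma Lnorm_bounded:
  assumes "0 < s" "0 \<le> B" "(\<lambda>\<theta>. f (cis \<theta>)) \<in> borel_measurable circ" "\<And>z. norm z = 1 \<Longrightarrow> norm (f z) \<le> B"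
  shows "Lnorm s f \<le> B"
proof -
  have "Lspace s f" using assms by (intro Lspace_bounded[of f B]) auto
  then have "integrable circ (\<lambda>\<theta>. norm (f (cis \<theta>)) powr s)"
    by (simp add: Lspace_iff_Lp_fun Lp_fun_def)
  then have "(\<integral>\<theta>. norm (f (cis \<theta>)) powr s \<partial>circ) \<le> (\<integral>\<theta>. B powr s \<partial>circ)"
    using assms by (intro integral_mono) (auto intro!: powr_mono2)
  also have "\<dots> = 2 * pi * B powr s" using measure_circ by simp
  finally show ?thesis using assms by (subst Lnorm_le_iff)
qed

lemma Lnorm_eq_0_iff:
  assumes "0 < s" "Lspace s f"
  shows "Lnorm s f = 0 \<longleftrightarrow> f \<in> null_T"
  using assms Lp_norm_eq_0[of s circ "\<lambda>\<theta>. f (cis \<theta>)"]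
  by (simp add: Lnorm_eq_Lp_norm null_T_iff Lspace_iff_Lp_fun)

section \<open>Density of trigonometric polynomials and convergence of Fejer means\<close>

inductive trig_poly :: "(complex \<Rightarrow> complex) \<Rightarrow> bool" where
  monom: "(\<And>z. norm z = 1 \<Longrightarrow> f z = c * z powi k) \<Longrightarrow> trig_poly f"
| add: "\<lbrakk>trig_poly f; trig_poly g; \<And>z. norm z = 1 \<Longrightarrow> h z = f z + g z\<rbrakk> \<Longrightarrow> trig_poly h"

lemma trig_poly_const: "trig_poly (\<lambda>z. c)"
  by (rule monom[of _ c 0]) simp

lemma trig_poly_mult_monom:
  assumes "trig_poly f"
  shows "(\<And>z. norm z = 1 \<Longrightarrow> h z = c * z powi k * f z) \<Longrightarrow> trig_poly h"
  using assms
proof (induction arbitrary: h)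
  case (monom f d l)
  have "h z = c * d * z powi (k + l)" if "norm z = 1" for z
  proof -
    have "z \<noteq> 0" using that by auto
    then show ?thesis using monom that by (simp add: power_int_add)
  qed
  then show ?case by (rule trig_poly.monom)
next
  case (add f g f')
  have "trig_poly (\<lambda>z. c * z powi k * f z)" "trig_poly (\<lambda>z. c * z powi k * g z)"
    using add.IH by simp_all
  then show ?case
    by (rule trig_poly.add) (simp add: add.hyps add.prems distrib_left)
qed

lemma trig_poly_mult:
  assumes "trig_poly f" "trig_poly g"
  shows "(\<And>z. norm z = 1 \<Longrightarrow> h z = f z * g z) \<Longrightarrow> trig_poly h"
  using assms(1)
proof (induction arbitrary: h)
  case (monom f c k)
  then show ?case by (intro trig_poly_mult_monom[OF assms(2), of h c k]) simp
next
  case (add f1 f2 f)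
  have "trig_poly (\<lambda>z. f1 z * g z)" "trig_poly (\<lambda>z. f2 z * g z)" using add.IH by simp_all
  then show ?case
    by (rule trig_poly.add) (simp add: add.hyps add.prems distrib_right)
qed

text \<open>On the circle \<open>inverse z = cnj z\<close>, so \<open>Re z\<close> is half of
  \<open>z + inverse z\<close>. Such identities are the reason why \<open>trig_poly\<close> demands
  equality on the circle only.\<close>

lemma trig_poly_Re: "trig_poly (\<lambda>z. of_real (Re z))"
proof (rule trig_poly.add)
  show "trig_poly (\<lambda>z. 1/2 * z powi 1)" "trig_poly (\<lambda>z. 1/2 * z powi (-1))"
    by (rule monom, rule refl)+
  fix z :: complex assume "norm z = 1"
  then have "inverse z = cnj z"
    using complex_norm_square[of z] by (intro inverse_unique) simp
  then show "complex_of_real (Re z) = 1/2 * z powi 1 + 1/2 * z powi (-1)"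
    using complex_add_cnj[of z] by (simp add: power_int_minus flip: add_divide_distrib)
qed

lemma trig_poly_Im: "trig_poly (\<lambda>z. of_real (Im z))"
proof (rule trig_poly.add)
  show "trig_poly (\<lambda>z. (- \<i> / 2) * z powi 1)" "trig_poly (\<lambda>z. (\<i> / 2) * z powi (-1))"
    by (rule monom, rule refl)+
  fix z :: complex assume "norm z = 1"
  then have "inverse z = cnj z"
    using complex_norm_square[of z] by (intro inverse_unique) simp
  then show "complex_of_real (Im z) = (- \<i> / 2) * z powi 1 + (\<i> / 2) * z powi (-1)"
    by (simp add: power_int_minus complex_eq_iff)
qed

lemma trig_poly_real_polynomial:
  fixes p :: "complex \<Rightarrow> real"
  assumes "real_polynomial_function p"
  shows "trig_poly (\<lambda>z. of_real (p z))"
  using assms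
proof (induction p)
  case (linear f)
  interpret f: bounded_linear f by fact
  have f: "f z = Re z * f 1 + Im z * f \<i>" for z
  proof -
    have "f z = f (Re z *\<^sub>R 1 + Im z *\<^sub>R \<i>)"
      by (intro arg_cong[where f = f]) (simp add: complex_eq_iff)
    then show ?thesis by (simp add: f.add f.scaleR)
  qed
  have "trig_poly (\<lambda>z. of_real (Re z) * of_real (f 1))" "trig_poly (\<lambda>z. of_real (Im z) * of_real (f \<i>))"
    by (rule trig_poly_mult[OF trig_poly_Re trig_poly_const] trig_poly_mult[OF trig_poly_Im trig_poly_const],
        rule refl)+
  then show ?case by (rule trig_poly.add) (subst f, simp)
next
  case (const c)
  then show ?case by (rule trig_poly_const)
next
  case (add f g)
  then show ?case by (intro trig_poly.add[OF add.IH]) simp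
next
  case (mult f g)
  then show ?case by (intro trig_poly_mult[OF mult.IH]) simp
qed

text \<open>Stone-Weierstrass delivers polynomial functions of the real plane; on the circle they
  are generated by \<open>Re z\<close> and \<open>Im z\<close>, thus trigonometric.\<close>

lemma trig_poly_polynomial_function:
  fixes p :: "complex \<Rightarrow> complex"
  assumes "polynomial_function p"
  shows "trig_poly p"
proof -
  have re: "trig_poly (\<lambda>z. of_real (Re (p z)))"
    using assms bounded_linear_Re trig_poly_real_polynomial unfolding polynomial_function_def o_def by blast
  have im: "trig_poly (\<lambda>z. of_real (Im (p z)))"
    using assms bounded_linear_Im trig_poly_real_polynomial unfolding polynomial_function_def o_def by blast
  have "trig_poly (\<lambda>z. \<i> * of_real (Im (p z)))"
    by (rule trig_poly_mult[OF trig_poly_const im]) (rule refl)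
  from re this show ?thesis
    by (rule trig_poly.add) (rule complex_eq)
qed

lemma Lspace_trig_poly:
  assumes "1 \<le> s" "trig_poly f"
  shows "Lspace s f"
  using assms(2)
proof induction
  case (monom f c k)
  then have "Lp_fun s circ (\<lambda>\<theta>. f (cis \<theta>)) = Lp_fun s circ (\<lambda>\<theta>. c * cis \<theta> powi k)" by simp
  then show ?case
    using Lspace_powi[of s k] assms(1) Lp_fun_scale by (simp add: Lspace_iff_Lp_fun)
next
  case (add f g h)
  then have "Lp_fun s circ (\<lambda>\<theta>. h (cis \<theta>)) = Lp_fun s circ (\<lambda>\<theta>. f (cis \<theta>) + g (cis \<theta>))" by simp
  then show ?case
    using add.IH Lp_fun_add[OF assms(1)] by (simp add: Lspace_iff_Lp_fun)
qed

text \<open>A function on the line carried to the circle by \<open>Arg2pi\<close> may jump at 1. The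
  bounded function is multiplied by a factor vanishing there, which removes the jump; as c grows,
  the factor tends to 1 at every other point.\<close>

lemma continuous_on_circle_cutoff:
  fixes g :: "real \<Rightarrow> complex"
  assumes g: "continuous_on UNIV g" and N: "\<And>t. norm (g t) \<le> N" and c: "0 \<le> c"
  shows "continuous_on (sphere 0 1) (\<lambda>z. of_real (min 1 (c * norm (z - 1))) * g (Arg2pi z))"
  unfolding continuous_on_eq_continuous_within
proof
  fix z :: complex assume z: "z \<in> sphere 0 1"
  show "continuous (at z within sphere 0 1) (\<lambda>z. of_real (min 1 (c * norm (z - 1))) * g (Arg2pi z))"
  proof (cases "z = 1")
    case True
    have "((\<lambda>z. of_real (min 1 (c * norm (z - 1))) * g (Arg2pi z)) \<longlongrightarrow> 0) (at 1 within sphere 0 1)"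
    proof (rule Lim_null_comparison)
      have "norm (of_real (min 1 (c * norm (z - 1))) * g (Arg2pi z)) \<le> c * norm (z - 1) * N" for z
      proof -
        have "norm (of_real (min 1 (c * norm (z - 1))) * g (Arg2pi z)) =
            min 1 (c * norm (z - 1)) * norm (g (Arg2pi z))"
          using c by (simp add: norm_mult)
        also have "\<dots> \<le> (c * norm (z - 1)) * N"
          using c N by (intro mult_mono) auto
        finally show ?thesis .
      qed
      then show "\<forall>\<^sub>F z in at 1 within sphere 0 1.
          norm (of_real (min 1 (c * norm (z - 1))) * g (Arg2pi z)) \<le> c * norm (z - 1) * N"
        by simp
      have "((\<lambda>z::complex. c * norm (z - 1) * N) \<longlongrightarrow> c * norm (1 - 1 :: complex) * N) (at 1 within sphere 0 1)"
        by (intro tendsto_intros)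
      then show "((\<lambda>z::complex. c * norm (z - 1) * N) \<longlongrightarrow> 0) (at 1 within sphere 0 1)" by simp
    qed
    then show ?thesis using True by (simp add: continuous_within)
  next
    case False
    have "z \<notin> \<real>\<^sub>\<ge>\<^sub>0"
    proof
      assume "z \<in> \<real>\<^sub>\<ge>\<^sub>0"
      then obtain r where "z = of_real r" "0 \<le> r" by (rule nonneg_Reals_cases)
      then show False using z False by simp
    qed
    then have "continuous (at z within sphere 0 1) Arg2pi"
      using continuous_at_Arg2pi continuous_at_imp_continuous_at_within by blast
    moreover have "continuous (at (Arg2pi z) within Arg2pi ` sphere 0 1) g"
      using g by (simp add: continuous_on_eq_continuous_at continuous_at_imp_continuous_at_within)
    ultimately have "continuous (at z within sphere 0 1) (\<lambda>z. g (Arg2pi z))"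
      using continuous_within_compose[of z "sphere 0 1" Arg2pi g] by (simp add: o_def)
    then show ?thesis by (intro continuous_intros)
  qed
qed

lemma Arg2pi_cis_eq: "\<lbrakk>0 \<le> \<theta>; \<theta> < 2 * pi\<rbrakk> \<Longrightarrow> Arg2pi (cis \<theta>) = \<theta>"
  by (rule Arg2pi_unique[of 1]) (simp_all add: cis_conv_exp)

lemma AE_circ_interior: "AE \<theta> in circ. 0 < \<theta> \<and> \<theta> < 2 * pi"
proof -
  have "AE \<theta> in lebesgue. \<theta> \<notin> {0, 2 * pi}"
    by (rule AE_not_in) (simp add: negligible_iff_null_sets[symmetric] negligible_finite)
  then have "AE \<theta> in lebesgue. \<theta> \<in> {0..2*pi} \<longrightarrow> 0 < \<theta> \<and> \<theta> < 2 * pi"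
    by (rule eventually_mono) auto
  then show ?thesis by (rule AE_restrict_space_iff[THEN iffD2, rotated]) simp
qed

text \<open>Three approximations, each within a third of \<epsilon>: f by a bounded function, that
  function by a continuous function on the circle, and the latter by a polynomial uniformly. The
  first two converge by dominated convergence.\<close>

lemma trig_poly_dense:
  assumes s: "1 \<le> s" and f: "Lspace s f" and e: "0 < \<epsilon>"
  shows "\<exists>P. trig_poly P \<and> Lnorm s (\<lambda>z. f z - P z) < \<epsilon>"
proof -
  interpret L: seminormed_complete "{f. Lspace s f}" "Lnorm s"
    by (rule Lspace_seminormed_complete[OF s])
  have s0: "0 < s" using s by simp
  let ?k = "(1 / (2 * pi)) powr (1 / s)"
  have N: "Lnorm s f = ?k * Lp_norm s circ (\<lambda>\<theta>. f (cis \<theta>))" for f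
    by (rule Lnorm_eq_Lp_norm[OF s0])
  have lim_small: "\<exists>n. Lnorm s (u n) < \<delta>"
    if "(\<lambda>n. Lp_norm s circ (\<lambda>\<theta>. u n (cis \<theta>))) \<longlonglongrightarrow> 0" "0 < \<delta>" for u :: "nat \<Rightarrow> complex \<Rightarrow> complex" and \<delta>
  proof -
    have "(\<lambda>n. Lnorm s (u n)) \<longlonglongrightarrow> ?k * 0"
      unfolding N by (intro tendsto_mult tendsto_const that)
    then have "(\<lambda>n. Lnorm s (u n)) \<longlonglongrightarrow> 0" by simp
    from order_tendstoD(2)[OF this that(2)] show ?thesis
      by (auto dest: eventually_happens)
  qed
  have fL: "Lp_fun s circ (\<lambda>\<theta>. f (cis \<theta>))" using f by (simp add: Lspace_iff_Lp_fun)
  have [measurable]: "(\<lambda>\<theta>. f (cis \<theta>)) \<in> borel_measurable circ" using fL by (rule Lp_fun_measurable)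
  define F where "F n z = (if norm (f z) \<le> real n then f z else 0)" for n z
  have Fm[measurable]: "(\<lambda>\<theta>. F n (cis \<theta>)) \<in> borel_measurable circ" for n
    unfolding F_def by measurable
  have "(\<lambda>n. Lp_norm s circ (\<lambda>\<theta>. f (cis \<theta>) - F n (cis \<theta>))) \<longlonglongrightarrow> 0"
  proof (rule Lp_dominated_convergence[OF s0 fL])
    show "(\<lambda>\<theta>. f (cis \<theta>) - F n (cis \<theta>)) \<in> borel_measurable circ" for n by measurable
    show "AE \<theta> in circ. norm (f (cis \<theta>) - F n (cis \<theta>)) \<le> norm (f (cis \<theta>))" for n
      by (rule AE_I2) (simp add: F_def)
    show "AE \<theta> in circ. (\<lambda>n. f (cis \<theta>) - F n (cis \<theta>)) \<longlonglongrightarrow> 0"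
    proof (rule AE_I2)
      fix \<theta>
      obtain n0 :: nat where n0: "norm (f (cis \<theta>)) \<le> real n0" using real_arch_simple by blast
      have "\<forall>\<^sub>F n in sequentially. f (cis \<theta>) - F n (cis \<theta>) = 0"
        using eventually_ge_at_top[of n0] by (rule eventually_mono) (use n0 in \<open>auto simp: F_def\<close>)
      then show "(\<lambda>n. f (cis \<theta>) - F n (cis \<theta>)) \<longlonglongrightarrow> 0" by (rule tendsto_eventually)
    qed
  qed
  from lim_small[OF this, of "\<epsilon>/3"] obtain n where n: "Lnorm s (\<lambda>z. f z - F n z) < \<epsilon> / 3"
    using e by auto
  \<comment> \<open>A bound for \<open>F n\<close> that is positive also for \<open>n = 0\<close>,
    as the clamping needs.\<close>
  define K where "K = real n + 1"
  have K: "0 < K" by (simp add: K_def)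
  have FK: "norm (F n z) \<le> K" for z by (simp add: F_def K_def)
  have "(\<lambda>\<theta>. F n (cis \<theta>)) measurable_on {0..2*pi}"
    using Fm[of n] by (subst measurable_on_iff_borel_measurable) auto
  then obtain A g where A: "negligible A" and g: "\<And>m. continuous_on UNIV (g m)"
    and glim: "\<And>\<theta>. \<theta> \<notin> A \<Longrightarrow> (\<lambda>m. g m \<theta>) \<longlonglongrightarrow> (if \<theta> \<in> {0..2*pi} then F n (cis \<theta>) else 0)"
    unfolding measurable_on_def by blast
  \<comment> \<open>The continuous approximants g m converge almost everywhere but need not be
    bounded. The radial retraction onto the disc of radius K supplies the dominating constant and
    fixes the limit, whose values lie in the disc.\<close>
  define clamp where "clamp w = of_real (K / max K (norm w)) * w" for w :: complex
  have clamp_cont: "continuous_on UNIV clamp"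
    unfolding clamp_def using K by (intro continuous_intros) (auto simp: max_def)
  have clamp_le: "norm (clamp w) \<le> K" for w
  proof -
    have "norm (clamp w) = K * (norm w / max K (norm w))"
      using K by (simp add: clamp_def norm_mult norm_divide max_def)
    also have "\<dots> \<le> K * 1" using K by (intro mult_left_mono) (auto simp: max_def)
    finally show ?thesis by simp
  qed
  have clamp_id: "clamp w = w" if "norm w \<le> K" for w
    using that K by (simp add: clamp_def max_def)
  define H where "H m z = of_real (min 1 (real m * norm (z - 1))) * clamp (g m (Arg2pi z))" for m z
  have Hc: "continuous_on (sphere 0 1) (H m)" for m
    unfolding H_def
    by (rule continuous_on_circle_cutoff)
      (use clamp_le in \<open>auto intro!: continuous_on_compose2[OF clamp_cont g]\<close>)
  have HK: "norm (H m z) \<le> K" for m z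
  proof -
    have "norm (H m z) = min 1 (real m * norm (z - 1)) * norm (clamp (g m (Arg2pi z)))"
      by (simp add: H_def norm_mult)
    also have "\<dots> \<le> 1 * K" using clamp_le K by (intro mult_mono) auto
    finally show ?thesis by simp
  qed
  have Hm[measurable]: "(\<lambda>\<theta>. H m (cis \<theta>)) \<in> borel_measurable circ" for m
    by (intro continuous_measurable_circ continuous_on_compose2[OF Hc] continuous_intros) auto
  have "(\<lambda>m. Lp_norm s circ (\<lambda>\<theta>. F n (cis \<theta>) - H m (cis \<theta>))) \<longlonglongrightarrow> 0"
  proof (rule Lp_dominated_convergence[OF s0, where w = "\<lambda>_. of_real (2 * K)"])
    show "Lp_fun s circ (\<lambda>_. of_real (2 * K))" by (simp add: Lp_fun_def)
    show "(\<lambda>\<theta>. F n (cis \<theta>) - H m (cis \<theta>)) \<in> borel_measurable circ" for m by measurable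
    show "AE \<theta> in circ. norm (F n (cis \<theta>) - H m (cis \<theta>)) \<le> norm (complex_of_real (2 * K))" for m
    proof (rule AE_I2)
      fix \<theta>
      show "norm (F n (cis \<theta>) - H m (cis \<theta>)) \<le> norm (complex_of_real (2 * K))"
        using norm_triangle_ineq4[of "F n (cis \<theta>)" "H m (cis \<theta>)"] FK[of "cis \<theta>"] HK[of m "cis \<theta>"] K
        by (simp only: norm_of_real)
    qed
    have "AE \<theta> in lebesgue. \<theta> \<notin> A"
      using A by (intro AE_not_in) (simp add: negligible_iff_null_sets)
    then have "AE \<theta> in circ. \<theta> \<notin> A"
      by (auto simp: AE_restrict_space_iff elim: eventually_mono)
    with AE_circ_interior show "AE \<theta> in circ. (\<lambda>m. F n (cis \<theta>) - H m (cis \<theta>)) \<longlonglongrightarrow> 0"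
    proof eventually_elim
      fix \<theta> assume \<theta>: "0 < \<theta> \<and> \<theta> < 2 * pi" "\<theta> \<notin> A"
      have "cis \<theta> \<noteq> 1"
        using Arg2pi_cis_eq[of \<theta>] Arg2pi_of_real[of 1] \<theta> by auto
      then have pos: "0 < norm (cis \<theta> - 1)" by simp
      have gl: "(\<lambda>m. g m \<theta>) \<longlonglongrightarrow> F n (cis \<theta>)" using glim[of \<theta>] \<theta> by auto
      have "isCont clamp (F n (cis \<theta>))"
        using clamp_cont by (simp add: continuous_on_eq_continuous_at)
      from isCont_tendsto_compose[OF this gl]
      have cl: "(\<lambda>m. clamp (g m \<theta>)) \<longlonglongrightarrow> F n (cis \<theta>)" by (simp add: clamp_id[OF FK])
      \<comment> \<open>From this index on the cutoff factor at \<open>cis \<theta>\<close> equals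
        1.\<close>
      obtain m0 :: nat where m0: "1 / norm (cis \<theta> - 1) \<le> real m0" using real_arch_simple by blast
      have "\<forall>\<^sub>F m in sequentially. clamp (g m \<theta>) = H m (cis \<theta>)"
        using eventually_ge_at_top[of m0]
      proof (rule eventually_mono)
        fix m assume "m0 \<le> m"
        then have "1 / norm (cis \<theta> - 1) \<le> real m" using m0 by linarith
        then have "1 \<le> real m * norm (cis \<theta> - 1)" using pos by (simp add: field_simps)
        then show "clamp (g m \<theta>) = H m (cis \<theta>)"
          using \<theta> by (simp add: H_def min_def Arg2pi_cis_eq)
      qed
      with cl have "(\<lambda>m. H m (cis \<theta>)) \<longlonglongrightarrow> F n (cis \<theta>)" by (rule Lim_transform_eventually)
      from tendsto_diff[OF tendsto_const this, of "F n (cis \<theta>)"]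
      show "(\<lambda>m. F n (cis \<theta>) - H m (cis \<theta>)) \<longlonglongrightarrow> 0" by simp
    qed
  qed
  from lim_small[OF this, of "\<epsilon>/3"] obtain m where m: "Lnorm s (\<lambda>z. F n z - H m z) < \<epsilon> / 3"
    using e by auto
  obtain P where P: "polynomial_function P" "\<And>z. z \<in> sphere 0 1 \<Longrightarrow> norm (H m z - P z) < \<epsilon> / 3"
    using Stone_Weierstrass_polynomial_function[OF _ Hc, of "\<epsilon>/3" m] e by auto
  have tP: "trig_poly P" by (rule trig_poly_polynomial_function[OF P(1)])
  have LP: "Lspace s P" by (rule Lspace_trig_poly[OF s tP])
  have [measurable]: "(\<lambda>\<theta>. P (cis \<theta>)) \<in> borel_measurable circ"
    using LP by (simp add: Lspace_iff_Lp_fun Lp_fun_measurable)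
  have "(\<lambda>\<theta>. H m (cis \<theta>) - P (cis \<theta>)) \<in> borel_measurable circ" by measurable
  then have hp: "Lnorm s (\<lambda>z. H m z - P z) \<le> \<epsilon> / 3"
    using e s0 P(2) by (intro Lnorm_bounded) (auto intro: less_imp_le)
  have LF: "Lspace s (F n)" by (rule Lspace_bounded[of _ K]) (use FK s0 in auto)
  have LH: "Lspace s (H m)" by (rule Lspace_bounded[of _ K]) (use HK s0 in auto)
  have "Lnorm s (\<lambda>z. f z - P z) \<le>
      Lnorm s (\<lambda>z. f z - F n z) + (Lnorm s (\<lambda>z. F n z - H m z) + Lnorm s (\<lambda>z. H m z - P z))"
    using L.nrm_diff_trans[of f "F n" P] L.nrm_diff_trans[of "F n" "H m" P] f LF LH LP by simp
  then have "Lnorm s (\<lambda>z. f z - P z) < \<epsilon>" using n m hp by linarith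
  then show ?thesis using tP by blast
qed

lemma Lspace_fejer: "1 \<le> s \<Longrightarrow> Lspace s (fejer n f)"
proof -
  assume s: "1 \<le> s"
  interpret L: seminormed_complete "{f. Lspace s f}" "Lnorm s"
    by (rule Lspace_seminormed_complete[OF s])
  have "(\<lambda>z. 1 / of_nat n * (\<Sum>j<n. \<Sum>l<n. fcoef f (int j - int l) * z powi (int j - int l))) \<in> {f. Lspace s f}"
    by (intro L.scale_mem L.sum_mem) (use s in \<open>simp add: Lspace_powi\<close>)
  then show ?thesis by (simp add: fejer_def[abs_def])
qed

lemma fejer_add: "\<lbrakk>L1 f; L1 g\<rbrakk> \<Longrightarrow> fejer n (\<lambda>z. f z + g z) z = fejer n f z + fejer n g z"
  by (simp add: fejer_def fcoef_add distrib_right sum.distrib add_divide_distrib)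

lemma fejer_diff: "\<lbrakk>L1 f; L1 g\<rbrakk> \<Longrightarrow> fejer n (\<lambda>z. f z - g z) z = fejer n f z - fejer n g z"
  by (simp add: fejer_def fcoef_diff left_diff_distrib sum_subtractf diff_divide_distrib)

lemma fejer_cong_circle: "(\<And>z. norm z = 1 \<Longrightarrow> f z = g z) \<Longrightarrow> fejer n f = fejer n g"
  using fcoef_cong_circle[of f g] by (simp add: fejer_def[abs_def])

lemma fejer_weight_sum:
  "(\<Sum>j<n. \<Sum>l<n. of_bool (int j - int l = k) * c) / of_nat n = complex_of_real (fejer_weight n k) * c"
  by (simp add: fejer_weight_def sum_distrib_right sum_divide_distrib)

lemma fejer_monom:
  "fejer n (\<lambda>z. c * z powi k) z = of_real (fejer_weight n k) * (c * z powi k)"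
proof -
  have "fcoef (\<lambda>z. c * z powi k) (int j - int l) * z powi (int j - int l) =
      of_bool (int j - int l = k) * (c * z powi k)" for j l
    by (simp add: fcoef_scale fcoef_powi)
  then have "fejer n (\<lambda>z. c * z powi k) z = (\<Sum>j<n. \<Sum>l<n. of_bool (int j - int l = k) * (c * z powi k)) / of_nat n"
    by (simp only: fejer_def)
  then show ?thesis
    by (simp only: fejer_weight_sum)
qed

text \<open>Monomials are eigenvectors of the Fejer means, with the weights as eigenvalues, and
  these tend to 1.\<close>

lemma fejer_trig_poly_tendsto:
  assumes s: "1 < s" and P: "trig_poly P"
  shows "(\<lambda>n. Lnorm s (\<lambda>z. P z - fejer n P z)) \<longlonglongrightarrow> 0"
  using P
proof induction
  case (monom f c k)
  let ?m = "\<lambda>z. c * z powi k"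
  have L: "Lspace s ?m" using Lspace_trig_poly[of s ?m] trig_poly.monom[of ?m c k] s by simp
  have eq: "Lnorm s (\<lambda>z. f z - fejer n f z) = \<bar>1 - fejer_weight n k\<bar> * Lnorm s ?m" for n
  proof -
    have "Lnorm s (\<lambda>z. f z - fejer n f z) = Lnorm s (\<lambda>z. of_real (1 - fejer_weight n k) * ?m z)"
      using fejer_cong_circle[of f ?m n] monom
      by (intro Lnorm_cong_circle) (simp add: fejer_monom algebra_simps)
    also have "\<dots> = \<bar>1 - fejer_weight n k\<bar> * Lnorm s ?m"
      using seminormed_complete.nrm_scale[OF Lspace_seminormed_complete, of s ?m "of_real (1 - fejer_weight n k)"] s L
      by (simp only: norm_of_real mem_Collect_eq)
    finally show ?thesis .
  qed
  have "(\<lambda>n. \<bar>1 - fejer_weight n k\<bar> * Lnorm s ?m) \<longlonglongrightarrow> \<bar>1 - 1\<bar> * Lnorm s ?m"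
    by (intro tendsto_intros fejer_weight_tendsto)
  then show ?case unfolding eq by simp
next
  case (add f g h)
  interpret L: seminormed_complete "{f. Lspace s f}" "Lnorm s"
    by (rule Lspace_seminormed_complete) (use s in simp)
  have m: "Lspace s f" "Lspace s g" using Lspace_trig_poly s add by auto
  have L1: "L1 f" "L1 g" using m Lspace_imp_L1[of s] s by simp_all
  have mem: "(\<lambda>z. f z - fejer n f z) \<in> {f. Lspace s f}" "(\<lambda>z. g z - fejer n g z) \<in> {f. Lspace s f}" for n
    using m s by - (rule L.diff_mem; simp add: Lspace_fejer)+
  have le: "Lnorm s (\<lambda>z. h z - fejer n h z) \<le>
      Lnorm s (\<lambda>z. f z - fejer n f z) + Lnorm s (\<lambda>z. g z - fejer n g z)" for n
  proof -
    have "Lnorm s (\<lambda>z. h z - fejer n h z) = Lnorm s (\<lambda>z. (f z - fejer n f z) + (g z - fejer n g z))"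
      using fejer_cong_circle[of h "\<lambda>z. f z + g z" n] add.hyps
      by (intro Lnorm_cong_circle) (simp add: fejer_add[OF L1])
    also have "\<dots> \<le> Lnorm s (\<lambda>z. f z - fejer n f z) + Lnorm s (\<lambda>z. g z - fejer n g z)"
      by (rule L.nrm_triangle[OF mem])
    finally show ?thesis .
  qed
  have "\<forall>\<^sub>F n in sequentially. norm (Lnorm s (\<lambda>z. h z - fejer n h z)) \<le>
      Lnorm s (\<lambda>z. f z - fejer n f z) + Lnorm s (\<lambda>z. g z - fejer n g z)"
    using le by (simp add: Lnorm_nonneg)
  moreover have "(\<lambda>n. Lnorm s (\<lambda>z. f z - fejer n f z) + Lnorm s (\<lambda>z. g z - fejer n g z)) \<longlonglongrightarrow> 0"
    using tendsto_add[OF add.IH] by simp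
  ultimately show ?case by (rule Lim_null_comparison)
qed

text \<open>The Fejer means are contractions by \<open>Lnorm_fejer_le\<close>, so convergence
  spreads from the dense trigonometric polynomials to all functions.\<close>

lemma fejer_tendsto:
  assumes s: "1 < s" and f: "Lspace s f"
  shows "(\<lambda>n. Lnorm s (\<lambda>z. f z - fejer n f z)) \<longlonglongrightarrow> 0"
proof (rule tendstoI)
  interpret L: seminormed_complete "{f. Lspace s f}" "Lnorm s"
    by (rule Lspace_seminormed_complete) (use s in simp)
  fix \<epsilon> :: real assume e: "0 < \<epsilon>"
  obtain P where P: "trig_poly P" "Lnorm s (\<lambda>z. f z - P z) < \<epsilon> / 3"
    using trig_poly_dense[OF _ f, of "\<epsilon>/3"] s e by auto
  have LP: "Lspace s P" using Lspace_trig_poly P s by auto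
  have "\<forall>\<^sub>F n in sequentially. Lnorm s (\<lambda>z. P z - fejer n P z) < \<epsilon> / 3"
    by (rule order_tendstoD(2)[OF fejer_trig_poly_tendsto[OF s P(1)]]) (use e in simp)
  then show "\<forall>\<^sub>F n in sequentially. dist (Lnorm s (\<lambda>z. f z - fejer n f z)) 0 < \<epsilon>"
    using eventually_gt_at_top[of 0]
  proof eventually_elim
    fix n :: nat assume n: "Lnorm s (\<lambda>z. P z - fejer n P z) < \<epsilon> / 3" "0 < n"
    have m: "f \<in> {f. Lspace s f}" "P \<in> {f. Lspace s f}" "fejer n P \<in> {f. Lspace s f}" "fejer n f \<in> {f. Lspace s f}"
      using f LP s by (auto simp: Lspace_fejer)
    have "Lnorm s (\<lambda>z. fejer n P z - fejer n f z) = Lnorm s (fejer n (\<lambda>z. P z - f z))"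
      using fejer_diff[OF Lspace_imp_L1[OF _ LP] Lspace_imp_L1[OF _ f], of n] s by (intro Lnorm_cong_circle) simp
    also have "\<dots> \<le> Lnorm s (\<lambda>z. P z - f z)"
      using L.diff_mem[OF m(2,1)] n s by (intro Lnorm_fejer_le) auto
    also have "\<dots> = Lnorm s (\<lambda>z. f z - P z)" by (rule L.nrm_diff_commute[OF m(2,1)])
    finally have "Lnorm s (\<lambda>z. f z - fejer n f z) < \<epsilon>"
      using L.nrm_diff_trans[OF m(1,2,4)] L.nrm_diff_trans[OF m(2,3,4)] P(2) n by linarith
    then show "dist (Lnorm s (\<lambda>z. f z - fejer n f z)) 0 < \<epsilon>"
      by (simp add: Lnorm_nonneg)
  qed
qed

lemma fourier_uniqueness:
  assumes s: "1 < s" and f: "Lspace s f" and z: "\<And>n. fcoef f n = 0"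
  shows "f \<in> null_T"
proof -
  have "fejer n f = (\<lambda>_. 0)" for n by (simp add: fejer_def[abs_def] z)
  then have "(\<lambda>n. Lnorm s f) \<longlonglongrightarrow> 0" using fejer_tendsto[OF s f] by simp
  then have "Lnorm s f = 0" by (simp add: LIMSEQ_const_iff)
  then show ?thesis using Lnorm_eq_0_iff[of s f] s f by simp
qed

lemma fcoef_null_T: "f \<in> null_T \<Longrightarrow> fcoef f n = 0"
proof -
  assume "f \<in> null_T"
  then have "AE \<theta> in circ. f (cis \<theta>) = 0" by (simp add: null_T_iff)
  then have "AE \<theta> in circ. f (cis \<theta>) * cis (- (of_int n * \<theta>)) = 0" by (rule eventually_mono) simp
  then show ?thesis by (simp add: fcoef_eq_integral integral_eq_zero_AE)
qed

text \<open>Measurability comes from completeness of Lebesgue measure; it is what places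
  \<open>null_T\<close> inside every Hardy space.\<close>

lemma null_T_measurable:
  assumes "f \<in> null_T"
  shows "(\<lambda>\<theta>. f (cis \<theta>)) \<in> borel_measurable circ"
proof -
  have "AE \<theta> in lebesgue. \<theta> \<in> {0..2*pi} \<longrightarrow> f (cis \<theta>) = 0" using assms by (simp add: null_T_def)
  then have "AE \<theta> in lebesgue. 0 = indicator {0..2*pi} \<theta> *\<^sub>R f (cis \<theta>)"
    by (rule eventually_mono) (auto simp: indicator_def)
  then have "(\<lambda>\<theta>. indicator {0..2*pi} \<theta> *\<^sub>R f (cis \<theta>)) \<in> borel_measurable lebesgue"
    by (rule borel_measurable_AE[rotated]) simp
  then show ?thesis by (simp add: borel_measurable_restrict_space_iff)
qed

lemma Lspace_null_T: "\<lbrakk>f \<in> null_T; 0 < s\<rbrakk> \<Longrightarrow> Lspace s f"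
  using null_T_measurable[of f] null_T_iff[of f]
  by (intro Lspace_bounded[of f 0]) auto

section \<open>Hardy spaces and analytic polynomials\<close>

lemma Hardy_seminormed_complete:
  assumes s: "1 < s"
  shows "seminormed_complete (Hardy s) (Lnorm s)"
proof -
  interpret L: seminormed_complete "{f. Lspace s f}" "Lnorm s"
    by (rule Lspace_seminormed_complete) (use s in simp)
  have L1: "L1 f" if "Lspace s f" for f using that Lspace_imp_L1[of s f] s by simp
  show ?thesis
  proof
    show "(\<lambda>_. 0) \<in> Hardy s" using L.zero_mem by (simp add: Hardy_def)
    show add: "(\<lambda>t. x t + y t) \<in> Hardy s" if "x \<in> Hardy s" "y \<in> Hardy s" for x y
      using that L.add_mem[of x y] fcoef_add[OF L1 L1, of x y] by (simp add: Hardy_def)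
    show "(\<lambda>t. c * x t) \<in> Hardy s" if "x \<in> Hardy s" for x c
      using that L.scale_mem[of x c] by (simp add: Hardy_def fcoef_scale)
    show "Lnorm s (\<lambda>t. x t + y t) \<le> Lnorm s x + Lnorm s y" if "x \<in> Hardy s" "y \<in> Hardy s" for x y
      using that by (intro L.nrm_triangle) (simp_all add: Hardy_def)
    show "Lnorm s (\<lambda>t. c * x t) = norm c * Lnorm s x" if "x \<in> Hardy s" for x c
      using that by (intro L.nrm_scale) (simp add: Hardy_def)
    fix u :: "nat \<Rightarrow> complex \<Rightarrow> complex"
    assume u: "\<And>i. u i \<in> Hardy s" and sum: "summable (\<lambda>i. Lnorm s (u i))"
    have uL: "u i \<in> {f. Lspace s f}" for i using u by (simp add: Hardy_def)
    from L.complete[OF uL sum] obtain y where y: "Lspace s y"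
      and lim: "(\<lambda>n. Lnorm s (\<lambda>t. y t - (\<Sum>i<n. u i t))) \<longlonglongrightarrow> 0" by blast
    \<comment> \<open>The coefficient vanishes for all partial sums, and
      \<open>fcoef_le_Lnorm\<close> bounds the difference from that of the limit.\<close>
    have "fcoef y m = 0" if "m < 0" for m
    proof -
      have le: "norm (fcoef y m) \<le> Lnorm s (\<lambda>t. y t - (\<Sum>i<n. u i t))" for n
      proof -
        have p: "(\<lambda>t. \<Sum>i<n. u i t) \<in> {f. Lspace s f}" using uL by (rule L.sum_mem)
        have "fcoef (\<lambda>t. \<Sum>i<n. u i t) m = 0"
          using uL L1 fcoef_sum[of "{..<n}" u m] u that by (simp add: Hardy_def)
        then have "fcoef (\<lambda>t. y t - (\<Sum>i<n. u i t)) m = fcoef y m"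
          using fcoef_diff[OF L1 L1, of y "\<lambda>t. \<Sum>i<n. u i t" m] y p by simp
        moreover have "Lspace s (\<lambda>t. y t - (\<Sum>i<n. u i t))" using L.diff_mem[OF _ p] y by simp
        ultimately show ?thesis using fcoef_le_Lnorm[OF s, of _ m] by metis
      qed
      then have "norm (fcoef y m) \<le> 0" by (intro LIMSEQ_le_const[OF lim]) simp
      then show ?thesis by simp
    qed
    then have "y \<in> Hardy s" using y by (simp add: Hardy_def)
    with lim show "\<exists>y\<in>Hardy s. (\<lambda>n. Lnorm s (\<lambda>t. y t - (\<Sum>i<n. u i t))) \<longlonglongrightarrow> 0" by (rule bexI)
  qed
qed

lemma Hardy_null:
  assumes s: "1 < s"
  shows "seminormed_complete.null (Hardy s) (Lnorm s) = null_T"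
proof -
  interpret H: seminormed_complete "Hardy s" "Lnorm s" by (rule Hardy_seminormed_complete[OF s])
  show ?thesis
    using Lspace_null_T[of _ s] fcoef_null_T Lnorm_eq_0_iff[of s] s
    unfolding H.null_def by (auto simp: Hardy_def)
qed

definition cpoly :: "nat set \<Rightarrow> (nat \<Rightarrow> complex) \<Rightarrow> complex \<Rightarrow> complex" where
  "cpoly A \<xi> z = (\<Sum>k\<in>A. \<xi> k * z ^ k)"

lemma Lspace_monom: "0 < s \<Longrightarrow> Lspace s (\<lambda>z. z ^ k)"
  using Lspace_powi[of s "int k"] by simp

lemma L1_monom: "L1 (\<lambda>z. z ^ k)"
  using L1_powi[of "int k"] by simp

lemma L1_cpoly: "L1 (cpoly A \<xi>)"
  unfolding cpoly_def by (intro L1_sum L1_scale L1_monom)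

lemma fcoef_cpoly:
  assumes "finite A"
  shows "fcoef (cpoly A \<xi>) m = (if 0 \<le> m \<and> nat m \<in> A then \<xi> (nat m) else 0)"
proof -
  have "fcoef (cpoly A \<xi>) m = (\<Sum>k\<in>A. \<xi> k * fcoef (\<lambda>z. z ^ k) m)"
    unfolding cpoly_def by (simp only: fcoef_sum L1_scale L1_monom fcoef_scale)
  also have "\<dots> = (\<Sum>k\<in>A. if int k = m then \<xi> k else 0)"
    using fcoef_powi[of "int k" m for k] by (intro sum.cong) simp_all
  also have "\<dots> = (if 0 \<le> m \<and> nat m \<in> A then \<xi> (nat m) else 0)"
  proof (cases "0 \<le> m")
    case True
    then have "(\<Sum>k\<in>A. if int k = m then \<xi> k else 0) = (\<Sum>k\<in>A. if k = nat m then \<xi> k else 0)"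
      by (intro sum.cong) auto
    then show ?thesis using assms True by simp
  next
    case False
    then show ?thesis by (auto intro!: sum.neutral)
  qed
  finally show ?thesis .
qed

lemma cpoly_Hardy:
  assumes "1 < s" "finite A"
  shows "cpoly A \<xi> \<in> Hardy s"
proof -
  interpret L: seminormed_complete "{f. Lspace s f}" "Lnorm s"
    by (rule Lspace_seminormed_complete) (use assms in simp)
  have "cpoly A \<xi> \<in> {f. Lspace s f}"
    unfolding cpoly_def using assms by (intro L.lincomb_mem) (simp add: Lspace_monom)
  then show ?thesis using fcoef_cpoly[OF assms(2)] by (simp add: Hardy_def)
qed

text \<open>The negative coefficients vanish, so the Fejer means of a Hardy function are analytic
  polynomials. This makes them approximants inside the Hardy space.\<close>

lemma fejer_Hardy:
  assumes f: "f \<in> Hardy s"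
  shows "fejer n f = cpoly {..<n} (\<lambda>k. of_real (fejer_weight n (int k)) * fcoef f (int k))"
proof
  fix z
  have trm: "fcoef f (int j - int l) * z powi (int j - int l) =
      (\<Sum>k<n. of_bool (int j - int l = int k) * (fcoef f (int k) * z ^ k))" if "j < n" for j l
  proof (cases "l \<le> j")
    case True
    then have "(\<Sum>k<n. of_bool (int j - int l = int k) * (fcoef f (int k) * z ^ k)) =
        (\<Sum>k<n. if k = j - l then fcoef f (int k) * z ^ k else 0)"
      by (intro sum.cong) auto
    also have "\<dots> = fcoef f (int (j - l)) * z ^ (j - l)" using that by (simp add: less_imp_diff_less)
    finally show ?thesis using True by (simp add: power_int_def nat_diff_distrib of_nat_diff)
  next
    case False
    then have "fcoef f (int j - int l) = 0" using f by (simp add: Hardy_def)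
    moreover have "(\<Sum>k<n. of_bool (int j - int l = int k) * (fcoef f (int k) * z ^ k)) = 0"
      using False by (intro sum.neutral) auto
    ultimately show ?thesis by simp
  qed
  have "fejer n f z = (\<Sum>j<n. \<Sum>l<n. \<Sum>k<n. of_bool (int j - int l = int k) * (fcoef f (int k) * z ^ k)) / of_nat n"
    unfolding fejer_def using trm by simp
  also have "(\<Sum>j<n. \<Sum>l<n. \<Sum>k<n. of_bool (int j - int l = int k) * (fcoef f (int k) * z ^ k)) =
      (\<Sum>k<n. \<Sum>j<n. \<Sum>l<n. of_bool (int j - int l = int k) * (fcoef f (int k) * z ^ k))"
    proof -
    have "(\<Sum>l<n. \<Sum>k<n. of_bool (int j - int l = int k) * (fcoef f (int k) * z ^ k)) =
        (\<Sum>k<n. \<Sum>l<n. of_bool (int j - int l = int k) * (fcoef f (int k) * z ^ k))" for j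
      by (rule sum.swap)
    then show ?thesis by (simp only:) (rule sum.swap)
  qed
  also have "\<dots> / of_nat n = cpoly {..<n} (\<lambda>k. of_real (fejer_weight n (int k)) * fcoef f (int k)) z"
    unfolding cpoly_def by (subst sum_divide_distrib) (intro sum.cong refl, simp only: fejer_weight_sum mult.assoc)
  finally show "fejer n f z = cpoly {..<n} (\<lambda>k. of_real (fejer_weight n (int k)) * fcoef f (int k)) z" .
qed

lemma cpoly_dense:
  assumes s: "1 < s" and f: "f \<in> Hardy s" and e: "0 < \<epsilon>"
  shows "\<exists>n \<xi>. Lnorm s (\<lambda>z. f z - cpoly {..<n} \<xi> z) < \<epsilon>"
proof -
  have "Lspace s f" using f by (simp add: Hardy_def)
  from order_tendstoD(2)[OF fejer_tendsto[OF s this] e]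
  obtain n where "Lnorm s (\<lambda>z. f z - fejer n f z) < \<epsilon>" by (auto dest: eventually_happens)
  then show ?thesis using fejer_Hardy[OF f] by metis
qed

section \<open>Sequence spaces and truncation\<close>

lemma lp_iff_Lp_fun: "x \<in> lp p \<longleftrightarrow> Lp_fun p (count_space UNIV) x"
  by (simp add: lp_def Lp_fun_def integrable_count_space_nat_iff)

lemma lpnorm_eq_Lp_norm: "x \<in> lp p \<Longrightarrow> lpnorm p x = Lp_norm p (count_space UNIV) x"
  by (simp add: lpnorm_def Lp_norm_def lp_iff_Lp_fun Lp_fun_def integral_count_space_nat)

lemma lp_seminormed_complete:
  assumes p: "1 \<le> p"
  shows "seminormed_complete (lp p) (lpnorm p)"
proof
  show "(\<lambda>_. 0) \<in> lp p" by (simp add: lp_iff_Lp_fun Lp_fun_zero)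
  show add: "(\<lambda>t. x t + y t) \<in> lp p" if "x \<in> lp p" "y \<in> lp p" for x y
    using that Lp_fun_add[OF p] by (simp add: lp_iff_Lp_fun)
  show sc: "(\<lambda>t. c * x t) \<in> lp p" if "x \<in> lp p" for x c
    using that Lp_fun_scale by (simp add: lp_iff_Lp_fun)
  show "lpnorm p (\<lambda>t. x t + y t) \<le> lpnorm p x + lpnorm p y" if "x \<in> lp p" "y \<in> lp p" for x y
    using that add[OF that] Lp_norm_triangle[OF p, of "count_space UNIV" x y]
    by (simp add: lpnorm_eq_Lp_norm lp_iff_Lp_fun)
  show "lpnorm p (\<lambda>t. c * x t) = norm c * lpnorm p x" if "x \<in> lp p" for x c
    using that sc[OF that, of c] Lp_norm_scale[of p "count_space UNIV" c x] p
    by (simp add: lpnorm_eq_Lp_norm)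
  fix u :: "nat \<Rightarrow> nat \<Rightarrow> complex"
  assume u: "\<And>i. u i \<in> lp p" and sum: "summable (\<lambda>i. lpnorm p (u i))"
  have uL: "Lp_fun p (count_space UNIV) (u i)" for i using u by (simp add: lp_iff_Lp_fun)
  have sL: "summable (\<lambda>i. Lp_norm p (count_space UNIV) (u i))"
    using sum u by (simp add: lpnorm_eq_Lp_norm)
  let ?f = "\<lambda>x. \<Sum>i. u i x"
  have f: "?f \<in> lp p" using Lp_complete(1)[OF p uL sL] by (simp add: lp_iff_Lp_fun)
  have d: "(\<lambda>t. ?f t - (\<Sum>i<n. u i t)) \<in> lp p" for n
    unfolding lp_iff_Lp_fun
    using Lp_fun_add[OF p Lp_complete(1)[OF p uL sL] Lp_fun_scale[OF Lp_fun_sum[OF p uL, where I = "{..<n}"], of "- 1"]]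
    by simp
  have "(\<lambda>n. lpnorm p (\<lambda>t. ?f t - (\<Sum>i<n. u i t))) \<longlonglongrightarrow> 0"
    using Lp_complete(2)[OF p uL sL] by (simp add: lpnorm_eq_Lp_norm[OF d])
  then show "\<exists>y\<in>lp p. (\<lambda>n. lpnorm p (\<lambda>t. y t - (\<Sum>i<n. u i t))) \<longlonglongrightarrow> 0" using f by (rule bexI)
qed

lemma lp_null:
  assumes p: "1 \<le> p"
  shows "seminormed_complete.null (lp p) (lpnorm p) = {\<lambda>_. 0}"
proof -
  interpret L: seminormed_complete "lp p" "lpnorm p" by (rule lp_seminormed_complete[OF p])
  have "x = (\<lambda>_. 0)" if "x \<in> lp p" "lpnorm p x = 0" for x
    using that Lp_norm_eq_0[of p "count_space UNIV" x] p
    by (auto simp: lpnorm_eq_Lp_norm lp_iff_Lp_fun AE_count_space)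
  then show ?thesis by (auto simp: L.null_def L.zero_mem)
qed

definition truncate :: "nat \<Rightarrow> (nat \<Rightarrow> complex) \<Rightarrow> nat \<Rightarrow> complex" where
  "truncate n \<xi> = (\<lambda>k. if k < n then \<xi> k else 0)"

lemma truncate_lp: "truncate n \<xi> \<in> lp p"
  unfolding lp_def by (auto intro!: summable_finite[of "{..<n}"] simp: truncate_def split: if_splits)

lemma truncate_tendsto:
  assumes p: "1 \<le> p" and x: "\<xi> \<in> lp p"
  shows "(\<lambda>n. lpnorm p (\<lambda>k. \<xi> k - truncate n \<xi> k)) \<longlonglongrightarrow> 0"
proof -
  interpret L: seminormed_complete "lp p" "lpnorm p" by (rule lp_seminormed_complete[OF p])
  have "(\<lambda>n. Lp_norm p (count_space UNIV) (\<lambda>k. \<xi> k - truncate n \<xi> k)) \<longlonglongrightarrow> 0"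
  proof (rule Lp_dominated_convergence[where w = \<xi>])
    show "Lp_fun p (count_space UNIV) \<xi>" using x by (simp add: lp_iff_Lp_fun)
    show "AE k in count_space UNIV. (\<lambda>n. \<xi> k - truncate n \<xi> k) \<longlonglongrightarrow> 0"
    proof (rule AE_I2)
      fix k
      have "\<forall>\<^sub>F n in sequentially. \<xi> k - truncate n \<xi> k = 0"
        using eventually_gt_at_top[of k] by (rule eventually_mono) (simp add: truncate_def)
      then show "(\<lambda>n. \<xi> k - truncate n \<xi> k) \<longlonglongrightarrow> 0" by (rule tendsto_eventually)
    qed
  qed (use p in \<open>auto simp: truncate_def\<close>)
  then show ?thesis using L.diff_mem[OF x truncate_lp] by (simp add: lpnorm_eq_Lp_norm)
qed

section \<open>The Hausdorff-Young inequality\<close>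

text \<open>Parseval against a polynomial. Taking f to be the polynomial itself yields Plancherel; a
  general f enters in the duality argument for Hausdorff-Young.\<close>

lemma integral_mult_cnj_cpoly:
  assumes f: "L1 f" and A: "finite A"
  shows "(\<integral>\<theta>. f (cis \<theta>) * cnj (cpoly A \<eta> (cis \<theta>)) \<partial>circ) =
      of_real (2 * pi) * (\<Sum>k\<in>A. cnj (\<eta> k) * fcoef f (int k))"
proof -
  have cnj: "cnj (cpoly A \<eta> (cis \<theta>)) = (\<Sum>k\<in>A. cnj (\<eta> k) * cis (- (of_int (int k) * \<theta>)))" for \<theta>
    by (simp add: cpoly_def Complex.DeMoivre cis_cnj)
  have "(\<integral>\<theta>. f (cis \<theta>) * cnj (cpoly A \<eta> (cis \<theta>)) \<partial>circ) =
      (\<integral>\<theta>. (\<Sum>k\<in>A. cnj (\<eta> k) * (f (cis \<theta>) * cis (- (of_int (int k) * \<theta>)))) \<partial>circ)"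
    unfolding cnj by (simp add: sum_distrib_left mult.left_commute)
  also have "\<dots> = (\<Sum>k\<in>A. cnj (\<eta> k) * (\<integral>\<theta>. f (cis \<theta>) * cis (- (of_int (int k) * \<theta>)) \<partial>circ))"
    by (subst Bochner_Integration.integral_sum) (intro integrable_mult_right L1_mult_cis f, simp)
  also have "\<dots> = (\<Sum>k\<in>A. of_real (2 * pi) * (cnj (\<eta> k) * fcoef f (int k)))"
    by (simp add: fcoef_eq_integral)
  finally show ?thesis by (simp add: sum_distrib_left)
qed

lemma integral_norm_cpoly_squared:
  assumes A: "finite A"
  shows "(\<integral>\<theta>. (norm (cpoly A \<xi> (cis \<theta>)))\<^sup>2 \<partial>circ) = 2 * pi * (\<Sum>k\<in>A. (norm (\<xi> k))\<^sup>2)"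
proof -
  have "complex_of_real (\<integral>\<theta>. (norm (cpoly A \<xi> (cis \<theta>)))\<^sup>2 \<partial>circ) =
      (\<integral>\<theta>. cpoly A \<xi> (cis \<theta>) * cnj (cpoly A \<xi> (cis \<theta>)) \<partial>circ)"
    by (simp only: integral_complex_of_real[symmetric] complex_norm_square)
  also have "\<dots> = of_real (2 * pi) * (\<Sum>k\<in>A. cnj (\<xi> k) * fcoef (cpoly A \<xi>) (int k))"
    by (rule integral_mult_cnj_cpoly[OF L1_cpoly A])
  also have "(\<Sum>k\<in>A. cnj (\<xi> k) * fcoef (cpoly A \<xi>) (int k)) = (\<Sum>k\<in>A. of_real ((norm (\<xi> k))\<^sup>2))"
    by (intro sum.cong refl) (simp only: fcoef_cpoly[OF A] complex_norm_square, simp)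
  also have "of_real (2 * pi) * \<dots> = complex_of_real (2 * pi * (\<Sum>k\<in>A. (norm (\<xi> k))\<^sup>2))" by simp
  finally show ?thesis by (simp only: of_real_eq_iff)
qed

lemma integrable_norm_cpoly_squared: "finite A \<Longrightarrow> integrable circ (\<lambda>\<theta>. (norm (cpoly A \<xi> (cis \<theta>)))\<^sup>2)"
  using Lp_fun_integrable[of 2 circ "\<lambda>\<theta>. cpoly A \<xi> (cis \<theta>)"] cpoly_Hardy[of 2 A \<xi>]
  by (simp add: Hardy_def Lspace_iff_Lp_fun)

text \<open>A sum of distinct powers of r is dominated by its largest term up to the factor
  \<open>r / (r - 1)\<close>, so a bound M for single terms controls the whole sum. The
  interpolation uses this for the levels at which a given coefficient is kept.\<close>

lemma sum_geometric_bounded: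
  fixes r :: real
  assumes r: "1 < r" and S: "finite S" "\<And>j. j \<in> S \<Longrightarrow> r ^ j \<le> M" and M: "0 \<le> M"
  shows "(\<Sum>j\<in>S. r ^ j) \<le> M * (r / (r - 1))"
proof (cases "S = {}")
  case True
  then show ?thesis using r M by simp
next
  case False
  let ?m = "Max S"
  have "(\<Sum>j\<in>S. r ^ j) \<le> (\<Sum>j\<le>?m. r ^ j)"
    using S r by (intro sum_mono2) auto
  also have "\<dots> = (r ^ Suc ?m - 1) / (r - 1)"
    using r by (simp add: sum_gp0 field_simps)
  also have "\<dots> \<le> (r * M) / (r - 1)"
  proof (rule divide_right_mono)
    have "r * r ^ ?m \<le> r * M" using r S(2)[OF Max_in[OF S(1) False]] by (intro mult_left_mono) auto
    then show "r ^ Suc ?m - 1 \<le> r * M" by simp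
  qed (use r in simp)
  finally show ?thesis by (simp add: mult.commute)
qed

text \<open>Marcinkiewicz interpolation, done pointwise: where the polynomial is of size about
  \<^term>\<open>2 ^ j\<close>, discarding the coefficients larger than \<^term>\<open>2 powr ((1 - j) * (q - 1))\<close>
  changes it by at most half its size.\<close>

lemma Hausdorff_Young_normalized:
  assumes p: "1 < p" "p < 2" and pq: "1 / p + 1 / q = 1"
  shows "\<exists>C>0. \<forall>A \<xi>. finite A \<longrightarrow> (\<Sum>k\<in>A. norm (\<xi> k) powr p) \<le> 1 \<longrightarrow>
      (\<integral>\<theta>. norm (cpoly A \<xi> (cis \<theta>)) powr q \<partial>circ) \<le> 2 * pi * C"
proof -
  have q: "2 < q" and pq1: "(p - 1) * (q - 1) = 1"
  proof -
    have "q \<noteq> 0" using pq p by auto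
    then have eq: "p + q = p * q" using pq p by (simp add: field_simps)
    then show "(p - 1) * (q - 1) = 1" by (simp add: algebra_simps)
    have "q * (p - 1) = p" using eq by (simp add: algebra_simps)
    then have "q = p / (p - 1)" using p by (simp add: field_simps)
    moreover have "2 < p / (p - 1)" using p by (simp add: field_simps)
    ultimately show "2 < q" by simp
  qed
  have pq2: "(p - 1) * (q - 2) = 2 - p" using pq1 by (simp add: algebra_simps)
  \<comment> \<open>Where the polynomial has size about \<open>2 ^ j\<close>, its q-th power exceeds
    its square by a factor of about \<open>r ^ j\<close>.\<close>
  define r where "r = 2 powr (q - 2)"
  have r: "1 < r" using q by (simp add: r_def)
  have r_power: "r ^ j = 2 powr ((q - 2) * real j)" for j
    by (simp add: r_def powr_powr flip: powr_realpow)
  \<comment> \<open>The 1 covers the points where the modulus is at most 1;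
    \<open>2 powr (q + 2)\<close> arises from replacing \<open>2 powr (j + 1)\<close> by
    \<open>2 powr (j - 1)\<close>; the rest is the geometric sum over the levels.\<close>
  define C where "C = 1 + 2 powr (q + 2) * (r * (r / (r - 1)))"
  have C: "0 < C" using r by (auto simp: C_def intro!: add_pos_nonneg mult_nonneg_nonneg divide_nonneg_nonneg)
  have "(\<integral>\<theta>. norm (cpoly A \<xi> (cis \<theta>)) powr q \<partial>circ) \<le> 2 * pi * C"
    if A: "finite A" and S: "(\<Sum>k\<in>A. norm (\<xi> k) powr p) \<le> 1" for A and \<xi> :: "nat \<Rightarrow> complex"
  proof -
    \<comment> \<open>As \<open>(p - 1) * (q - 1) = 1\<close>, this gives
      \<open>a j powr (1 - p) = 2 powr (j - 1)\<close>. A coefficient above the threshold is at most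
      this number times its p-th power, so the discarded ones sum to at most
      \<open>2 powr (j - 1)\<close>.\<close>
    define a where "a j = 2 powr ((1 - real j) * (q - 1))" for j
    have a: "0 < a j" for j by (simp add: a_def)
    define Aj where "Aj j = {k\<in>A. norm (\<xi> k) \<le> a j}" for j
    have Aj: "finite (Aj j)" "Aj j \<subseteq> A" for j using A by (auto simp: Aj_def)
    define P where "P = cpoly A \<xi>"
    define Pj where "Pj j = cpoly (Aj j) \<xi>" for j
    have diff: "norm (P z - Pj j z) \<le> 2 powr (real j - 1)" if z: "norm z = 1" for z j
    proof -
      have "P z - Pj j z = (\<Sum>k\<in>A - Aj j. \<xi> k * z ^ k)"
        unfolding P_def Pj_def cpoly_def using A Aj[of j] by (simp add: sum_diff)
      also have "norm \<dots> \<le> (\<Sum>k\<in>A - Aj j. norm (\<xi> k))"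
        using z by (intro sum_norm_le) (simp add: norm_mult norm_power)
      also have "\<dots> \<le> (\<Sum>k\<in>A - Aj j. a j powr (1 - p) * norm (\<xi> k) powr p)"
      proof (rule sum_mono)
        fix k assume "k \<in> A - Aj j"
        then have k: "a j < norm (\<xi> k)" by (auto simp: Aj_def)
        then have pos: "0 < norm (\<xi> k)" using a[of j] by linarith
        have "norm (\<xi> k) powr (1 - p) \<le> a j powr (1 - p)"
          using k p a[of j] by (intro powr_mono2') auto
        then have "norm (\<xi> k) powr (1 - p) * norm (\<xi> k) powr p \<le> a j powr (1 - p) * norm (\<xi> k) powr p"
          by (rule mult_right_mono) simp
        moreover have "norm (\<xi> k) powr (1 - p) * norm (\<xi> k) powr p = norm (\<xi> k)"
          using pos by (simp flip: powr_add)
        ultimately show "norm (\<xi> k) \<le> a j powr (1 - p) * norm (\<xi> k) powr p" by simp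
      qed
      also have "\<dots> = a j powr (1 - p) * (\<Sum>k\<in>A - Aj j. norm (\<xi> k) powr p)"
        by (simp add: sum_distrib_left)
      also have "\<dots> \<le> a j powr (1 - p) * 1"
        using S sum_mono2[of A "A - Aj j" "\<lambda>k. norm (\<xi> k) powr p"] A
        by (intro mult_left_mono) auto
      also have "a j powr (1 - p) = 2 powr (real j - 1)"
      proof -
        have "(1 - real j) * (q - 1) * (1 - p) = (real j - 1) * ((p - 1) * (q - 1))"
          by (simp add: algebra_simps)
        then show ?thesis by (simp add: a_def powr_powr pq1)
      qed
      finally show ?thesis by simp
    qed
    define T where "T = (\<Sum>k\<in>A. norm (\<xi> k))"
    \<comment> \<open>The polynomial is bounded by T on the circle, so only the finitely many levels
      below J occur.\<close>
    obtain J :: nat where J: "T < 2 ^ J" using real_arch_pow[of 2 T] by auto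
    have PT: "norm (P z) \<le> T" if "norm z = 1" for z
      unfolding P_def cpoly_def T_def
      using that by (intro sum_norm_le) (simp add: norm_mult norm_power)
    let ?B = "\<lambda>z. 1 + (\<Sum>j<J. 2 powr (q + 2) * r ^ j * (norm (Pj j z))\<^sup>2)"
    have point: "norm (P z) powr q \<le> ?B z" if z: "norm z = 1" for z
    proof (cases "norm (P z) \<le> 1")
      case True
      then have "norm (P z) powr q \<le> 1" using q powr_mono2[of q "norm (P z)" 1] by simp
      moreover have "0 \<le> (\<Sum>j<J. 2 powr (q + 2) * r ^ j * (norm (Pj j z))\<^sup>2)"
        using r by (intro sum_nonneg) auto
      ultimately show ?thesis by linarith
    next
      case False
      define t where "t = norm (P z)"
      have t: "1 < t" using False by (simp add: t_def)
      define j where "j = nat \<lfloor>log 2 t\<rfloor>"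
      have l0: "0 < log 2 t" using t by simp
      have jl: "real j \<le> log 2 t" "log 2 t < real j + 1"
        using l0 by (auto simp: j_def)
      have j1: "2 powr real j \<le> t" "t < 2 powr (real j + 1)"
        using jl t by (auto simp: le_log_iff log_less_iff)
      have "t < 2 ^ J" using PT[OF z] J by (simp add: t_def)
      then have "t < 2 powr real J" by (simp add: powr_realpow)
      then have "2 powr real j < 2 powr real J" by (rule le_less_trans[OF j1(1)])
      then have jJ: "j < J" by simp
      have half: "2 powr real j = 2 * 2 powr (real j - 1)"
        by (simp add: powr_diff)
      have "t \<le> norm (P z - Pj j z) + norm (Pj j z)"
        unfolding t_def using norm_triangle_ineq[of "P z - Pj j z" "Pj j z"] by simp
      then have Pbig: "2 powr (real j - 1) \<le> norm (Pj j z)"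
        using diff[OF z, of j] j1(1) half by linarith
      have "t powr q \<le> (2 powr (real j + 1)) powr q" using j1 t q by (intro powr_mono2) auto
      also have "\<dots> = 2 powr (q + 2) * r ^ j * (2 powr (real j - 1))\<^sup>2"
      proof -
        have "(2 powr (real j - 1))\<^sup>2 = 2 powr (2 * real j - 2)"
          by (simp add: power2_eq_square flip: powr_add)
        moreover have "(2 powr (real j + 1)) powr q = 2 powr ((q + 2) + (q - 2) * real j + (2 * real j - 2))"
          by (simp add: powr_powr algebra_simps)
        ultimately show ?thesis by (simp only: powr_add r_power)
      qed
      also have "\<dots> \<le> 2 powr (q + 2) * r ^ j * (norm (Pj j z))\<^sup>2"
        using Pbig r by (intro mult_left_mono power_mono) auto
      also have "\<dots> \<le> (\<Sum>j<J. 2 powr (q + 2) * r ^ j * (norm (Pj j z))\<^sup>2)"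
        using jJ r by (intro member_le_sum[of j "{..<J}" "\<lambda>j. 2 powr (q + 2) * r ^ j * (norm (Pj j z))\<^sup>2"]) auto
      finally show ?thesis by (simp add: t_def)
    qed
    have iB: "integrable circ (\<lambda>\<theta>. ?B (cis \<theta>))"
      unfolding Pj_def using Aj
      by (intro Bochner_Integration.integrable_add Bochner_Integration.integrable_sum
          integrable_mult_right integrable_norm_cpoly_squared) auto
    have "P \<in> Hardy q" unfolding P_def using q A by (intro cpoly_Hardy) auto
    then have iP: "integrable circ (\<lambda>\<theta>. norm (P (cis \<theta>)) powr q)"
      by (simp add: Hardy_def Lspace_iff_Lp_fun Lp_fun_def)
    have "(\<integral>\<theta>. norm (P (cis \<theta>)) powr q \<partial>circ) \<le> (\<integral>\<theta>. ?B (cis \<theta>) \<partial>circ)"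
      by (intro integral_mono iP iB point) simp
    also have "\<dots> = 2 * pi + (\<Sum>j<J. 2 powr (q + 2) * r ^ j * (\<integral>\<theta>. (norm (Pj j (cis \<theta>)))\<^sup>2 \<partial>circ))"
      unfolding Pj_def using Aj measure_circ
      by (simp add: integrable_norm_cpoly_squared Bochner_Integration.integral_sum)
    also have "\<dots> = 2 * pi * (1 + 2 powr (q + 2) * (\<Sum>j<J. r ^ j * (\<Sum>k\<in>Aj j. (norm (\<xi> k))\<^sup>2)))"
      unfolding Pj_def integral_norm_cpoly_squared[OF Aj(1)]
      by (simp add: sum_distrib_left algebra_simps)
    also have "\<dots> \<le> 2 * pi * (1 + 2 powr (q + 2) * (r * (r / (r - 1))))"
    proof -
      \<comment> \<open>Summing over the levels first: a coefficient contributes at those j whose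
        threshold it does not exceed, and the corresponding powers of r form a geometric sum of the
        order of \<open>norm (\<xi> k) powr (p - 2)\<close>.\<close>
      have "(\<Sum>j<J. r ^ j * (\<Sum>k\<in>Aj j. (norm (\<xi> k))\<^sup>2)) =
          (\<Sum>k\<in>A. (norm (\<xi> k))\<^sup>2 * (\<Sum>j\<in>{j\<in>{..<J}. k \<in> Aj j}. r ^ j))"
      proof -
        have "(\<Sum>j<J. r ^ j * (\<Sum>k\<in>Aj j. (norm (\<xi> k))\<^sup>2)) =
            (\<Sum>j<J. \<Sum>k\<in>{k\<in>A. k \<in> Aj j}. (norm (\<xi> k))\<^sup>2 * r ^ j)"
          using Aj(2) by (intro sum.cong refl) (simp add: sum_distrib_left mult.commute Collect_conj_eq Int_absorb1)
        also have "\<dots> = (\<Sum>k\<in>A. \<Sum>j\<in>{j\<in>{..<J}. k \<in> Aj j}. (norm (\<xi> k))\<^sup>2 * r ^ j)"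
          using A by (intro sum.swap_restrict) auto
        finally show ?thesis by (simp add: sum_distrib_left)
      qed
      also have "\<dots> \<le> (\<Sum>k\<in>A. r * (r / (r - 1)) * norm (\<xi> k) powr p)"
      proof (rule sum_mono)
        fix k assume k: "k \<in> A"
        show "(norm (\<xi> k))\<^sup>2 * (\<Sum>j\<in>{j\<in>{..<J}. k \<in> Aj j}. r ^ j) \<le> r * (r / (r - 1)) * norm (\<xi> k) powr p"
        proof (cases "\<xi> k = 0")
          case False
          define x where "x = norm (\<xi> k)"
          have x: "0 < x" using False by (simp add: x_def)
          \<comment> \<open>The inequality \<open>x \<le> a j\<close> is raised to the power
            \<open>p - 1\<close>, where the right-hand side becomes \<open>2 powr (1 - j)\<close>,
            and then to \<open>q - 2\<close>; finally
            \<open>(p - 1) * (q - 2) = 2 - p\<close>.\<close>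
          have "r ^ j \<le> r * x powr (p - 2)" if "j \<in> {j\<in>{..<J}. k \<in> Aj j}" for j
          proof -
            have "x \<le> a j" using that by (simp add: Aj_def x_def)
            then have "x powr (p - 1) \<le> a j powr (p - 1)" using x p by (intro powr_mono2) auto
            also have "a j powr (p - 1) = 2 powr (1 - real j)"
              using pq1 by (simp add: a_def powr_powr mult.assoc mult.commute[of "q - 1"])
            finally have "(x powr (p - 1)) powr (q - 2) \<le> (2 powr (1 - real j)) powr (q - 2)"
              using q by (intro powr_mono2) auto
            then have "x powr (2 - p) \<le> 2 powr ((1 - real j) * (q - 2))"
              by (simp add: powr_powr pq2)
            also have "\<dots> = r / r ^ j"
            proof -
              have "(1 - real j) * (q - 2) = (q - 2) - (q - 2) * real j" by (simp add: algebra_simps)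
              then show ?thesis by (simp only: powr_diff[of 2 "q - 2"] r_power) (simp only: r_def)
            qed
            finally have "r ^ j * x powr (2 - p) \<le> r" using r by (simp add: field_simps)
            moreover have "x powr (p - 2) * x powr (2 - p) = 1" using x by (simp flip: powr_add)
            ultimately show ?thesis
              using mult_right_mono[of "r ^ j * x powr (2 - p)" r "x powr (p - 2)"]
              by (simp add: mult.assoc mult.commute[of "x powr (2 - p)"])
          qed
          then have "(\<Sum>j\<in>{j\<in>{..<J}. k \<in> Aj j}. r ^ j) \<le> (r * x powr (p - 2)) * (r / (r - 1))"
            using r by (intro sum_geometric_bounded) auto
          then have "x\<^sup>2 * (\<Sum>j\<in>{j\<in>{..<J}. k \<in> Aj j}. r ^ j) \<le> x\<^sup>2 * ((r * x powr (p - 2)) * (r / (r - 1)))"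
            by (rule mult_left_mono) simp
          also have "\<dots> = r * (r / (r - 1)) * (x powr 2 * x powr (p - 2))"
            using x by simp
          also have "x powr 2 * x powr (p - 2) = x powr p" by (simp flip: powr_add)
          finally show ?thesis by (simp add: x_def)
        qed (use p in simp)
      qed
      also have "\<dots> = r * (r / (r - 1)) * (\<Sum>k\<in>A. norm (\<xi> k) powr p)" by (simp add: sum_distrib_left)
      also have "\<dots> \<le> r * (r / (r - 1)) * 1" using S r by (intro mult_left_mono) auto
      finally show ?thesis by (intro mult_left_mono add_left_mono) simp_all
    qed
    finally show ?thesis by (simp add: P_def C_def)
  qed
  then show ?thesis using C by blast
qed

text \<open>Homogeneity reduces to coefficients of norm 1. For \<open>p = 2\<close> the ratio r of
  the interpolation would be 1 and the geometric sum useless; there Plancherel gives the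
  bound.\<close>

lemma Hausdorff_Young_cpoly:
  assumes p: "1 < p" "p \<le> 2" and pq: "1 / p + 1 / q = 1"
  shows "\<exists>C>0. \<forall>A \<xi>. finite A \<longrightarrow> Lnorm q (cpoly A \<xi>) \<le> C * (\<Sum>k\<in>A. norm (\<xi> k) powr p) powr (1 / p)"
proof (cases "p = 2")
  case True
  then have q: "q = 2" using pq by (simp add: field_simps)
  have "Lnorm q (cpoly A \<xi>) \<le> 1 * (\<Sum>k\<in>A. norm (\<xi> k) powr p) powr (1 / p)" if "finite A" for A \<xi>
    using integral_norm_cpoly_squared[OF that, of \<xi>]
    by (subst Lnorm_le_iff) (auto simp: q True powr_powr sum_nonneg)
  then show ?thesis by (intro exI[of _ 1]) auto
next
  case False
  then have p2: "p < 2" using p by simp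
  have q0: "0 < q" using p pq by (smt (verit) divide_nonpos_nonneg divide_less_eq_1_pos zero_less_divide_1_iff)
  obtain C where C: "0 < C" "\<And>A \<xi>. finite A \<Longrightarrow> (\<Sum>k\<in>A. norm (\<xi> k) powr p) \<le> 1 \<Longrightarrow>
      (\<integral>\<theta>. norm (cpoly A \<xi> (cis \<theta>)) powr q \<partial>circ) \<le> 2 * pi * C"
    using Hausdorff_Young_normalized[OF p(1) p2 pq] by blast
  have "Lnorm q (cpoly A \<xi>) \<le> C powr (1 / q) * (\<Sum>k\<in>A. norm (\<xi> k) powr p) powr (1 / p)"
    if A: "finite A" for A and \<xi> :: "nat \<Rightarrow> complex"
  proof -
    define S where "S = (\<Sum>k\<in>A. norm (\<xi> k) powr p)"
    have S0: "0 \<le> S" by (simp add: S_def sum_nonneg)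
    show ?thesis
    proof (cases "S = 0")
      case True
      then have "\<forall>k\<in>A. \<xi> k = 0"
        using A by (simp add: S_def sum_nonneg_eq_0_iff)
      then have "cpoly A \<xi> = (\<lambda>_. 0)" by (simp add: cpoly_def fun_eq_iff)
      then show ?thesis by (simp add: Lnorm_def)
    next
      case False
      then have Sp: "0 < S" using S0 by simp
      define c where "c = S powr (1 / p)"
      have c: "0 < c" using Sp by (simp add: c_def)
      have cp: "c powr p = S" using Sp p by (simp add: c_def powr_powr)
      let ?\<eta> = "\<lambda>k. \<xi> k / of_real c"
      have "(\<Sum>k\<in>A. norm (?\<eta> k) powr p) = S / c powr p"
        using c by (simp add: S_def norm_divide powr_divide sum_divide_distrib)
      then have "(\<Sum>k\<in>A. norm (?\<eta> k) powr p) \<le> 1" using Sp by (simp add: cp)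
      from C(2)[OF A this] have "Lnorm q (cpoly A ?\<eta>) \<le> C powr (1 / q)"
        using C(1) q0 by (subst Lnorm_le_iff) (auto simp: powr_powr)
      moreover have "cpoly A \<xi> = (\<lambda>z. of_real c * cpoly A ?\<eta> z)"
        using c by (simp add: cpoly_def fun_eq_iff sum_distrib_left)
      moreover have "Lnorm q (\<lambda>z. of_real c * cpoly A ?\<eta> z) = c * Lnorm q (cpoly A ?\<eta>)"
        using q0 c Lp_norm_scale[of q circ "of_real c" "\<lambda>\<theta>. cpoly A ?\<eta> (cis \<theta>)"]
        by (simp add: Lnorm_eq_Lp_norm)
      ultimately show ?thesis
        using c by (simp add: mult.commute mult_left_mono flip: c_def S_def)
    qed
  qed
  then show ?thesis using C(1) by (intro exI[of _ "C powr (1 / q)"]) auto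
qed

lemma Holder_Lnorm:
  assumes p: "1 < p" "1 < q" "1 / p + 1 / q = 1" and f: "Lspace p f" and g: "Lspace q g"
  shows "norm (\<integral>\<theta>. f (cis \<theta>) * g (cis \<theta>) \<partial>circ) \<le> 2 * pi * (Lnorm p f * Lnorm q g)"
proof -
  have "(1 / (2 * pi)) powr (1 / p) * (1 / (2 * pi)) powr (1 / q) = 1 / (2 * pi)"
    using p(3) by (simp flip: powr_add)
  then have "2 * pi * (Lnorm p f * Lnorm q g) =
      Lp_norm p circ (\<lambda>\<theta>. f (cis \<theta>)) * Lp_norm q circ (\<lambda>\<theta>. g (cis \<theta>))"
    using p by (simp add: Lnorm_eq_Lp_norm mult.assoc mult.left_commute[of "Lp_norm p circ (\<lambda>\<theta>. f (cis \<theta>))"])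
  then show ?thesis
    using Holder_inequality(2)[OF p, of circ "\<lambda>\<theta>. f (cis \<theta>)" "\<lambda>\<theta>. g (cis \<theta>)"] f g
    by (simp add: Lspace_iff_Lp_fun)
qed

lemma conjugate_exponent:
  fixes p q :: real
  assumes "1 < p" "1 / p + 1 / q = 1"
  shows "1 < q" and "2 \<le> q \<longleftrightarrow> p \<le> 2" and "(p - 1) * q = p"
proof -
  have "1 / q = (p - 1) / p" using assms by (simp add: diff_divide_distrib)
  then have "1 / (1 / q) = 1 / ((p - 1) / p)" by (rule arg_cong)
  then have q: "q = p / (p - 1)" by simp
  show "1 < q" "2 \<le> q \<longleftrightarrow> p \<le> 2" "(p - 1) * q = p"
    unfolding q using assms(1) by (simp_all add: less_divide_eq le_divide_eq)
qed

lemma fourier_seq_cpoly: "fourier_seq (cpoly {..<n} \<xi>) = truncate n \<xi>"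
  by (simp add: fourier_seq_def truncate_def fcoef_cpoly fun_eq_iff)

lemma Hardy_imp_L1: "\<lbrakk>1 < s; f \<in> Hardy s\<rbrakk> \<Longrightarrow> L1 f"
  using Lspace_imp_L1[of s f] by (simp add: Hardy_def)

lemma Hardy_uniqueness:
  assumes "1 < s" "f \<in> Hardy s" "fourier_seq f = (\<lambda>_. 0)"
  shows "f \<in> null_T"
proof (rule fourier_uniqueness[OF assms(1)])
  show "Lspace s f" using assms(2) by (simp add: Hardy_def)
  fix m
  show "fcoef f m = 0"
  proof (cases "0 \<le> m")
    case True
    then show ?thesis using fun_cong[OF assms(3), of "nat m"] by (simp add: fourier_seq_def)
  next
    case False
    then show ?thesis using assms(2) by (simp add: Hardy_def)
  qed
qed

text \<open>The function is the limit of partial sums along a subsequence so sparse that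
  \<open>Hausdorff_Young_cpoly\<close> makes the blocks in between geometrically small. Coefficients
  and the norm bound pass to the limit.\<close>

lemma Hausdorff_Young_lp:
  assumes p: "1 < p" "p \<le> 2" and pq: "1 / p + 1 / q = 1"
  shows "\<exists>C>0. \<forall>\<xi>\<in>lp p. \<exists>h\<in>Hardy q. fourier_seq h = \<xi> \<and> Lnorm q h \<le> C * lpnorm p \<xi>"
proof -
  have q: "1 < q" by (rule conjugate_exponent[OF p(1) pq])
  interpret H: seminormed_complete "Hardy q" "Lnorm q" by (rule Hardy_seminormed_complete[OF q])
  obtain C where C: "0 < C"
    "\<And>A \<xi>. finite A \<Longrightarrow> Lnorm q (cpoly A \<xi>) \<le> C * (\<Sum>k\<in>A. norm (\<xi> k) powr p) powr (1 / p)"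
    using Hausdorff_Young_cpoly[OF p pq] by blast
  have "\<exists>h\<in>Hardy q. fourier_seq h = \<xi> \<and> Lnorm q h \<le> C * lpnorm p \<xi>" if x: "\<xi> \<in> lp p" for \<xi>
  proof -
    have sm: "summable (\<lambda>k. norm (\<xi> k) powr p)" using x by (simp add: lp_def)
    have "\<exists>N. \<forall>m\<ge>N. \<forall>n. C * (\<Sum>k=m..<n. norm (\<xi> k) powr p) powr (1 / p) \<le> (1/2)^i" for i :: nat
    proof -
      define e where "e = ((1/2)^i / C) powr p"
      have e: "0 < e" using C by (simp add: e_def)
      have ep: "C * e powr (1 / p) = (1/2)^i" using C p by (simp add: e_def powr_powr)
      obtain N where N: "\<And>m n. N \<le> m \<Longrightarrow> norm (\<Sum>k=m..<n. norm (\<xi> k) powr p) < e"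
        using sm e unfolding summable_Cauchy by blast
      have "C * (\<Sum>k=m..<n. norm (\<xi> k) powr p) powr (1 / p) \<le> C * e powr (1 / p)" if "N \<le> m" for m n
        using N[OF that, of n] C p by (intro mult_left_mono powr_mono2) (auto simp: sum_nonneg)
      then show ?thesis unfolding ep by blast
    qed
    then obtain N0 where N0: "\<And>i m n. N0 i \<le> m \<Longrightarrow> C * (\<Sum>k=m..<n. norm (\<xi> k) powr p) powr (1 / p) \<le> (1/2)^i"
      by metis
    \<comment> \<open>One formula for three demands: monotone, at least \<open>N0 i\<close>, and
      larger than i, so that every coefficient is eventually included.\<close>
    define N where "N i = (\<Sum>j\<le>i. Suc (N0 j))" for i
    have N_ge: "N0 i \<le> N i" for i
      using member_le_sum[of i "{..i}" "\<lambda>j. Suc (N0 j)"] by (simp add: N_def)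
    have N_mono: "N i \<le> N (Suc i)" for i by (simp add: N_def)
    have N_big: "i < N i" for i
      using sum_mono[of "{..i}" "\<lambda>_. 1::nat" "\<lambda>j. Suc (N0 j)"] by (simp add: N_def)
    define y where "y i = cpoly {..<N i} \<xi>" for i
    have y: "y i \<in> Hardy q" for i unfolding y_def using q by (intro cpoly_Hardy) auto
    have "Lnorm q (\<lambda>z. y (Suc i) z - y i z) \<le> (1/2)^i" for i
    proof -
      have "(\<lambda>z. y (Suc i) z - y i z) = cpoly {N i..<N (Suc i)} \<xi>"
        using N_mono[of i] by (simp add: y_def cpoly_def fun_eq_iff lessThan_atLeast0 sum_diff_nat_ivl)
      then show ?thesis
        using C(2)[of "{N i..<N (Suc i)}" \<xi>] N0[OF N_ge, of i "N (Suc i)"] by simp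
    qed
    from H.complete_fast[of y, OF y this] obtain h where h: "h \<in> Hardy q"
      and lim: "(\<lambda>i. Lnorm q (\<lambda>z. h z - y i z)) \<longlonglongrightarrow> 0" by blast
    have "fcoef h (int k) = \<xi> k" for k
    proof -
      have "norm (fcoef h (int k) - \<xi> k) \<le> Lnorm q (\<lambda>z. h z - y i z)" if "k \<le> i" for i
      proof -
        have "k < N i" using N_big[of i] that by simp
        then have "fcoef (y i) (int k) = \<xi> k" by (simp add: y_def fcoef_cpoly)
        then have "fcoef (\<lambda>z. h z - y i z) (int k) = fcoef h (int k) - \<xi> k"
          using fcoef_diff[OF Hardy_imp_L1[OF q h] Hardy_imp_L1[OF q y]] by simp
        moreover have "Lspace q (\<lambda>z. h z - y i z)"
          using H.diff_mem[OF h y] by (simp add: Hardy_def)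
        ultimately show ?thesis using fcoef_le_Lnorm[OF q, of "\<lambda>z. h z - y i z" "int k"] by simp
      qed
      then have "norm (fcoef h (int k) - \<xi> k) \<le> 0" by (intro LIMSEQ_le_const[OF lim]) blast
      then show ?thesis by simp
    qed
    then have F: "fourier_seq h = \<xi>" by (simp add: fourier_seq_def)
    have "Lnorm q h \<le> Lnorm q (\<lambda>z. h z - y i z) + C * lpnorm p \<xi>" for i
    proof -
      have "Lnorm q (y i) \<le> C * (\<Sum>k<N i. norm (\<xi> k) powr p) powr (1 / p)"
        unfolding y_def by (rule C(2)) simp
      also have "\<dots> \<le> C * lpnorm p \<xi>"
        unfolding lpnorm_def using C p sum_le_suminf[OF sm, of "{..<N i}"]
        by (intro mult_left_mono powr_mono2) (auto simp: sum_nonneg)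
      finally show ?thesis using H.nrm_le_diff[OF h y, of i] by linarith
    qed
    moreover have "(\<lambda>i. Lnorm q (\<lambda>z. h z - y i z) + C * lpnorm p \<xi>) \<longlonglongrightarrow> 0 + C * lpnorm p \<xi>"
      by (intro tendsto_add tendsto_const lim)
    ultimately have "Lnorm q h \<le> 0 + C * lpnorm p \<xi>" by (intro LIMSEQ_le_const) auto
    then show ?thesis using h F by auto
  qed
  then show ?thesis using C(1) by blast
qed

text \<open>Duality: f is paired with a polynomial whose coefficients are extremal for Hoelder
  between l^p and l^q, and \<open>Hausdorff_Young_cpoly\<close> with p and q exchanged bounds that
  polynomial.\<close>

lemma Hausdorff_Young_dual:
  assumes q: "1 < q" "q \<le> 2" and pq: "1 / p + 1 / q = 1"
  shows "\<exists>C>0. \<forall>f. Lspace q f \<longrightarrow> fourier_seq f \<in> lp p \<and> lpnorm p (fourier_seq f) \<le> C * Lnorm q f"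
proof -
  have qp: "1 / q + 1 / p = 1" using pq by simp
  have p: "2 \<le> p" using conjugate_exponent[OF q(1) qp] q(2) by simp
  have pq': "(p - 1) * q = p" using conjugate_exponent(3)[of p q] p pq by simp
  obtain C where C: "0 < C"
    "\<And>A \<xi>. finite A \<Longrightarrow> Lnorm p (cpoly A \<xi>) \<le> C * (\<Sum>k\<in>A. norm (\<xi> k) powr q) powr (1 / q)"
    using Hausdorff_Young_cpoly[of q p] q pq by (auto simp: add.commute)
  have bound: "(\<Sum>k<n. norm (fourier_seq f k) powr p) \<le> (C * Lnorm q f) powr p"
    if f: "Lspace q f" for f n
  proof -
    define S where "S = (\<Sum>k<n. norm (fourier_seq f k) powr p)"
    have S0: "0 \<le> S" by (simp add: S_def sum_nonneg)
    \<comment> \<open>The extremal sequence: its pairing with the coefficients of f is S, and since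
      \<open>(p - 1) * q = p\<close> its q-th powers also sum to S.\<close>
    define \<eta> where "\<eta> k = fourier_seq f k * of_real (norm (fourier_seq f k) powr (p - 2))" for k
    have norm_\<eta>: "norm (\<eta> k) = norm (fourier_seq f k) powr (p - 1)" for k
    proof (cases "fourier_seq f k = 0")
      case False
      then have "norm (fourier_seq f k) powr 1 * norm (fourier_seq f k) powr (p - 2) =
          norm (fourier_seq f k) powr (p - 1)"
        by (simp only: powr_add[symmetric]) simp
      then show ?thesis using False by (simp add: \<eta>_def norm_mult)
    qed (use p in \<open>simp add: \<eta>_def\<close>)
    have pair: "cnj (\<eta> k) * fcoef f (int k) = of_real (norm (fourier_seq f k) powr p)" for k
    proof (cases "fourier_seq f k = 0")
      case False
      let ?w = "fourier_seq f k"
      have "cnj (\<eta> k) * fcoef f (int k) = (?w * cnj ?w) * of_real (norm ?w powr (p - 2))"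
        by (simp add: \<eta>_def fourier_seq_def mult_ac)
      also have "?w * cnj ?w = of_real (norm ?w powr 2)"
        using False by (simp add: complex_norm_square[symmetric])
      also have "\<dots> * of_real (norm ?w powr (p - 2)) = of_real (norm ?w powr 2 * norm ?w powr (p - 2))"
        by simp
      also have "norm ?w powr 2 * norm ?w powr (p - 2) = norm ?w powr p"
        by (simp only: powr_add[symmetric]) simp
      finally show ?thesis .
    qed (use p in \<open>simp add: fourier_seq_def\<close>)
    have P: "cpoly {..<n} \<eta> \<in> Hardy p" using p by (intro cpoly_Hardy) auto
    have cP: "Lspace p (\<lambda>z. cnj (cpoly {..<n} \<eta> z))"
    proof -
      have "Lp_fun p circ (\<lambda>\<theta>. cpoly {..<n} \<eta> (cis \<theta>))" using P by (simp add: Hardy_def Lspace_iff_Lp_fun)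
      then have "integrable circ (\<lambda>\<theta>. norm (cpoly {..<n} \<eta> (cis \<theta>)) powr p)"
        and [measurable]: "(\<lambda>\<theta>. cpoly {..<n} \<eta> (cis \<theta>)) \<in> borel_measurable circ"
        by (simp_all add: Lp_fun_def)
      moreover have "(\<lambda>\<theta>. cnj (cpoly {..<n} \<eta> (cis \<theta>))) \<in> borel_measurable circ"
        by (intro borel_measurable_continuous_on[of cnj] continuous_intros) measurable
      ultimately show ?thesis by (simp add: Lspace_iff_Lp_fun Lp_fun_def)
    qed
    have f1: "L1 f" using Lspace_imp_L1[OF _ f] q by simp
    have "2 * pi * S = norm (\<integral>\<theta>. f (cis \<theta>) * cnj (cpoly {..<n} \<eta> (cis \<theta>)) \<partial>circ)"
    proof -
      have "(\<integral>\<theta>. f (cis \<theta>) * cnj (cpoly {..<n} \<eta> (cis \<theta>)) \<partial>circ) = of_real (2 * pi * S)"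
        by (simp add: integral_mult_cnj_cpoly[OF f1] pair S_def)
      then show ?thesis using S0 by (simp only: norm_of_real) simp
    qed
    also have "\<dots> \<le> 2 * pi * (Lnorm q f * Lnorm p (\<lambda>z. cnj (cpoly {..<n} \<eta> z)))"
      using Holder_Lnorm[of q p f "\<lambda>z. cnj (cpoly {..<n} \<eta> z)"] q p pq f cP by (simp add: add.commute)
    also have "Lnorm p (\<lambda>z. cnj (cpoly {..<n} \<eta> z)) = Lnorm p (cpoly {..<n} \<eta>)"
      by (simp add: Lnorm_def)
    finally have "S \<le> Lnorm q f * Lnorm p (cpoly {..<n} \<eta>)" by simp
    also have "\<dots> \<le> Lnorm q f * (C * (\<Sum>k<n. norm (\<eta> k) powr q) powr (1 / q))"
      using C(2)[of "{..<n}" \<eta>] by (intro mult_left_mono) (auto simp: Lnorm_nonneg)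
    also have "(\<Sum>k<n. norm (\<eta> k) powr q) = S"
      by (simp add: norm_\<eta> powr_powr pq' S_def)
    finally have le: "S \<le> (C * Lnorm q f) * S powr (1 / q)" by (simp add: mult_ac)
    have "S \<le> (C * Lnorm q f) powr p"
    proof (cases "S = 0")
      case False
      then have Sp: "0 < S" using S0 by simp
      \<comment> \<open>Since S appears on both sides of \<open>le\<close>, dividing by
        \<open>S powr (1 / q)\<close> leaves the desired norm. S is a finite sum, so the division is
        legitimate.\<close>
      have "S powr (1 / p) = S / S powr (1 / q)"
      proof -
        have "1 / p = 1 - 1 / q" using pq by simp
        then show ?thesis using Sp by (simp only: powr_diff) simp
      qed
      also have "\<dots> \<le> C * Lnorm q f" using le Sp by (simp add: divide_le_eq)
      finally have "(S powr (1 / p)) powr p \<le> (C * Lnorm q f) powr p"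
        using p by (intro powr_mono2) auto
      then show ?thesis using Sp p by (simp add: powr_powr)
    qed simp
    then show ?thesis by (simp add: S_def)
  qed
  have "fourier_seq f \<in> lp p \<and> lpnorm p (fourier_seq f) \<le> C * Lnorm q f" if f: "Lspace q f" for f
  proof -
    have sm: "summable (\<lambda>k. norm (fourier_seq f k) powr p)"
      using bound[OF f] by (intro summableI_nonneg_bounded) auto
    have "(\<Sum>k. norm (fourier_seq f k) powr p) \<le> (C * Lnorm q f) powr p"
      using bound[OF f] by (intro suminf_le_const sm) auto
    then have "lpnorm p (fourier_seq f) \<le> ((C * Lnorm q f) powr p) powr (1 / p)"
      unfolding lpnorm_def using p sm by (intro powr_mono2) (auto simp: suminf_nonneg)
    also have "\<dots> = C * Lnorm q f" using p C(1) Lnorm_nonneg[of q f] by (simp add: powr_powr)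
    finally show ?thesis using sm by (simp add: lp_def)
  qed
  then show ?thesis using C(1) by blast
qed

section \<open>Multipliers and the operators on polynomials\<close>

lemma Linf_iff:
  "Linf a \<longleftrightarrow> (\<lambda>\<theta>. a (cis \<theta>)) \<in> borel_measurable circ \<and> (\<exists>M. AE \<theta> in circ. norm (a (cis \<theta>)) \<le> M)"
  by (simp add: Linf_def set_borel_measurable_def borel_measurable_restrict_space_iff AE_restrict_space_iff)

lemma Linf_imp_Lspace:
  assumes "Linf a" "0 < s"
  shows "Lspace s a"
proof -
  obtain M where "AE \<theta> in circ. norm (a (cis \<theta>)) \<le> M" using assms by (auto simp: Linf_iff)
  then show ?thesis using Lspace_bounded[of a M s] assms by (simp add: Linf_iff)
qed

lemma fcoef_mult_powi: "fcoef (\<lambda>z. a z * z powi m) n = fcoef a (n - m)"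
  by (simp add: fcoef_eq_integral cis_power_int mult.assoc cis_mult algebra_simps)

lemma L1_mult_powi: "L1 a \<Longrightarrow> L1 (\<lambda>z. a z * z powi m)"
  using L1_mult_cis[of a "- of_int m"] by (simp add: L1_def cis_power_int)

lemma fcoef_mult_trig_sum:
  assumes "L1 a"
  shows "fcoef (\<lambda>z. a z * (\<Sum>k\<in>A. \<xi> k * z powi e k)) n = (\<Sum>k\<in>A. fcoef a (n - e k) * \<xi> k)"
proof -
  have "fcoef (\<lambda>z. a z * (\<Sum>k\<in>A. \<xi> k * z powi e k)) n = fcoef (\<lambda>z. \<Sum>k\<in>A. \<xi> k * (a z * z powi e k)) n"
    by (simp add: sum_distrib_left mult.left_commute)
  also have "\<dots> = (\<Sum>k\<in>A. \<xi> k * fcoef a (n - e k))"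
    by (simp only: fcoef_sum L1_scale L1_mult_powi assms fcoef_scale fcoef_mult_powi)
  finally show ?thesis by (simp add: mult.commute)
qed

lemma support_sum_subset:
  fixes \<xi> :: "'k \<Rightarrow> 'a::comm_monoid_add"
  shows "{m. (\<Sum>k\<in>A. if e k = m then \<xi> k else 0) \<noteq> 0} \<subseteq> e ` A"
proof
  fix m assume "m \<in> {m. (\<Sum>k\<in>A. if e k = m then \<xi> k else 0) \<noteq> 0}"
  moreover have "(\<Sum>k\<in>A. if e k = m then \<xi> k else 0) = 0" if "m \<notin> e ` A"
    using that by (intro sum.neutral) auto
  ultimately show "m \<in> e ` A" by blast
qed

text \<open>The right-hand side is that of \<open>fcoef_mult_trig_sum\<close>: the Laurent operator
  is multiplication by a, seen on coefficients. The Toeplitz part takes k for \<open>e k\<close>,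
  the Hankel part \<open>- 1 - k\<close>.\<close>

lemma laurent_sum:
  assumes "finite A"
  shows "laurent a (\<lambda>m. \<Sum>k\<in>A. if e k = m then \<xi> k else 0) j = (\<Sum>k\<in>A. fcoef a (j - e k) * \<xi> k)"
proof -
  let ?x = "\<lambda>m. \<Sum>k\<in>A. if e k = m then \<xi> k else 0"
  have "{m. ?x m \<noteq> 0} \<subseteq> e ` A" by (rule support_sum_subset)
  then have "laurent a ?x j = (\<Sum>m\<in>e ` A. fcoef a (j - m) * ?x m)"
    unfolding laurent_def using assms by (intro sum.mono_neutral_left) auto
  also have "\<dots> = (\<Sum>m\<in>e ` A. \<Sum>k\<in>A. if e k = m then fcoef a (j - m) * \<xi> k else 0)"
    unfolding sum_distrib_left by (intro sum.cong refl) simp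
  also have "\<dots> = (\<Sum>k\<in>A. \<Sum>m\<in>e ` A. if e k = m then fcoef a (j - m) * \<xi> k else 0)"
    by (rule sum.swap)
  also have "\<dots> = (\<Sum>k\<in>A. fcoef a (j - e k) * \<xi> k)"
    using assms by (intro sum.cong refl) simp
  finally show ?thesis .
qed

lemma lpZ_imp_lp:
  assumes "lpZ p x"
  shows "(\<lambda>n. x (int n)) \<in> lp p"
proof -
  have "(\<lambda>k. norm (x k) powr p) summable_on range int"
    using assms unfolding lpZ_def by (rule summable_on_subset_banach) simp
  then have "(\<lambda>n. norm (x (int n)) powr p) summable_on UNIV"
    by (subst (asm) summable_on_reindex) (auto simp: o_def)
  then show ?thesis
    unfolding lp_def by (simp add: summable_on_imp_summable)
qed

text \<open>The Riesz projection exists here without M. Riesz' theorem: the coefficients lie in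
  \<^term>\<open>lp p\<close> because the symbol is a multiplier if \<^term>\<open>p \<le> 2\<close>, and in \<^term>\<open>lp 2\<close> by Bessel's
  inequality otherwise.\<close>

lemma riesz_proj_multiplier:
  assumes p: "1 < p" and pq: "1 / p + 1 / q = 1" and q: "1 < q" and a: "multiplier p a"
    and A: "finite A" and g: "\<And>j. fcoef g j = (\<Sum>k\<in>A. fcoef a (j - e k) * \<xi> k)"
  shows "Lspace q (riesz_proj q g)"
    and "fcoef (riesz_proj q g) n = (if 0 \<le> n then fcoef g n else 0)"
proof -
  have lift: "\<exists>h. Lspace s h \<and> (\<forall>n. fcoef h n = (if 0 \<le> n then fcoef g n else 0))"
    if "h \<in> Hardy s" "fourier_seq h = (\<lambda>n. fcoef g (int n))" for h s
  proof -
    have "fcoef h n = (if 0 \<le> n then fcoef g n else 0)" for n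
      using that(1) fun_cong[OF that(2), of "nat n"]
      by (cases "0 \<le> n") (simp_all add: Hardy_def fourier_seq_def)
    then show ?thesis using that(1) by (auto simp: Hardy_def)
  qed
  have "\<exists>h. Lspace q h \<and> (\<forall>n. fcoef h n = (if 0 \<le> n then fcoef g n else 0))"
  proof (cases "p \<le> 2")
    case True
    let ?x = "\<lambda>m. \<Sum>k\<in>A. if e k = m then \<xi> k else 0"
    have *: "lpZ p (laurent a x)" if "finite {k. x k \<noteq> 0}" for x
      using a that unfolding multiplier_def by blast
    have "lpZ p (laurent a ?x)"
      by (rule *) (rule finite_subset[OF support_sum_subset finite_imageI[OF A]])
    then have "(\<lambda>n. fcoef g (int n)) \<in> lp p"
      using lpZ_imp_lp[of p "laurent a ?x"] by (simp add: laurent_sum[OF A] g)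
    then obtain h where "h \<in> Hardy q" "fourier_seq h = (\<lambda>n. fcoef g (int n))"
      using Hausdorff_Young_lp[OF p True pq] by blast
    then show ?thesis by (rule lift)
  next
    case False
    have q2: "q \<le> 2" using conjugate_exponent(2)[OF p pq] False by simp
    \<comment> \<open>Of g only the coefficients are known. This bounded function has the same ones,
      and Bessel's inequality applies to it.\<close>
    define g' where "g' = (\<lambda>z. a z * (\<Sum>k\<in>A. \<xi> k * z powi e k))"
    have Linf: "Linf a" using a by (simp add: multiplier_def)
    have a1: "L1 a" using Lspace_imp_L1[OF _ Linf_imp_Lspace[OF Linf], of 1] by simp
    obtain M where M: "AE \<theta> in circ. norm (a (cis \<theta>)) \<le> M" using Linf by (auto simp: Linf_iff)
    have [measurable]: "(\<lambda>\<theta>. a (cis \<theta>)) \<in> borel_measurable circ" using Linf by (simp add: Linf_iff)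
    have "Lspace 2 g'"
    proof (rule Lspace_bounded)
      show "(\<lambda>\<theta>. g' (cis \<theta>)) \<in> borel_measurable circ" unfolding g'_def by measurable
      show "AE \<theta> in circ. norm (g' (cis \<theta>)) \<le> M * (\<Sum>k\<in>A. norm (\<xi> k))"
        using M
      proof (rule eventually_mono)
        fix \<theta> assume th: "norm (a (cis \<theta>)) \<le> M"
        have "norm (\<Sum>k\<in>A. \<xi> k * cis \<theta> powi e k) \<le> (\<Sum>k\<in>A. norm (\<xi> k))"
          by (intro sum_norm_le) (simp add: norm_mult norm_power_int)
        then show "norm (g' (cis \<theta>)) \<le> M * (\<Sum>k\<in>A. norm (\<xi> k))"
          unfolding g'_def norm_mult using th by (intro mult_mono) (auto intro: order_trans[OF norm_ge_zero])
      qed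
    qed simp
    then have "fourier_seq g' \<in> lp 2" using Hausdorff_Young_dual[of 2 2] by auto
    moreover have "fourier_seq g' = (\<lambda>n. fcoef g (int n))"
      by (simp add: fourier_seq_def g'_def fcoef_mult_trig_sum[OF a1] g)
    ultimately obtain h where "h \<in> Hardy 2" "fourier_seq h = (\<lambda>n. fcoef g (int n))"
      using Hausdorff_Young_lp[of 2 2] by auto
    from lift[OF this] obtain h where "Lspace 2 h" "\<forall>n. fcoef h n = (if 0 \<le> n then fcoef g n else 0)"
      by blast
    \<comment> \<open>As \<open>q \<le> 2\<close> and the circle has finite measure, a square
      integrable projection is good enough.\<close>
    then show ?thesis using Lspace_mono[of q 2 h] q q2 by auto
  qed
  from someI_ex[OF this]
  show "Lspace q (riesz_proj q g)" "fcoef (riesz_proj q g) n = (if 0 \<le> n then fcoef g n else 0)"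
    unfolding riesz_proj_def by auto
qed

text \<open>By completeness of the measure the difference is measurable, so the two integrands are
  both measurable or both not. In the second case both integrals are 0 by convention.\<close>

lemma fcoef_cong_null:
  assumes "(\<lambda>z. f z - g z) \<in> null_T"
  shows "fcoef f n = fcoef g n"
proof -
  have ae: "AE \<theta> in circ. f (cis \<theta>) - g (cis \<theta>) = 0" using assms by (simp add: null_T_iff)
  have m: "(\<lambda>\<theta>. f (cis \<theta>) - g (cis \<theta>)) \<in> borel_measurable circ" by (rule null_T_measurable[OF assms])
  let ?f = "\<lambda>\<theta>. f (cis \<theta>) * cis (- (of_int n * \<theta>))" and ?g = "\<lambda>\<theta>. g (cis \<theta>) * cis (- (of_int n * \<theta>))"
  have d: "(\<lambda>\<theta>. ?f \<theta> - ?g \<theta>) = (\<lambda>\<theta>. (f (cis \<theta>) - g (cis \<theta>)) * cis (- (of_int n * \<theta>)))"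
    by (simp add: fun_eq_iff left_diff_distrib)
  have md: "(\<lambda>\<theta>. ?f \<theta> - ?g \<theta>) \<in> borel_measurable circ"
    unfolding d using m by measurable
  have ae': "AE \<theta> in circ. ?f \<theta> = ?g \<theta>" using ae by (rule eventually_mono) simp
  have "integral\<^sup>L circ ?f = integral\<^sup>L circ ?g"
  proof (cases "?f \<in> borel_measurable circ")
    case True
    then have "(\<lambda>\<theta>. ?f \<theta> - (?f \<theta> - ?g \<theta>)) \<in> borel_measurable circ"
      using md by (rule borel_measurable_diff)
    then have "?g \<in> borel_measurable circ" by simp
    with True show ?thesis using ae' by (rule integral_cong_AE)
  next
    case False
    have "?g \<notin> borel_measurable circ"
    proof
      assume "?g \<in> borel_measurable circ"
      then have "(\<lambda>\<theta>. ?g \<theta> + (?f \<theta> - ?g \<theta>)) \<in> borel_measurable circ"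
        using md by (rule borel_measurable_add)
      then show False using False by simp
    qed
    then have "\<not> integrable circ ?f" "\<not> integrable circ ?g"
      using False borel_measurable_integrable[of circ ?f] borel_measurable_integrable[of circ ?g] by blast+
    then show ?thesis by (simp add: not_integrable_integral_eq)
  qed
  then show ?thesis by (simp add: fcoef_eq_integral)
qed

text \<open>On the circle the flip sends \<open>z ^ k\<close> to \<open>z powi (- 1 - k)\<close>, so
  the flipped polynomial has negative frequencies only and Q leaves it unchanged up to a null
  function. Multiplication by a symbol shifts indices, and all series are finite.\<close>

lemma fourier_seq_TH_Hardy_cpoly:
  assumes p: "1 < p" and pq: "1 / p + 1 / q = 1" and q: "1 < q"
    and a: "multiplier p a" and b: "multiplier p b"
  shows "fourier_seq (TH_Hardy q a b (cpoly {..<n} \<xi>)) = TH_lp a b (truncate n \<xi>)"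
proof
  fix j
  let ?f = "cpoly {..<n} \<xi>"
  have L1: "L1 c" if "multiplier p c" for c
    using Lspace_imp_L1[OF _ Linf_imp_Lspace, of 1 c] that by (simp add: multiplier_def)
  have f: "?f z = (\<Sum>k<n. \<xi> k * z powi int k)" for z by (simp add: cpoly_def)
  have c1: "fcoef (\<lambda>z. a z * ?f z) m = (\<Sum>k<n. fcoef a (m - int k) * \<xi> k)" for m
    unfolding f by (rule fcoef_mult_trig_sum[OF L1[OF a]])
  note r1 = riesz_proj_multiplier[OF p pq q a finite_lessThan c1]
  have J: "flipJ ?f z = (\<Sum>k<n. \<xi> k * z powi (- 1 - int k))" if "norm z = 1" for z
  proof -
    have "z powi (- 1 - int k) = inverse z * inverse z ^ k" for k
    proof -
      have "z powi (- 1 - int k) = z powi (- int (Suc k))" by simp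
      then show ?thesis by (simp only: power_int_minus power_int_of_nat) (simp add: power_inverse)
    qed
    then show ?thesis
      by (simp add: flipJ_def cpoly_def sum_distrib_left mult.left_commute)
  qed
  have cJ: "fcoef (flipJ ?f) m = (\<Sum>k<n. if m = - 1 - int k then \<xi> k else 0)" for m
  proof -
    have "fcoef (flipJ ?f) m = fcoef (\<lambda>z. \<Sum>k<n. \<xi> k * z powi (- 1 - int k)) m"
      by (rule fcoef_cong_circle) (rule J)
    also have "\<dots> = (\<Sum>k<n. \<xi> k * fcoef (\<lambda>z. z powi (- 1 - int k)) m)"
      by (simp only: fcoef_sum L1_scale L1_powi fcoef_scale)
    finally show ?thesis by (simp add: fcoef_powi if_distrib eq_commute cong: if_cong)
  qed
  \<comment> \<open>Its coefficients all vanish, but \<open>riesz_proj\<close> is a choice, so g0 is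
    merely null and need not be the zero function.\<close>
  define g0 where "g0 = riesz_proj q (flipJ ?f)"
  have g0: "g0 \<in> null_T"
  proof -
    have cz: "fcoef (flipJ ?f) m = 0" if "0 \<le> m" for m
      unfolding cJ using that by (intro sum.neutral) auto
    have "Lspace q (\<lambda>_. 0)" by (simp add: Lspace_iff_Lp_fun Lp_fun_zero)
    then have "\<exists>h. Lspace q h \<and> (\<forall>n. fcoef h n = (if 0 \<le> n then fcoef (flipJ ?f) n else 0))"
      using cz by (intro exI[of _ "\<lambda>_. 0"]) simp
    from someI_ex[OF this] have "Lspace q g0" "\<forall>n. fcoef g0 n = (if 0 \<le> n then fcoef (flipJ ?f) n else 0)"
      unfolding g0_def riesz_proj_def by auto
    then show ?thesis using cz by (intro fourier_uniqueness[OF q]) auto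
  qed
  \<comment> \<open>The index \<open>m - (- 1 - k)\<close> is the Hankel index
    \<open>m + k + 1\<close>; the shift by one stems from the factor \<open>inverse t\<close> in
    \<open>flipJ\<close>.\<close>
  have c2: "fcoef (\<lambda>z. b z * (flipJ ?f z - g0 z)) m = (\<Sum>k<n. fcoef b (m - (- 1 - int k)) * \<xi> k)" for m
  proof -
    have "AE \<theta> in circ. g0 (cis \<theta>) = 0" using g0 by (simp add: null_T_iff)
    then have "AE \<theta> in circ. b (cis \<theta>) * (flipJ ?f (cis \<theta>) - g0 (cis \<theta>))
        - b (cis \<theta>) * (\<Sum>k<n. \<xi> k * cis \<theta> powi (- 1 - int k)) = 0"
      by (rule eventually_mono) (simp add: J)
    then have "(\<lambda>z. b z * (flipJ ?f z - g0 z) - b z * (\<Sum>k<n. \<xi> k * z powi (- 1 - int k))) \<in> null_T"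
      by (simp add: null_T_iff)
    from fcoef_cong_null[OF this] show ?thesis
      using fcoef_mult_trig_sum[OF L1[OF b], where A = "{..<n}" and \<xi> = \<xi> and e = "\<lambda>k. - 1 - int k"] by simp
  qed
  note r2 = riesz_proj_multiplier[OF p pq q b finite_lessThan c2]
  have "fcoef (TH_Hardy q a b ?f) (int j) =
      fcoef (riesz_proj q (\<lambda>z. a z * ?f z)) (int j) +
      fcoef (riesz_proj q (\<lambda>z. b z * (flipJ ?f z - g0 z))) (int j)"
    unfolding TH_Hardy_def g0_def[symmetric]
    using q by (intro fcoef_add Lspace_imp_L1[of q] r1 r2) auto
  also have "\<dots> = (\<Sum>k<n. fcoef a (int j - int k) * \<xi> k) + (\<Sum>k<n. fcoef b (int j + int k + 1) * \<xi> k)"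
    unfolding r1(2) r2(2) c1 c2 by (simp add: algebra_simps)
  also have "(\<Sum>k<n. fcoef a (int j - int k) * \<xi> k) = toeplitz_lp a (truncate n \<xi>) j"
    unfolding toeplitz_lp_def
    by (subst suminf_finite[of "{..<n}"]) (auto simp: truncate_def)
  also have "(\<Sum>k<n. fcoef b (int j + int k + 1) * \<xi> k) = hankel_lp b (truncate n \<xi>) j"
    unfolding hankel_lp_def
    by (subst suminf_finite[of "{..<n}"]) (auto simp: truncate_def)
  finally show "fourier_seq (TH_Hardy q a b ?f) j = TH_lp a b (truncate n \<xi>) j"
    by (simp add: fourier_seq_def TH_lp_def)
qed

section \<open>The Fredholm pair of a Toeplitz plus Hankel operator\<close>

lemma fourier_seq_add: "\<lbrakk>L1 f; L1 g\<rbrakk> \<Longrightarrow> fourier_seq (\<lambda>z. f z + g z) = (\<lambda>n. fourier_seq f n + fourier_seq g n)"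
  by (simp add: fourier_seq_def fcoef_add)

lemma fourier_seq_diff: "\<lbrakk>L1 f; L1 g\<rbrakk> \<Longrightarrow> fourier_seq (\<lambda>z. f z - g z) = (\<lambda>n. fourier_seq f n - fourier_seq g n)"
  by (simp add: fourier_seq_def fcoef_diff)

lemma fourier_seq_scale: "fourier_seq (\<lambda>z. c * f z) = (\<lambda>n. c * fourier_seq f n)"
  by (simp add: fourier_seq_def fcoef_scale)

lemma fourier_seq_null_T: "f \<in> null_T \<Longrightarrow> fourier_seq f = (\<lambda>_. 0)"
  by (simp add: fourier_seq_def fcoef_null_T)

text \<open>Here \<open>q \<le> 2\<close>, so the Fourier transform is bounded by the dual form of
  Hausdorff-Young. Its range is dense because truncated sequences are Fourier sequences of
  polynomials.\<close>

lemma fredholm_pair_fourier_seq: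
  assumes p: "1 < p" and pq: "1 / p + 1 / q = 1" and L: "class_L p q a b" and p2: "2 \<le> p"
  shows "fredholm_pair (Hardy q) (Lnorm q) (lp p) (lpnorm p) fourier_seq
    (TH_Hardy q a b) (TH_lp a b) {cpoly {..<n} \<xi> | n \<xi>. True}"
proof -
  have q: "1 < q" by (rule conjugate_exponent[OF p pq])
  have qp: "1 / q + 1 / p = 1" using pq by simp
  have q2: "q \<le> 2" using conjugate_exponent(2)[OF q qp] p2 by simp
  have m: "multiplier p a" "multiplier p b" using L by (simp_all add: class_L_def)
  interpret X: seminormed_complete "Hardy q" "Lnorm q" by (rule Hardy_seminormed_complete[OF q])
  interpret Y: seminormed_complete "lp p" "lpnorm p" by (rule lp_seminormed_complete) (use p in simp)
  have XN: "X.null = null_T" by (rule Hardy_null[OF q])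
  have YN: "Y.null = {\<lambda>_. 0}" by (rule lp_null) (use p in simp)
  note L1 = Hardy_imp_L1[OF q]
  obtain C where C: "0 < C"
    "\<And>f. Lspace q f \<Longrightarrow> fourier_seq f \<in> lp p \<and> lpnorm p (fourier_seq f) \<le> C * Lnorm q f"
    using Hausdorff_Young_dual[OF q q2 pq] by blast
  have CH: "fourier_seq f \<in> lp p" "lpnorm p (fourier_seq f) \<le> C * Lnorm q f" if "f \<in> Hardy q" for f
    using C(2)[of f] that by (simp_all add: Hardy_def)
  show ?thesis
  proof
    show "fourier_seq x \<in> lp p" if "x \<in> Hardy q" for x by (rule CH(1)[OF that])
    show "(\<lambda>t. fourier_seq (\<lambda>s. x s + y s) t - fourier_seq x t - fourier_seq y t) \<in> Y.null"
      if "x \<in> Hardy q" "y \<in> Hardy q" for x y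
      using fourier_seq_add[OF L1[OF that(1)] L1[OF that(2)]] by (simp add: YN)
    show "(\<lambda>t. fourier_seq (\<lambda>s. c * x s) t - c * fourier_seq x t) \<in> Y.null" for x c
      by (simp add: YN fourier_seq_scale)
    show "\<exists>C. \<forall>x\<in>Hardy q. lpnorm p (fourier_seq x) \<le> C * Lnorm q x" using CH(2) by blast
    show "fredholm_op (Hardy q) X.null (Lnorm q) (TH_Hardy q a b)"
      "fredholm_op (lp p) Y.null (lpnorm p) (TH_lp a b)"
      "fredholm_index (Hardy q) X.null (TH_Hardy q a b) = fredholm_index (lp p) Y.null (TH_lp a b)"
      using L by (simp_all add: class_L_def XN YN)
    show "x \<in> X.null" if "x \<in> Hardy q" "fourier_seq x \<in> Y.null" for x
      using Hardy_uniqueness[OF q that(1)] that(2) by (simp add: XN YN)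
    show "\<exists>x\<in>Hardy q. lpnorm p (\<lambda>t. y t - fourier_seq x t) < \<epsilon>" if y: "y \<in> lp p" and e: "0 < \<epsilon>" for y \<epsilon>
    proof -
      have "(\<lambda>n. lpnorm p (\<lambda>k. y k - truncate n y k)) \<longlonglongrightarrow> 0"
        by (rule truncate_tendsto[OF _ y]) (use p in simp)
      from order_tendstoD(2)[OF this e] obtain n where "lpnorm p (\<lambda>k. y k - truncate n y k) < \<epsilon>"
        by (auto dest: eventually_happens)
      then show ?thesis
        using cpoly_Hardy[OF q, of "{..<n}" y] by (intro bexI[of _ "cpoly {..<n} y"]) (simp_all add: fourier_seq_cpoly)
    qed
    show "{cpoly {..<n} \<xi> | n \<xi>. True} \<subseteq> Hardy q" using cpoly_Hardy[OF q] by auto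
    show "\<exists>d\<in>{cpoly {..<n} \<xi> | n \<xi>. True}. Lnorm q (\<lambda>t. x t - d t) < \<epsilon>" if "x \<in> Hardy q" "0 < \<epsilon>" for x \<epsilon>
      using cpoly_dense[OF q that] by blast
    show "(\<lambda>t. fourier_seq (TH_Hardy q a b d) t - TH_lp a b (fourier_seq d) t) \<in> Y.null"
      if "d \<in> {cpoly {..<n} \<xi> | n \<xi>. True}" for d
      using that fourier_seq_TH_Hardy_cpoly[OF p pq q m] by (auto simp: YN fourier_seq_cpoly)
  qed
qed

text \<open>Hausdorff-Young provides some function for each sequence, and E chooses one. The choice
  is linear only modulo null functions, which is all that \<open>bounded_map\<close>
  demands.\<close>

lemma fredholm_pair_inverse_fourier:
  assumes p: "1 < p" and pq: "1 / p + 1 / q = 1" and L: "class_L p q a b" and p2: "p \<le> 2"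
  shows "\<exists>E. fredholm_pair (lp p) (lpnorm p) (Hardy q) (Lnorm q) E
      (TH_lp a b) (TH_Hardy q a b) {truncate n \<xi> | n \<xi>. True} \<and> (\<forall>\<xi>\<in>lp p. fourier_seq (E \<xi>) = \<xi>)"
proof -
  have q: "1 < q" by (rule conjugate_exponent[OF p pq])
  have m: "multiplier p a" "multiplier p b" using L by (simp_all add: class_L_def)
  interpret Y: seminormed_complete "Hardy q" "Lnorm q" by (rule Hardy_seminormed_complete[OF q])
  interpret X: seminormed_complete "lp p" "lpnorm p" by (rule lp_seminormed_complete) (use p in simp)
  have YN: "Y.null = null_T" by (rule Hardy_null[OF q])
  have XN: "X.null = {\<lambda>_. 0}" by (rule lp_null) (use p in simp)
  note L1 = Hardy_imp_L1[OF q]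
  obtain C where C: "\<forall>\<xi>\<in>lp p. \<exists>h\<in>Hardy q. fourier_seq h = \<xi> \<and> Lnorm q h \<le> C * lpnorm p \<xi>"
    using Hausdorff_Young_lp[OF p p2 pq] by blast
  then have "\<forall>\<xi>. \<exists>h. \<xi> \<in> lp p \<longrightarrow> h \<in> Hardy q \<and> fourier_seq h = \<xi> \<and> Lnorm q h \<le> C * lpnorm p \<xi>"
    by blast
  from choice[OF this] obtain E where E: "\<And>\<xi>. \<xi> \<in> lp p \<Longrightarrow> E \<xi> \<in> Hardy q"
    and FE: "\<And>\<xi>. \<xi> \<in> lp p \<Longrightarrow> fourier_seq (E \<xi>) = \<xi>"
    and EC: "\<And>\<xi>. \<xi> \<in> lp p \<Longrightarrow> Lnorm q (E \<xi>) \<le> C * lpnorm p \<xi>" by blast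
  have T: "fredholm_op (Hardy q) Y.null (Lnorm q) (TH_Hardy q a b)"
    "fredholm_op (lp p) X.null (lpnorm p) (TH_lp a b)"
    using L by (simp_all add: class_L_def XN YN)
  interpret T: bounded_map "Hardy q" "Lnorm q" "Hardy q" "Lnorm q" "TH_Hardy q a b"
    using T(1) Y.bounded_op_iff_bounded_map unfolding fredholm_op_def by blast
  have Tp: "TH_lp a b \<xi> \<in> lp p" if "\<xi> \<in> lp p" for \<xi>
    using T(2) that by (simp add: fredholm_op_def bounded_op_def)
  \<comment> \<open>Uniqueness of Fourier coefficients: the identities for sums, scalar multiples
    and truncations reduce to comparing sequences, on which E is undone by
    \<open>FE\<close>.\<close>
  have eqI: "(\<lambda>z. f z - g z) \<in> Y.null"
    if "f \<in> Hardy q" "g \<in> Hardy q" "fourier_seq f = fourier_seq g" for f g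
    unfolding YN using that fourier_seq_diff[OF L1[OF that(1)] L1[OF that(2)]]
    by (intro Hardy_uniqueness[OF q] Y.diff_mem) simp_all
  have Ec: "(\<lambda>z. E (truncate n \<xi>) z - cpoly {..<n} \<xi> z) \<in> Y.null" for n \<xi>
    by (intro eqI E truncate_lp cpoly_Hardy[OF q]) (simp_all add: FE[OF truncate_lp] fourier_seq_cpoly)
  have "fredholm_pair (lp p) (lpnorm p) (Hardy q) (Lnorm q) E
      (TH_lp a b) (TH_Hardy q a b) {truncate n \<xi> | n \<xi>. True}"
  proof
    show "E x \<in> Hardy q" if "x \<in> lp p" for x by (rule E[OF that])
    show "(\<lambda>t. E (\<lambda>s. x s + y s) t - E x t - E y t) \<in> Y.null" if xy: "x \<in> lp p" "y \<in> lp p" for x y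
    proof -
      have "(\<lambda>t. E (\<lambda>s. x s + y s) t - (E x t + E y t)) \<in> Y.null"
        using xy X.add_mem[OF xy] fourier_seq_add[OF L1[OF E[OF xy(1)]] L1[OF E[OF xy(2)]]]
        by (intro eqI E Y.add_mem) (simp_all add: FE)
      then show ?thesis by (simp add: diff_diff_eq)
    qed
    show "(\<lambda>t. E (\<lambda>s. c * x s) t - c * E x t) \<in> Y.null" if x: "x \<in> lp p" for x c
      using x X.scale_mem[OF x, of c] by (intro eqI E Y.scale_mem) (simp_all add: FE fourier_seq_scale)
    show "\<exists>C. \<forall>x\<in>lp p. Lnorm q (E x) \<le> C * lpnorm p x" using EC by blast
    show "fredholm_op (lp p) X.null (lpnorm p) (TH_lp a b)"
      "fredholm_op (Hardy q) Y.null (Lnorm q) (TH_Hardy q a b)" by (fact T)+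
    show "fredholm_index (lp p) X.null (TH_lp a b) = fredholm_index (Hardy q) Y.null (TH_Hardy q a b)"
      using L by (simp add: class_L_def XN YN)
    show "x \<in> X.null" if "x \<in> lp p" "E x \<in> Y.null" for x
      using fourier_seq_null_T[of "E x"] that by (simp add: XN YN FE)
    show "\<exists>x\<in>lp p. Lnorm q (\<lambda>t. y t - E x t) < \<epsilon>" if y: "y \<in> Hardy q" and e: "0 < \<epsilon>" for y \<epsilon>
    proof -
      obtain n \<xi> where n: "Lnorm q (\<lambda>z. y z - cpoly {..<n} \<xi> z) < \<epsilon>" using cpoly_dense[OF q y e] by blast
      have c: "cpoly {..<n} \<xi> \<in> Hardy q" using cpoly_Hardy[OF q] by simp
      have et: "E (truncate n \<xi>) \<in> Hardy q" by (rule E[OF truncate_lp])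
      have "Lnorm q (\<lambda>t. y t - E (truncate n \<xi>) t) < \<epsilon>"
        using Y.nrm_diff_trans[OF y c et] n Y.nrm_diff_commute[OF c et] Y.null_nrm[OF Ec, of n \<xi>] by linarith
      then show ?thesis using truncate_lp by blast
    qed
    show "{truncate n \<xi> | n \<xi>. True} \<subseteq> lp p" using truncate_lp by auto
    show "\<exists>d\<in>{truncate n \<xi> | n \<xi>. True}. lpnorm p (\<lambda>t. x t - d t) < \<epsilon>" if x: "x \<in> lp p" and e: "0 < \<epsilon>" for x \<epsilon>
    proof -
      have "(\<lambda>n. lpnorm p (\<lambda>k. x k - truncate n x k)) \<longlonglongrightarrow> 0"
        by (rule truncate_tendsto[OF _ x]) (use p in simp)
      from order_tendstoD(2)[OF this e] obtain n where "lpnorm p (\<lambda>k. x k - truncate n x k) < \<epsilon>"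
        by (auto dest: eventually_happens)
      then show ?thesis by blast
    qed
    show "(\<lambda>t. E (TH_lp a b d) t - TH_Hardy q a b (E d) t) \<in> Y.null"
      if dD: "d \<in> {truncate n \<xi> | n \<xi>. True}" for d
    proof -
      obtain n \<xi> where d: "d = truncate n \<xi>" using dD by blast
      have c: "cpoly {..<n} \<xi> \<in> Hardy q" using cpoly_Hardy[OF q] by simp
      have dl: "d \<in> lp p" unfolding d by (rule truncate_lp)
      \<comment> \<open>The coefficient formula is available for the polynomial itself, while
        \<open>E d\<close> is only equal to it up to a null function; the two facts below exchange
        one for the other under the operator.\<close>
      have 1: "(\<lambda>t. E (TH_lp a b d) t - TH_Hardy q a b (cpoly {..<n} \<xi>) t) \<in> Y.null"
        using fourier_seq_TH_Hardy_cpoly[OF p pq q m, of n \<xi>] FE[OF Tp[OF dl]]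
        by (intro eqI E Tp dl T.map_mem c) (simp add: d)
      have 2: "(\<lambda>t. TH_Hardy q a b (\<lambda>s. E d s - cpoly {..<n} \<xi> s) t
          - (TH_Hardy q a b (E d) t - TH_Hardy q a b (cpoly {..<n} \<xi>) t)) \<in> Y.null"
        by (rule T.map_diff[OF E[OF dl] c])
      have 3: "TH_Hardy q a b (\<lambda>s. E d s - cpoly {..<n} \<xi> s) \<in> Y.null"
        unfolding d by (rule T.map_null[OF Ec])
      from Y.null_diff[OF 1 Y.null_diff[OF 3 2]] show ?thesis by simp
    qed
  qed
  then show ?thesis using FE by blast
qed

theorem theorem6p3:
  fixes p q :: real and a b :: "complex \<Rightarrow> complex"
  assumes "1 < p" and "1 / p + 1 / q = 1"
    and "class_L p q a b"
  shows "(\<forall>h \<in> ker_op (Hardy q) null_T (TH_Hardy q a b).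
            fourier_seq h \<in> ker_op (lp p) {\<lambda>_. 0} (TH_lp a b))
       \<and> (\<forall>\<xi> \<in> ker_op (lp p) {\<lambda>_. 0} (TH_lp a b).
            \<exists>h \<in> ker_op (Hardy q) null_T (TH_Hardy q a b). fourier_seq h = \<xi>)
       \<and> (\<forall>h1 \<in> ker_op (Hardy q) null_T (TH_Hardy q a b).
          \<forall>h2 \<in> ker_op (Hardy q) null_T (TH_Hardy q a b).
            fourier_seq h1 = fourier_seq h2 \<longrightarrow> (\<lambda>z. h1 z - h2 z) \<in> null_T)
       \<and> (\<exists>C>0. \<forall>h \<in> ker_op (Hardy q) null_T (TH_Hardy q a b).
            lpnorm p (fourier_seq h) \<le> C * Lnorm q h \<and> Lnorm q h \<le> C * lpnorm p (fourier_seq h))"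
proof -
  let ?KH = "ker_op (Hardy q) null_T (TH_Hardy q a b)" and ?Kl = "ker_op (lp p) {\<lambda>_. 0} (TH_lp a b)"
  have q: "1 < q" by (rule conjugate_exponent[OF assms(1,2)])
  interpret H: seminormed_complete "Hardy q" "Lnorm q" by (rule Hardy_seminormed_complete[OF q])
  interpret l: seminormed_complete "lp p" "lpnorm p"
    by (rule lp_seminormed_complete) (use assms(1) in simp)
  have HN: "H.null = null_T" by (rule Hardy_null[OF q])
  have lN: "l.null = {\<lambda>_. 0}" by (rule lp_null) (use assms(1) in simp)
  note L1 = Hardy_imp_L1[OF q]
  have KH: "h \<in> Hardy q" if "h \<in> ?KH" for h using that by (simp add: ker_op_def)
  have Kl: "\<xi> \<in> lp p" if "\<xi> \<in> ?Kl" for \<xi> using that by (simp add: ker_op_def)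
  have inj: "(\<lambda>z. h1 z - h2 z) \<in> null_T" if "h1 \<in> ?KH" "h2 \<in> ?KH" "fourier_seq h1 = fourier_seq h2" for h1 h2
    using that fourier_seq_diff[OF L1[OF KH[OF that(1)]] L1[OF KH[OF that(2)]]]
    by (intro Hardy_uniqueness[OF q] H.diff_mem KH) simp_all
  have main: "(\<forall>h\<in>?KH. fourier_seq h \<in> ?Kl) \<and> (\<forall>\<xi>\<in>?Kl. \<exists>h\<in>?KH. fourier_seq h = \<xi>) \<and>
      (\<exists>A>0. \<exists>B>0. \<forall>h\<in>?KH. lpnorm p (fourier_seq h) \<le> A * Lnorm q h \<and> Lnorm q h \<le> B * lpnorm p (fourier_seq h))"
  proof (cases "2 \<le> p")
    case True
    interpret P: fredholm_pair "Hardy q" "Lnorm q" "lp p" "lpnorm p" fourier_seq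
      "TH_Hardy q a b" "TH_lp a b" "{cpoly {..<n} \<xi> | n \<xi>. True}"
      by (rule fredholm_pair_fourier_seq[OF assms True])
    have "\<exists>h\<in>?KH. fourier_seq h = \<xi>" if x: "\<xi> \<in> ?Kl" for \<xi>
    proof -
      obtain h where h: "h \<in> ?KH" and eq: "(\<lambda>t. fourier_seq h t - \<xi> t) = (\<lambda>_. 0)"
        using P.ker_surj[of \<xi>] x unfolding HN lN by blast
      have "fourier_seq h = \<xi>" using eq by (simp add: fun_eq_iff)
      with h show ?thesis by blast
    qed
    moreover have "fourier_seq h \<in> ?Kl" if "h \<in> ?KH" for h
      using P.ker_map[of h] that unfolding HN lN .
    moreover obtain A where A: "0 < A" "\<And>h. h \<in> Hardy q \<Longrightarrow> lpnorm p (fourier_seq h) \<le> A * Lnorm q h"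
      using P.map_bound_pos by blast
    moreover obtain B where B: "0 < B" "\<forall>h\<in>?KH. Lnorm q h \<le> B * lpnorm p (fourier_seq h)"
      using P.ker_bounded_below unfolding HN by blast
    ultimately show ?thesis using KH by blast
  next
    case False
    then obtain E where "fredholm_pair (lp p) (lpnorm p) (Hardy q) (Lnorm q) E
        (TH_lp a b) (TH_Hardy q a b) {truncate n \<xi> | n \<xi>. True}"
      and FE: "\<And>\<xi>. \<xi> \<in> lp p \<Longrightarrow> fourier_seq (E \<xi>) = \<xi>"
      using fredholm_pair_inverse_fourier[OF assms] by auto
    then interpret P: fredholm_pair "lp p" "lpnorm p" "Hardy q" "Lnorm q" E
      "TH_lp a b" "TH_Hardy q a b" "{truncate n \<xi> | n \<xi>. True}" by simp
    \<comment> \<open>With the inverse transform as embedding the roles are exchanged: surjectivity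
      of E between the kernels shows that \<open>fourier_seq\<close> maps into the kernel on l^p at
      all, and \<open>ker_map\<close> shows that it maps onto it.\<close>
    have onto: "\<exists>\<xi>\<in>?Kl. fourier_seq h = \<xi> \<and> Lnorm q h = Lnorm q (E \<xi>)" if h: "h \<in> ?KH" for h
    proof -
      obtain \<xi> where x: "\<xi> \<in> ?Kl" and eq: "(\<lambda>t. E \<xi> t - h t) \<in> null_T"
        using P.ker_surj[of h] h unfolding HN lN by blast
      have E: "E \<xi> \<in> Hardy q" by (rule P.map_mem[OF Kl[OF x]])
      have "fourier_seq (E \<xi>) = fourier_seq h"
        using fourier_seq_null_T[OF eq] fourier_seq_diff[OF L1[OF E] L1[OF KH[OF h]]]
        by (simp add: fun_eq_iff)
      moreover have "Lnorm q h = Lnorm q (E \<xi>)"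
        using H.nrm_le_diff[OF E KH[OF h]] H.nrm_le_diff[OF KH[OF h] E] H.nrm_diff_commute[OF E KH[OF h]]
          H.null_nrm eq unfolding HN by fastforce
      ultimately show ?thesis using x FE[OF Kl[OF x]] by auto
    qed
    obtain A where A: "0 < A" "\<And>\<xi>. \<xi> \<in> lp p \<Longrightarrow> Lnorm q (E \<xi>) \<le> A * lpnorm p \<xi>"
      using P.map_bound_pos by blast
    obtain B where B: "0 < B" "\<forall>\<xi>\<in>?Kl. lpnorm p \<xi> \<le> B * Lnorm q (E \<xi>)"
      using P.ker_bounded_below unfolding lN by blast
    have "lpnorm p (fourier_seq h) \<le> B * Lnorm q h \<and> Lnorm q h \<le> A * lpnorm p (fourier_seq h)"
      if "h \<in> ?KH" for h
      using onto[OF that] A(2) B(2) Kl by auto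
    moreover have "fourier_seq h \<in> ?Kl" if "h \<in> ?KH" for h using onto[OF that] by auto
    moreover have "\<exists>h\<in>?KH. fourier_seq h = \<xi>" if "\<xi> \<in> ?Kl" for \<xi>
      using P.ker_map[of \<xi>] that FE[OF Kl[OF that]] unfolding HN lN by blast
    ultimately show ?thesis using A(1) B(1) by blast
  qed
  then obtain A B where AB: "0 < A" "0 < B" and
    bounds: "\<And>h. h \<in> ?KH \<Longrightarrow> lpnorm p (fourier_seq h) \<le> A * Lnorm q h \<and> Lnorm q h \<le> B * lpnorm p (fourier_seq h)"
    by blast
  have "lpnorm p (fourier_seq h) \<le> max A B * Lnorm q h \<and> Lnorm q h \<le> max A B * lpnorm p (fourier_seq h)"
    if h: "h \<in> ?KH" for h
  proof -
    have "A * Lnorm q h \<le> max A B * Lnorm q h"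
      by (intro mult_right_mono) (simp_all add: Lnorm_nonneg)
    moreover have "B * lpnorm p (fourier_seq h) \<le> max A B * lpnorm p (fourier_seq h)"
      by (intro mult_right_mono) (simp_all add: lpnorm_def)
    ultimately show ?thesis using bounds[OF h] by linarith
  qed
  moreover have "0 < max A B" using AB by simp
  ultimately have "\<exists>C>0. \<forall>h\<in>?KH. lpnorm p (fourier_seq h) \<le> C * Lnorm q h \<and>
      Lnorm q h \<le> C * lpnorm p (fourier_seq h)" by blast
  with main inj show ?thesis by blast
qed

end
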